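(* Consider the empirical Bayes $g$-prior model and true parameters $\{(\beta_{0n},\sigma_0^2),n\ge1\}$ described in the context. Posterior consistency under the $\ell_\infty$ norm occurs, i.e. the empirical Bayes posterior probability of $\{\|\beta_n-\beta_{0n}\|_\infty>\epsilon\}$ given $(\hat\beta_n,S_n)$ tends to $0$ almost surely under $P_0$ for every $\epsilon>0$, if and only if either $\alpha=0$ or there do not exist a subsequence $k_n$ of $n$ and a constant $A>0$ such that $\|\gamma_{k_n}-\beta_{0k_n}\|_2^2\to A$ and $\|\gamma_{k_n}-\beta_{0k_n}\|_\infty\nrightarrow0$.
   Context: Linear model: for each $n\ge1$, $Y_n=X_n\beta_n+e_n$, where $X_n$ is a nonrandom $n\times p_n$ matrix of full column rank, $\beta_n\in\mathbb{R}^{p_n}$, and $e_n\sim N_n(0,\sigma^2 I_n)$. The sequence $p_n$ is nondecreasing with $p_n<n$ and $p_n/n\to\alpha$, where $0\le\alpha<1$. The eigenvalues $\lambda_{n,1},\dots,\lambda_{n,p_n}$ of $n(X_n^TX_n)^{-1}$ satisfy $0<\lambda_{\min}\le\inf_{n,i}\lambda_{n,i}\le\sup_{n,i}\lambda_{n,i}\le\lambda_{\max}<\infty$ for some constants $\lambda_{\min},\lambda_{\max}$. Let $\hat\beta_n=(X_n^TX_n)^{-1}X_n^TY_n$ and $S_n=\|Y_n-X_n\hat\beta_n\|_2^2$; given $(\beta_n,\sigma^2)$ these are independent with $\hat\beta_n\sim N_{p_n}(\beta_n,\sigma^2(X_n^TX_n)^{-1})$ and $S_n\sim\sigma^2\chi^2_{n-p_n}$.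 Norms: $\|x\|_\infty=\max_i|x_i|$, $\|x\|_2=(\sum_i x_i^2)^{1/2}$. Non-hierarchical $g$-prior model with parameter $g$: given $(\beta_n,\sigma^2)$, the data $\hat\beta_n$ and $S_n$ are independent with $\hat\beta_n\sim N_{p_n}(\beta_n,\sigma^2(X_n^TX_n)^{-1})$ and $S_n\sim\sigma^2\chi^2_{n-p_n}$, with priors $\beta_n\mid\sigma^2\sim N_{p_n}(\gamma_n,g\sigma^2(X_n^TX_n)^{-1})$ and $\sigma^2\sim\mathrm{InverseGamma}(a/2,b/2)$ (density proportional to $(\sigma^2)^{-a/2-1}e^{-b/(2\sigma^2)}$), with $a\ge-2$, $b\ge0$ constants (improper priors allowed; asymptotic statements concern $n$ large enough that the posterior is proper). Here $\gamma_n\in\mathbb{R}^{p_n}$ is a known nonrandom sequence. In this model the posterior satisfies $\beta_n\mid\sigma^2,\hat\beta_n,S_n\sim N_{p_n}\big(\tfrac{g}{g+1}\hat\beta_n+\tfrac1{g+1}\gamma_n,\ \tfrac{g}{g+1}\sigma^2(X_n^TX_n)^{-1}\big)$. Empirical Bayes model: let $T_n=(\hat\beta_n-\gamma_n)^TX_n^TX_n(\hat\beta_n-\gamma_n)$ and $$\hat g_n^{\mathrm{EB}}=\max\left\{0,\left(\frac{n-p_n+a-2}{S_n+b}\right)\left(\frac{T_n}{p_n}\right)-1\right\}.$$ The empirical Bayes posterior is the posterior of the non-hierarchical model with the data-dependent quantity $\hat g_n^{\mathrm{EB}}$ substituted for $g$ (for $\hat g_n^{\mathrm{EB}}=0$ it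 is degenerate at $\gamma_n$). True distribution $P_0$: $\beta_{0n}\in\mathbb{R}^{p_n}$ ($n\ge1$) and $\sigma_0^2>0$ are fixed, and $P_0$ is the distribution of $\{(\hat\beta_n,S_n),n\ge1\}$ under $Y_n=X_n\beta_{0n}+e_n$, $e_n\sim N_n(0,\sigma_0^2I_n)$, for each $n\ge1$. *)

theory Defs
  imports
    "HOL-Probability.Probability"
    "Jordan_Normal_Form.Gauss_Jordan_Elimination"
    "Jordan_Normal_Form.Char_Poly"
    "Jordan_Normal_Form.DL_Rank"
begin

(* Vectors and matrices are those of Jordan_Normal_Form, since the dimensions vary with n;
   the clashing notation of HOL-Analysis is switched off. *)
unbundle no vec_syntax
unbundle no inner_syntax

definition l2_norm :: "real Matrix.vec \<Rightarrow> real" where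
  "l2_norm v = sqrt (v \<bullet> v)"

(* The inserted 0 only matters in dimension 0. *)
definition linf_norm :: "real Matrix.vec \<Rightarrow> real" where
  "linf_norm v = Max (insert 0 ((\<lambda>i. \<bar>v $ i\<bar>) ` {..<dim_vec v}))"

(* Only applied to invertible matrices. *)
definition inv_mat :: "real mat \<Rightarrow> real mat" where
  "inv_mat A = the (mat_inverse A)"

(* Lebesgue measure on carrier_vec m. *)
definition vec_lborel :: "nat \<Rightarrow> real Matrix.vec measure" where
  "vec_lborel m = embed_measure (PiM {..<m} (\<lambda>_. lborel)) (Matrix.vec m)"

(* Density of N(mu, Sigma) for positive definite Sigma. *)
definition mvn_density :: "real Matrix.vec \<Rightarrow> real mat \<Rightarrow> real Matrix.vec \<Rightarrow> real" where
  "mvn_density \<mu> \<Sigma> x =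
     exp (- ((x - \<mu>) \<bullet> (inv_mat \<Sigma> *\<^sub>v (x - \<mu>))) / 2)
       / sqrt ((2 * pi) ^ dim_vec \<mu> * Determinant.det \<Sigma>)"

definition chi_square_density :: "real \<Rightarrow> real \<Rightarrow> real" where
  "chi_square_density k x =
     (if 0 < x then x powr (k / 2 - 1) * exp (- x / 2) / (2 powr (k / 2) * Gamma (k / 2)) else 0)"

(* Inverse gamma density up to its normalizing constant, which need not exist (improper priors)
   and cancels in the posterior. *)
definition inverse_gamma_kernel :: "real \<Rightarrow> real \<Rightarrow> real \<Rightarrow> real" where
  "inverse_gamma_kernel a b v =
     (if 0 < v then v powr (- a / 2 - 1) * exp (- b / (2 * v)) else 0)"

definition gram_inv :: "real mat \<Rightarrow> real mat" where
  "gram_inv X = inv_mat (transpose_mat X * X)"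

definition ols :: "real mat \<Rightarrow> real Matrix.vec \<Rightarrow> real Matrix.vec" where
  "ols X y = gram_inv X *\<^sub>v (transpose_mat X *\<^sub>v y)"

definition rss :: "real mat \<Rightarrow> real Matrix.vec \<Rightarrow> real" where
  "rss X y = (l2_norm (y - X *\<^sub>v ols X y))\<^sup>2"

(* The prior of beta given sigma^2 = v; for g = 0 the covariance vanishes. *)
definition g_prior :: "real mat \<Rightarrow> real Matrix.vec \<Rightarrow> real \<Rightarrow> real \<Rightarrow> real Matrix.vec measure" where
  "g_prior X \<gamma> g v =
     (if g = 0 then return (vec_lborel (dim_col X)) \<gamma>
      else density (vec_lborel (dim_col X))
             (\<lambda>\<beta>. ennreal (mvn_density \<gamma> ((g * v) \<cdot>\<^sub>m gram_inv X) \<beta>)))"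

(* Likelihood of (beta, sigma^2 = v) at the data (bhat, s): the N(beta, v (X^T X)^{-1}) density
   at bhat times the density at s of v times a chi-square variable with n - p degrees of
   freedom. *)
definition likelihood ::
    "real mat \<Rightarrow> real Matrix.vec \<Rightarrow> real \<Rightarrow> real Matrix.vec \<Rightarrow> real \<Rightarrow> real" where
  "likelihood X bhat s \<beta> v =
     mvn_density \<beta> (v \<cdot>\<^sub>m gram_inv X) bhat
       * (chi_square_density (real (dim_row X) - real (dim_col X)) (s / v) / v)"

(* Integral of the likelihood over {beta in B} with respect to the prior. *)
definition posterior_mass ::
    "real mat \<Rightarrow> real Matrix.vec \<Rightarrow> real \<Rightarrow> real \<Rightarrow> real \<Rightarrow> real Matrix.vec \<Rightarrow> real
      \<Rightarrow> real Matrix.vec set \<Rightarrow> ennreal" where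
  "posterior_mass X \<gamma> a b g bhat s B =
     (\<integral>\<^sup>+ v. ennreal (inverse_gamma_kernel a b v)
        * (\<integral>\<^sup>+ \<beta>. ennreal (likelihood X bhat s \<beta> v) * indicator B \<beta> \<partial>g_prior X \<gamma> g v) \<partial>lborel)"

(* Bayes' formula for the posterior probability of {beta in B}; meaningful when the posterior is
   proper, i.e. when the denominator is neither 0 nor infinite. *)
definition posterior_prob ::
    "real mat \<Rightarrow> real Matrix.vec \<Rightarrow> real \<Rightarrow> real \<Rightarrow> real \<Rightarrow> real Matrix.vec \<Rightarrow> real
      \<Rightarrow> real Matrix.vec set \<Rightarrow> ennreal" where
  "posterior_prob X \<gamma> a b g bhat s B =
     posterior_mass X \<gamma> a b g bhat s B
       / posterior_mass X \<gamma> a b g bhat s (carrier_vec (dim_col X))"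

(* Empirical Bayes estimate of g; for p = 0 the convention 0 / 0 = 0 gives the value 0. *)
definition g_EB :: "real mat \<Rightarrow> real Matrix.vec \<Rightarrow> real \<Rightarrow> real \<Rightarrow> real Matrix.vec \<Rightarrow> real \<Rightarrow> real" where
  "g_EB X \<gamma> a b bhat s =
     (let n = real (dim_row X); p = real (dim_col X);
          T = (bhat - \<gamma>) \<bullet> ((transpose_mat X * X) *\<^sub>v (bhat - \<gamma>))
      in max 0 ((n - p + a - 2) / (s + b) * (T / p) - 1))"

definition EB_posterior_prob ::
    "real mat \<Rightarrow> real Matrix.vec \<Rightarrow> real \<Rightarrow> real \<Rightarrow> real Matrix.vec \<Rightarrow> real
      \<Rightarrow> real Matrix.vec set \<Rightarrow> ennreal" where
  "EB_posterior_prob X \<gamma> a b bhat s B =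
     posterior_prob X \<gamma> a b (g_EB X \<gamma> a b bhat s) bhat s B"

end

theory Submission
  imports Defs "HOL-Real_Asymp.Real_Asymp"
begin

text \<open>Write \<open>z\<close> for the error of the least squares estimate, \<open>d = \<gamma> - \<beta>\<^sub>0\<close>, and \<open>g\<close> for its empirical Bayes
  estimate. The posterior mean differs from \<open>\<beta>\<^sub>0\<close> by \<open>(g z + d) / (g + 1)\<close>, where \<open>\<parallel>z\<parallel>\<^sub>\<infinity> \<longrightarrow> 0\<close> almost
  surely, and a fourth moment bound shows that the posterior concentrates around its mean in the
  maximum norm. So consistency is equivalent to \<open>\<parallel>d\<parallel>\<^sub>\<infinity> / (g + 1) \<longrightarrow> 0\<close>. Since \<open>g + 1\<close> is at least of order
  \<open>n \<parallel>d\<parallel>\<^sub>2\<^sup>2 / p\<close> as soon as \<open>n \<parallel>d\<parallel>\<^sub>2\<^sup>2\<close> dominates the quadratic form of \<open>z\<close>, which is of order \<open>p\<close>, this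
  can fail only if \<open>p\<close> is of order \<open>n\<close> and \<open>\<parallel>d\<parallel>\<^sub>2\<close> stays bounded while \<open>\<parallel>d\<parallel>\<^sub>\<infinity>\<close> does not vanish; in that case
  \<open>g\<close> stays bounded and the bias persists.\<close>

section \<open>Lebesgue measure on coordinate vectors\<close>

text \<open>Each posterior coordinate has variance of order 1/n, so a union bound with second
  moments would only give p/n, which does not vanish for \<alpha> > 0; fourth moments give p/n^2.
  The variance parameter enters this bound through its posterior second moment, of order
  (scale/n)^2, and the scale stays of order n however far \<gamma> lies from
  \<open>\<beta>\<^sub>0\<close>: the quadratic form in it is divided by \<open>g + 1\<close>, which
  grows with that same form. Deviations of the quadratic forms in the errors are Chernoff bounds
  read off from Laplace transforms. Their exponential rates are summable, so Borel-Cantelli applies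
  whatever the dependence between the errors for different n. For the converse the symmetry of the
  posterior is enough: a mean outside the ball leaves at least half of the mass outside. The
  constant A of the criterion arises by compactness: bounded Euclidean distances converge along a
  subsequence, and the limit is positive because they dominate the maximum norm.\<close>

lemma inj_on_vec: "inj_on (Matrix.vec m) (space (PiM {..<m} (\<lambda>_. lborel)))"
proof (rule inj_onI)
  fix x y :: "nat \<Rightarrow> 'a"
  assume x: "x \<in> space (PiM {..<m} (\<lambda>_. lborel))" and y: "y \<in> space (PiM {..<m} (\<lambda>_. lborel))"
    and eq: "Matrix.vec m x = Matrix.vec m y"
  show "x = y"
  proof (rule PiE_ext)
    show "x \<in> PiE {..<m} (\<lambda>_. UNIV)" "y \<in> PiE {..<m} (\<lambda>_. UNIV)"
      using x y by (auto simp: space_PiM)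
    fix i assume "i \<in> {..<m}"
    then show "x i = y i"
      using arg_cong[OF eq, of "\<lambda>v. v $ i"] by simp
  qed
qed

lemma space_vec_lborel [simp]: "space (vec_lborel m) = carrier_vec m"
proof -
  have "x \<in> Matrix.vec m ` space (PiM {..<m} (\<lambda>_. lborel :: real measure))" if "x \<in> carrier_vec m" for x
  proof
    show "x = Matrix.vec m (\<lambda>i\<in>{..<m}. x $ i)"
      using that by auto
  qed (auto simp: space_PiM)
  then show ?thesis
    by (auto simp: vec_lborel_def space_embed_measure)
qed

lemma measurable_vec_index [measurable]:
  "i < m \<Longrightarrow> (\<lambda>x. x $ i) \<in> borel_measurable (vec_lborel m)"
  unfolding vec_lborel_def
  by (rule measurable_embed_measure1) simp

lemma measurable_vec_lborelI:
  assumes "\<And>x. x \<in> space N \<Longrightarrow> f x \<in> carrier_vec m"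
    and [measurable]: "\<And>i. i < m \<Longrightarrow> (\<lambda>x. f x $ i) \<in> borel_measurable N"
  shows "f \<in> measurable N (vec_lborel m)"
proof -
  \<comment> \<open>Restricting the coordinate function to \<open>{..<m}\<close> lands in the
    extensional product space, the domain of the embedding, and leaves the vector unchanged.\<close>
  have "(\<lambda>x. Matrix.vec m (\<lambda>i\<in>{..<m}. f x $ i)) \<in> measurable N (vec_lborel m)"
    unfolding vec_lborel_def
    by (rule measurable_compose[OF _ measurable_embed_measure2'[OF inj_on_vec]])
       (rule measurable_restrict, simp)
  moreover have "Matrix.vec m (\<lambda>i\<in>{..<m}. f x $ i) = f x" if "x \<in> space N" for x
    using assms(1)[OF that] by auto
  ultimately show ?thesis
    using measurable_cong[of N "\<lambda>x. Matrix.vec m (\<lambda>i\<in>{..<m}. f x $ i)" f] by simp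
qed

lemma measurable_vec_lborelD:
  "f \<in> measurable N (vec_lborel m) \<Longrightarrow> x \<in> space N \<Longrightarrow> f x \<in> carrier_vec m"
  using measurable_space[of f N "vec_lborel m" x] by simp

lemma measurable_scalar_prod:
  assumes [measurable]: "f \<in> measurable N (vec_lborel m)" "g \<in> measurable N (vec_lborel m)"
  shows "(\<lambda>x. f x \<bullet> g x) \<in> borel_measurable N"
proof -
  have "(\<lambda>x. \<Sum>i<m. f x $ i * g x $ i) \<in> borel_measurable N"
    by measurable
  moreover have "f x \<bullet> g x = (\<Sum>i<m. f x $ i * g x $ i)" if "x \<in> space N" for x
    using measurable_vec_lborelD[OF assms(2) that]
    by (simp add: scalar_prod_def atLeast0LessThan)
  ultimately show ?thesis
    by (subst measurable_cong)
qed

lemma measurable_mult_mat_vec: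
  assumes A: "A \<in> carrier_mat n m" and f [measurable]: "f \<in> measurable N (vec_lborel m)"
  shows "(\<lambda>x. A *\<^sub>v f x) \<in> measurable N (vec_lborel n)"
proof (rule measurable_vec_lborelI)
  fix i assume i: "i < n"
  have "(\<lambda>x. row A i \<bullet> f x) \<in> borel_measurable N"
    by (rule measurable_scalar_prod[OF _ f]) (use A in auto)
  then show "(\<lambda>x. (A *\<^sub>v f x) $ i) \<in> borel_measurable N"
    using A i by simp
qed (use A measurable_vec_lborelD[OF f] in auto)

lemma measurable_vec_add:
  assumes f [measurable]: "f \<in> measurable N (vec_lborel m)" and g [measurable]: "g \<in> measurable N (vec_lborel m)"
  shows "(\<lambda>x. f x + g x) \<in> measurable N (vec_lborel m)"
proof (rule measurable_vec_lborelI)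
  fix i assume i: "i < m"
  have "(\<lambda>x. f x $ i + g x $ i) \<in> borel_measurable N"
    using i by measurable
  moreover have "(f x + g x) $ i = f x $ i + g x $ i" if "x \<in> space N" for x
    using measurable_vec_lborelD[OF g that] i by simp
  ultimately show "(\<lambda>x. (f x + g x) $ i) \<in> borel_measurable N"
    by (subst measurable_cong)
qed (use measurable_vec_lborelD[OF g] measurable_vec_lborelD[OF f] in auto)

lemma measurable_vec_smult:
  assumes f [measurable]: "f \<in> measurable N (vec_lborel m)"
  shows "(\<lambda>x. c \<cdot>\<^sub>v f x) \<in> measurable N (vec_lborel m)"
proof (rule measurable_vec_lborelI)
  fix i assume i: "i < m"
  have "(\<lambda>x. c * f x $ i) \<in> borel_measurable N"
    using i by measurable
  moreover have "(c \<cdot>\<^sub>v f x) $ i = c * f x $ i" if "x \<in> space N" for x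
    using measurable_vec_lborelD[OF f that] i by simp
  ultimately show "(\<lambda>x. (c \<cdot>\<^sub>v f x) $ i) \<in> borel_measurable N"
    by (subst measurable_cong)
qed (use measurable_vec_lborelD[OF f] in auto)

lemma measurable_vec_minus:
  assumes f [measurable]: "f \<in> measurable N (vec_lborel m)" and g [measurable]: "g \<in> measurable N (vec_lborel m)"
  shows "(\<lambda>x. f x - g x) \<in> measurable N (vec_lborel m)"
proof (rule measurable_vec_lborelI)
  fix i assume i: "i < m"
  have "(\<lambda>x. f x $ i - g x $ i) \<in> borel_measurable N"
    using i by measurable
  moreover have "(f x - g x) $ i = f x $ i - g x $ i" if "x \<in> space N" for x
    using measurable_vec_lborelD[OF g that] i by simp
  ultimately show "(\<lambda>x. (f x - g x) $ i) \<in> borel_measurable N"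
    by (subst measurable_cong)
qed (use measurable_vec_lborelD[OF g] measurable_vec_lborelD[OF f] in auto)

lemma measurable_vec_ident: "(\<lambda>x. x) \<in> measurable (vec_lborel m) (vec_lborel m)"
  by simp

lemma measurable_vec_const: "c \<in> carrier_vec m \<Longrightarrow> (\<lambda>x. c) \<in> measurable N (vec_lborel m)"
  by simp

lemmas measurable_vec_intros =
  measurable_scalar_prod measurable_mult_mat_vec measurable_vec_add measurable_vec_smult
  measurable_vec_minus measurable_vec_ident measurable_vec_const

interpretation lborel_prod: product_sigma_finite "\<lambda>_::nat. lborel :: real measure"
  by standard

lemma nn_integral_vec_lborel:
  "f \<in> borel_measurable (vec_lborel m) \<Longrightarrow>
    (\<integral>\<^sup>+x. f x \<partial>vec_lborel m) = (\<integral>\<^sup>+x. f (Matrix.vec m x) \<partial>PiM {..<m} (\<lambda>_. lborel))"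
  unfolding vec_lborel_def by (rule nn_integral_embed_measure'[OF inj_on_vec])

text \<open>Tonelli's theorem in \<open>projection_mgf\<close> rests on this. The embedding
  preserves measures, so it carries over a countable cover of the product space by sets of finite
  measure.\<close>

lemma sigma_finite_vec_lborel: "sigma_finite_measure (vec_lborel m)"
proof -
  interpret P: finite_product_sigma_finite "\<lambda>_::nat. lborel :: real measure" "{..<m}"
    by standard simp
  obtain A :: "(nat \<Rightarrow> real) set set" where A: "countable A" "A \<subseteq> sets (PiM {..<m} (\<lambda>_. lborel))"
    "\<Union>A = space (PiM {..<m} (\<lambda>_. lborel))" "\<And>X. X \<in> A \<Longrightarrow> emeasure (PiM {..<m} (\<lambda>_. lborel)) X \<noteq> \<infinity>"
    using P.sigma_finite_countable by blast
  show ?thesis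
  proof (rule sigma_finite_measure.intro, intro exI[of _ "(`) (Matrix.vec m) ` A"] conjI ballI)
    show "(`) (Matrix.vec m) ` A \<subseteq> sets (vec_lborel m)"
      using A(2) by (auto simp: vec_lborel_def intro!: in_sets_embed_measure)
    show "\<Union> ((`) (Matrix.vec m) ` A) = space (vec_lborel m)"
      unfolding vec_lborel_def space_embed_measure A(3)[symmetric] by blast
    fix B assume "B \<in> (`) (Matrix.vec m) ` A"
    then obtain C where "C \<in> A" "B = Matrix.vec m ` C"
      by blast
    then show "emeasure (vec_lborel m) B \<noteq> \<infinity>"
      using A(2,4) unfolding vec_lborel_def
      by (subst \<open>B = _\<close>, subst emeasure_embed_measure_image'[OF inj_on_vec]) auto
  qed (use A(1) in auto)
qed

text \<open>A measure on the product is determined by its values on boxes, and there the claim is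
  the one-dimensional affine rule in each coordinate; the factors |t| multiply up to the power
  \<open>card I\<close>.\<close>

lemma PiM_lborel_affine:
  fixes t :: real and c :: "nat \<Rightarrow> real"
  assumes I: "finite I" and t: "t \<noteq> 0"
  shows "density (distr (PiM I (\<lambda>_. lborel)) (PiM I (\<lambda>_. borel)) (\<lambda>x. \<lambda>i\<in>I. c i + t * x i))
           (\<lambda>_. ennreal (\<bar>t\<bar> ^ card I)) = PiM I (\<lambda>_. lborel)"
proof (rule lborel_prod.PiM_eqI[OF I])
  show "sets (density (distr (PiM I (\<lambda>_. lborel)) (PiM I (\<lambda>_. borel)) (\<lambda>x. \<lambda>i\<in>I. c i + t * x i))
           (\<lambda>_. ennreal (\<bar>t\<bar> ^ card I))) = sets (PiM I (\<lambda>_. lborel :: real measure))"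
    unfolding sets_density sets_distr by (intro sets_PiM_cong) simp_all
next
  fix A :: "nat \<Rightarrow> real set" assume A: "\<And>i. i \<in> I \<Longrightarrow> A i \<in> sets lborel"
  have meas: "(\<lambda>x. \<lambda>i\<in>I. c i + t * x i) \<in> measurable (PiM I (\<lambda>_. lborel)) (PiM I (\<lambda>_. borel))"
    by measurable
  have AP: "PiE I A \<in> sets (PiM I (\<lambda>_. borel))"
    using A I by (intro sets_PiM_I_finite) auto
  have AP': "PiE I A \<in> sets (distr (PiM I (\<lambda>_. lborel)) (PiM I (\<lambda>_. borel)) (\<lambda>x. \<lambda>i\<in>I. c i + t * x i))"
    using AP by simp
  have one: "ennreal \<bar>t\<bar> * emeasure lborel ((\<lambda>y. c i + t * y) -` A i) = emeasure lborel (A i)" if "i \<in> I" for i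
  proof -
    have Ai: "A i \<in> sets borel"
      using A[OF that] by simp
    have "emeasure lborel (A i) = emeasure (density (distr lborel borel (\<lambda>y. c i + t * y)) (\<lambda>_. ennreal \<bar>t\<bar>)) (A i)"
      using lborel_real_affine[OF t, of "c i"] by simp
    also have "\<dots> = ennreal \<bar>t\<bar> * emeasure (distr lborel borel (\<lambda>y. c i + t * y)) (A i)"
      using Ai by (subst emeasure_density_const) auto
    also have "\<dots> = ennreal \<bar>t\<bar> * emeasure lborel ((\<lambda>y. c i + t * y) -` A i)"
      using Ai by (subst emeasure_distr) auto
    finally show ?thesis ..
  qed
  have "emeasure (density (distr (PiM I (\<lambda>_. lborel)) (PiM I (\<lambda>_. borel)) (\<lambda>x. \<lambda>i\<in>I. c i + t * x i))
           (\<lambda>_. ennreal (\<bar>t\<bar> ^ card I))) (PiE I A) =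
        ennreal (\<bar>t\<bar> ^ card I) *
          emeasure (PiM I (\<lambda>_. lborel)) ((\<lambda>x. \<lambda>i\<in>I. c i + t * x i) -` PiE I A \<inter> space (PiM I (\<lambda>_. lborel)))"
    using AP' by (subst emeasure_density_const[OF AP'], subst emeasure_distr[OF meas AP]) simp
  also have "(\<lambda>x. \<lambda>i\<in>I. c i + t * x i) -` PiE I A \<inter> space (PiM I (\<lambda>_. lborel)) =
      PiE I (\<lambda>i. (\<lambda>y. c i + t * y) -` A i)"
    by (auto simp: space_PiM PiE_iff)
  also have "emeasure (PiM I (\<lambda>_. lborel)) \<dots> = (\<Prod>i\<in>I. emeasure lborel ((\<lambda>y. c i + t * y) -` A i))"
  proof (rule lborel_prod.emeasure_PiM[OF I])
    fix i assume "i \<in> I"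
    then have "A i \<in> sets borel"
      using A by simp
    then have "(\<lambda>y. c i + t * y) -` A i \<inter> space borel \<in> sets borel"
      by (intro measurable_sets[of _ borel borel]) auto
    then show "(\<lambda>y. c i + t * y) -` A i \<in> sets lborel"
      by simp
  qed
  also have "ennreal (\<bar>t\<bar> ^ card I) * (\<Prod>i\<in>I. emeasure lborel ((\<lambda>y. c i + t * y) -` A i)) =
      (\<Prod>i\<in>I. ennreal \<bar>t\<bar> * emeasure lborel ((\<lambda>y. c i + t * y) -` A i))"
    by (simp add: prod.distrib ennreal_power)
  also have "\<dots> = (\<Prod>i\<in>I. emeasure lborel (A i))"
    by (rule prod.cong) (use one in auto)
  finally show "emeasure (density (distr (PiM I (\<lambda>_. lborel)) (PiM I (\<lambda>_. borel)) (\<lambda>x. \<lambda>i\<in>I. c i + t * x i))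
           (\<lambda>_. ennreal (\<bar>t\<bar> ^ card I))) (PiE I A) = (\<Prod>i\<in>I. emeasure lborel (A i))" .
qed

text \<open>Translations, scalar dilations and the reflection \<open>t = -1\<close> are the only
  substitutions made below, so the Jacobian is always a power of |t|.\<close>

lemma nn_integral_vec_affine:
  assumes t: "t \<noteq> 0" and c: "c \<in> carrier_vec m" and f [measurable]: "f \<in> borel_measurable (vec_lborel m)"
  shows "ennreal (\<bar>t\<bar> ^ m) * (\<integral>\<^sup>+x. f (c + t \<cdot>\<^sub>v x) \<partial>vec_lborel m) = (\<integral>\<^sup>+x. f x \<partial>vec_lborel m)"
proof -
  let ?P = "PiM {..<m} (\<lambda>_. lborel :: real measure)"
  let ?T = "\<lambda>x. \<lambda>i\<in>{..<m}. c $ i + t * x i"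
  have [measurable]: "(\<lambda>x. c + t \<cdot>\<^sub>v x) \<in> measurable (vec_lborel m) (vec_lborel m)"
    by (intro measurable_vec_intros c)
  have [measurable]: "?T \<in> measurable ?P (PiM {..<m} (\<lambda>_. borel))"
    by measurable
  have fv [measurable]: "(\<lambda>x. f (Matrix.vec m x)) \<in> borel_measurable ?P"
    unfolding vec_lborel_def
    by (rule measurable_compose[OF measurable_embed_measure2'[OF inj_on_vec]])
       (use f in \<open>simp add: vec_lborel_def\<close>)
  have fv' [measurable]: "(\<lambda>x. f (Matrix.vec m x)) \<in> borel_measurable (PiM {..<m} (\<lambda>_. borel))"
    using fv by (subst measurable_cong_sets[where M'="?P" and N'=borel]) (auto intro!: sets_PiM_cong)
  have "(\<integral>\<^sup>+x. f x \<partial>vec_lborel m) = (\<integral>\<^sup>+x. f (Matrix.vec m x) \<partial>?P)"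
    by (rule nn_integral_vec_lborel) simp
  also have "\<dots> = (\<integral>\<^sup>+x. f (Matrix.vec m x) \<partial>density (distr ?P (PiM {..<m} (\<lambda>_. borel)) ?T) (\<lambda>_. ennreal (\<bar>t\<bar> ^ m)))"
    using PiM_lborel_affine[OF _ t, of "{..<m}" "\<lambda>i. c $ i"] by simp
  also have "\<dots> = (\<integral>\<^sup>+x. ennreal (\<bar>t\<bar> ^ m) * f (Matrix.vec m (?T x)) \<partial>?P)"
    by (subst nn_integral_density) (auto simp: nn_integral_distr)
  also have "\<dots> = ennreal (\<bar>t\<bar> ^ m) * (\<integral>\<^sup>+x. f (Matrix.vec m (?T x)) \<partial>?P)"
    by (subst nn_integral_cmult) auto
  also have "(\<integral>\<^sup>+x. f (Matrix.vec m (?T x)) \<partial>?P) = (\<integral>\<^sup>+x. f (c + t \<cdot>\<^sub>v Matrix.vec m x) \<partial>?P)"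
  proof (rule nn_integral_cong)
    fix x :: "nat \<Rightarrow> real"
    have "Matrix.vec m (?T x) = c + t \<cdot>\<^sub>v Matrix.vec m x"
      using c by (intro eq_vecI) auto
    then show "f (Matrix.vec m (?T x)) = f (c + t \<cdot>\<^sub>v Matrix.vec m x)"
      by simp
  qed
  also have "\<dots> = (\<integral>\<^sup>+x. f (c + t \<cdot>\<^sub>v x) \<partial>vec_lborel m)"
    by (rule nn_integral_vec_lborel[symmetric]) measurable
  finally show ?thesis ..
qed

section \<open>Spherical Gaussian integrals\<close>

lemma nn_integral_gaussian_real:
  assumes c: "0 < c"
  shows "(\<integral>\<^sup>+x. ennreal (exp (- (c * x\<^sup>2) / 2)) \<partial>lborel) = ennreal (sqrt (2 * pi / c))"
proof -
  have *: "ennreal (exp (- (c * x\<^sup>2) / 2)) =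
      ennreal (sqrt (2 * pi / c)) * ennreal (normal_density 0 (1 / sqrt c) x)" for x
  proof -
    have "normal_density 0 (1 / sqrt c) x = 1 / sqrt (2 * pi / c) * exp (- (c * x\<^sup>2) / 2)"
      using c by (simp add: normal_density_def power_divide mult.commute)
    moreover have "0 < sqrt (2 * pi / c)"
      using c by simp
    ultimately show ?thesis
      using c by (simp flip: ennreal_mult)
  qed
  have "(\<integral>\<^sup>+x. ennreal (exp (- (c * x\<^sup>2) / 2)) \<partial>lborel) =
      (\<integral>\<^sup>+x. ennreal (sqrt (2 * pi / c)) * ennreal (normal_density 0 (1 / sqrt c) x) \<partial>lborel)"
    by (rule nn_integral_cong) (rule *)
  also have "\<dots> = ennreal (sqrt (2 * pi / c)) * (\<integral>\<^sup>+x. ennreal (normal_density 0 (1 / sqrt c) x) \<partial>lborel)"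
    by (rule nn_integral_cmult) simp
  also have "(\<integral>\<^sup>+x. ennreal (normal_density 0 (1 / sqrt c) x) \<partial>lborel) = 1"
    using c prob_space.emeasure_space_1[OF prob_space_normal_density[of "1 / sqrt c" 0]]
    by (simp add: emeasure_density)
  finally show ?thesis
    by simp
qed

lemma nn_integral_gaussian_vec:
  assumes c: "0 < c"
  shows "(\<integral>\<^sup>+x. ennreal (exp (- (c * (x \<bullet> x)) / 2)) \<partial>vec_lborel m) = ennreal (sqrt (2 * pi / c) ^ m)"
proof -
  have [measurable]: "(\<lambda>x. x \<bullet> x) \<in> borel_measurable (vec_lborel m)"
    by (rule measurable_scalar_prod[OF measurable_vec_ident measurable_vec_ident])
  have "(\<integral>\<^sup>+x. ennreal (exp (- (c * (x \<bullet> x)) / 2)) \<partial>vec_lborel m) =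
      (\<integral>\<^sup>+x. ennreal (exp (- (c * (Matrix.vec m x \<bullet> Matrix.vec m x)) / 2)) \<partial>PiM {..<m} (\<lambda>_. lborel))"
    by (rule nn_integral_vec_lborel) measurable
  also have "\<dots> = (\<integral>\<^sup>+x. (\<Prod>i<m. ennreal (exp (- (c * (x i)\<^sup>2) / 2))) \<partial>PiM {..<m} (\<lambda>_. lborel))"
  proof (rule nn_integral_cong)
    fix x :: "nat \<Rightarrow> real"
    have "- (c * (Matrix.vec m x \<bullet> Matrix.vec m x)) / 2 = (\<Sum>i<m. - (c * (x i)\<^sup>2) / 2)"
      by (simp add: scalar_prod_def atLeast0LessThan power2_eq_square sum_distrib_left
          sum_negf flip: sum_divide_distrib)
    then show "ennreal (exp (- (c * (Matrix.vec m x \<bullet> Matrix.vec m x)) / 2)) =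
        (\<Prod>i<m. ennreal (exp (- (c * (x i)\<^sup>2) / 2)))"
      by (simp only: exp_sum finite_lessThan) (simp add: prod_ennreal)
  qed
  also have "\<dots> = (\<Prod>i<m. \<integral>\<^sup>+x. ennreal (exp (- (c * x\<^sup>2) / 2)) \<partial>lborel)"
    by (rule lborel_prod.product_nn_integral_prod) auto
  also have "\<dots> = ennreal (sqrt (2 * pi / c) ^ m)"
    using c by (simp only: nn_integral_gaussian_real prod_constant card_lessThan) (simp add: ennreal_power)
  finally show ?thesis .
qed

section \<open>Quadratic forms and norms\<close>

lemma scalar_prod_self_ge_0: "0 \<le> x \<bullet> (x :: real Matrix.vec)"
  by (simp add: scalar_prod_def sum_nonneg)

lemma sq_index_le_scalar_prod_self: "i < dim_vec x \<Longrightarrow> (x $ i)\<^sup>2 \<le> x \<bullet> (x :: real Matrix.vec)"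
  unfolding scalar_prod_def power2_eq_square
  by (rule member_le_sum) auto

lemma scalar_prod_self_eq_0_iff:
  assumes "x \<in> carrier_vec n"
  shows "x \<bullet> (x :: real Matrix.vec) = 0 \<longleftrightarrow> x = 0\<^sub>v n"
proof
  assume *: "x \<bullet> x = 0"
  show "x = 0\<^sub>v n"
  proof (rule eq_vecI)
    fix i assume "i < dim_vec (0\<^sub>v n :: real Matrix.vec)"
    then show "x $ i = 0\<^sub>v n $ i"
      using sq_index_le_scalar_prod_self[of i x] assms * by auto
  qed (use assms in auto)
qed (use assms in auto)

lemma symmetric_index:
  assumes "A \<in> carrier_mat n n" "transpose_mat A = A" "i < n" "j < n"
  shows "A $$ (j, i) = A $$ (i, j)"
  using assms by (metis carrier_matD index_transpose_mat(1))

lemma symmetric_scalar_prod: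
  assumes "(A :: real mat) \<in> carrier_mat n n" "transpose_mat A = A" "x \<in> carrier_vec n" "y \<in> carrier_vec n"
  shows "x \<bullet> (A *\<^sub>v y) = y \<bullet> (A *\<^sub>v x)"
  using transpose_vec_mult_scalar[OF assms(1,4,3)] assms comm_scalar_prod[of "A *\<^sub>v x" n y] by simp

lemma quadratic_form_add:
  assumes A: "(A :: real mat) \<in> carrier_mat n n" and sym: "transpose_mat A = A"
    and x: "x \<in> carrier_vec n" and y: "y \<in> carrier_vec n"
  shows "(x + t \<cdot>\<^sub>v y) \<bullet> (A *\<^sub>v (x + t \<cdot>\<^sub>v y)) =
    x \<bullet> (A *\<^sub>v x) + 2 * t * (x \<bullet> (A *\<^sub>v y)) + t\<^sup>2 * (y \<bullet> (A *\<^sub>v y))"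
proof -
  have Av: "A *\<^sub>v x \<in> carrier_vec n" "A *\<^sub>v y \<in> carrier_vec n"
    using A x y by auto
  have "A *\<^sub>v (x + t \<cdot>\<^sub>v y) = A *\<^sub>v x + t \<cdot>\<^sub>v (A *\<^sub>v y)"
    using A x y by (simp add: mult_add_distrib_mat_vec[of _ n n] mult_mat_vec[of _ n n])
  then show ?thesis
    using Av x y symmetric_scalar_prod[OF A sym x y]
    by (simp add: add_scalar_prod_distrib[of _ n] scalar_prod_add_distrib[of _ n] algebra_simps power2_eq_square)
qed

text \<open>The form along the line x + t y is a nonnegative polynomial in t. Since A is only
  semidefinite, its leading coefficient c may vanish; otherwise the minimizer t = -b/c gives the
  inequality.\<close>

lemma psd_cauchy_schwarz:
  assumes A: "(A :: real mat) \<in> carrier_mat n n" and sym: "transpose_mat A = A"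
    and psd: "\<And>x. x \<in> carrier_vec n \<Longrightarrow> 0 \<le> x \<bullet> (A *\<^sub>v x)"
    and x: "x \<in> carrier_vec n" and y: "y \<in> carrier_vec n"
  shows "(x \<bullet> (A *\<^sub>v y))\<^sup>2 \<le> (x \<bullet> (A *\<^sub>v x)) * (y \<bullet> (A *\<^sub>v y))"
proof -
  define a b c where "a = x \<bullet> (A *\<^sub>v x)" and "b = x \<bullet> (A *\<^sub>v y)" and "c = y \<bullet> (A *\<^sub>v y)"
  have pos: "0 \<le> a + 2 * t * b + t\<^sup>2 * c" for t
    unfolding a_def b_def c_def quadratic_form_add[OF A sym x y, symmetric]
    by (rule psd) (use x y in auto)
  have "0 \<le> c"
    unfolding c_def by (rule psd[OF y])
  show ?thesis
    unfolding a_def[symmetric] b_def[symmetric] c_def[symmetric]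
  proof (cases "c = 0")
    case True
    have "b = 0"
    proof (rule ccontr)
      assume "b \<noteq> 0"
      \<comment> \<open>With c = 0 the polynomial is affine, and this t would give it the value
        -1.\<close>
      then have "a + 2 * (- (a + 1) / (2 * b)) * b = - 1"
        by (simp add: field_simps)
      then show False
        using pos[of "- (a + 1) / (2 * b)"] True by simp
    qed
    then show "b\<^sup>2 \<le> a * c"
      using True by simp
  next
    case False
    then have c: "0 < c"
      using \<open>0 \<le> c\<close> by simp
    have "a + 2 * (- b / c) * b + (- b / c)\<^sup>2 * c = a - b\<^sup>2 / c"
      using c by (simp add: field_simps power2_eq_square)
    then have "b\<^sup>2 / c \<le> a"
      using pos[of "- b / c"] by simp
    then show "b\<^sup>2 \<le> a * c"
      using c by (simp add: field_simps)
  qed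
qed

text \<open>Cauchy-Schwarz for the form of A, applied to y = A x and x, bounds (y . y)^2 by (y . A
  y)(x . A x); after the bound K on the first factor one y . y cancels. This plays the part of the
  spectral inequality A^2 \<le> K A.\<close>

lemma psd_norm_image_le:
  assumes A: "(A :: real mat) \<in> carrier_mat n n" and sym: "transpose_mat A = A"
    and psd: "\<And>x. x \<in> carrier_vec n \<Longrightarrow> 0 \<le> x \<bullet> (A *\<^sub>v x)"
    and K: "\<And>x. x \<in> carrier_vec n \<Longrightarrow> x \<bullet> (A *\<^sub>v x) \<le> K * (x \<bullet> x)"
    and x: "x \<in> carrier_vec n"
  shows "(A *\<^sub>v x) \<bullet> (A *\<^sub>v x) \<le> K * (x \<bullet> (A *\<^sub>v x))"
proof -
  define y where "y = A *\<^sub>v x"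
  have y: "y \<in> carrier_vec n"
    using A x by (simp add: y_def)
  have "(y \<bullet> y)\<^sup>2 = (y \<bullet> (A *\<^sub>v x))\<^sup>2"
    by (simp add: y_def)
  also have "\<dots> \<le> (y \<bullet> (A *\<^sub>v y)) * (x \<bullet> (A *\<^sub>v x))"
    by (rule psd_cauchy_schwarz[OF A sym psd y x])
  also have "\<dots> \<le> K * (y \<bullet> y) * (x \<bullet> (A *\<^sub>v x))"
    by (rule mult_right_mono[OF K[OF y] psd[OF x]])
  finally have *: "(y \<bullet> y) * (y \<bullet> y) \<le> (y \<bullet> y) * (K * (x \<bullet> (A *\<^sub>v x)))"
    by (simp add: power2_eq_square mult_ac)
  show ?thesis
  proof (cases "y \<bullet> y = 0")
    case True
    then have "y = 0\<^sub>v n"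
      using scalar_prod_self_eq_0_iff[OF y] by simp
    then have "x \<bullet> (A *\<^sub>v x) = 0"
      using x by (simp add: y_def[symmetric])
    then show ?thesis
      using True by (simp add: y_def)
  next
    case False
    then have "0 < y \<bullet> y"
      using scalar_prod_self_ge_0[of y] by simp
    then show ?thesis
      using * mult_le_cancel_left_pos unfolding y_def by blast
  qed
qed

lemma quadratic_form_bounded:
  assumes A: "(A :: real mat) \<in> carrier_mat n n"
  obtains K where "0 \<le> K" "\<And>x. x \<in> carrier_vec n \<Longrightarrow> \<bar>x \<bullet> (A *\<^sub>v x)\<bar> \<le> K * (x \<bullet> x)"
proof
  define K where "K = (\<Sum>i<n. \<Sum>j<n. \<bar>A $$ (i, j)\<bar>)"
  show "0 \<le> K"
    by (simp add: K_def sum_nonneg)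
  fix x :: "real Matrix.vec" assume x: "x \<in> carrier_vec n"
  have "x \<bullet> (A *\<^sub>v x) = (\<Sum>i<n. \<Sum>j<n. x $ i * (A $$ (i, j) * x $ j))"
    using A x by (simp add: scalar_prod_def mult_mat_vec_def atLeast0LessThan sum_distrib_left)
  also have "\<bar>\<dots>\<bar> \<le> (\<Sum>i<n. \<Sum>j<n. \<bar>x $ i * (A $$ (i, j) * x $ j)\<bar>)"
    by (rule order_trans[OF sum_abs]) (intro sum_mono sum_abs)
  also have "\<dots> \<le> (\<Sum>i<n. \<Sum>j<n. \<bar>A $$ (i, j)\<bar> * (x \<bullet> x))"
  proof (intro sum_mono)
    fix i j assume ij: "i \<in> {..<n}" "j \<in> {..<n}"
    have "2 * (\<bar>x $ i\<bar> * \<bar>x $ j\<bar>) \<le> (x $ i)\<^sup>2 + (x $ j)\<^sup>2"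
      using sum_squares_bound[of "\<bar>x $ i\<bar>" "\<bar>x $ j\<bar>"] by simp
    then have "\<bar>x $ i\<bar> * \<bar>x $ j\<bar> \<le> x \<bullet> x"
      using sq_index_le_scalar_prod_self[of i x] sq_index_le_scalar_prod_self[of j x] ij x by auto
    then show "\<bar>x $ i * (A $$ (i, j) * x $ j)\<bar> \<le> \<bar>A $$ (i, j)\<bar> * (x \<bullet> x)"
      using mult_left_mono[of "\<bar>x $ i\<bar> * \<bar>x $ j\<bar>" "x \<bullet> x" "\<bar>A $$ (i, j)\<bar>"]
      by (simp add: abs_mult mult_ac)
  qed
  also have "\<dots> = K * (x \<bullet> x)"
    by (simp add: K_def sum_distrib_right)
  finally show "\<bar>x \<bullet> (A *\<^sub>v x)\<bar> \<le> K * (x \<bullet> x)" .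
qed

section \<open>Coercivity, eigenvalue bounds and determinants of quadratic forms\<close>

lemma transpose_mult_self_form:
  assumes "(B :: real mat) \<in> carrier_mat m n" "x \<in> carrier_vec n"
  shows "x \<bullet> ((transpose_mat B * B) *\<^sub>v x) = (B *\<^sub>v x) \<bullet> (B *\<^sub>v x)"
proof -
  have "(transpose_mat B * B) *\<^sub>v x = transpose_mat B *\<^sub>v (B *\<^sub>v x)"
    using assms by (intro assoc_mult_mat_vec) auto
  then show ?thesis
    using transpose_vec_mult_scalar[of B m n x "B *\<^sub>v x"] assms
      comm_scalar_prod[of x n "transpose_mat B *\<^sub>v (B *\<^sub>v x)"] by simp
qed

text \<open>Writing x = B (A x) bounds |x|^2 by a multiple of |A x|^2, which
  \<open>psd_norm_image_le\<close> bounds by the form. The added 1 keeps the constant positive when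
  K or L vanishes.\<close>

lemma psd_invertible_imp_coercive:
  assumes A: "(A :: real mat) \<in> carrier_mat n n" and sym: "transpose_mat A = A"
    and psd: "\<And>x. x \<in> carrier_vec n \<Longrightarrow> 0 \<le> x \<bullet> (A *\<^sub>v x)"
    and B: "B \<in> carrier_mat n n" "B * A = 1\<^sub>m n"
  obtains c where "0 < c" "\<And>x. x \<in> carrier_vec n \<Longrightarrow> c * (x \<bullet> x) \<le> x \<bullet> (A *\<^sub>v x)"
proof -
  obtain K where K: "0 \<le> K" "\<And>x. x \<in> carrier_vec n \<Longrightarrow> \<bar>x \<bullet> (A *\<^sub>v x)\<bar> \<le> K * (x \<bullet> x)"
    using quadratic_form_bounded[OF A] by blast
  have "transpose_mat B * B \<in> carrier_mat n n"
    using B by simp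
  then obtain L where L: "0 \<le> L" "\<And>x. x \<in> carrier_vec n \<Longrightarrow> \<bar>x \<bullet> ((transpose_mat B * B) *\<^sub>v x)\<bar> \<le> L * (x \<bullet> x)"
    using quadratic_form_bounded by blast
  have *: "x \<bullet> x \<le> (L * K + 1) * (x \<bullet> (A *\<^sub>v x))" if x: "x \<in> carrier_vec n" for x
  proof -
    have Ax: "A *\<^sub>v x \<in> carrier_vec n"
      using A x by simp
    have "B *\<^sub>v (A *\<^sub>v x) = x"
      using assoc_mult_mat_vec[OF B(1) A x] B(2) x by simp
    then have "x \<bullet> x \<le> L * ((A *\<^sub>v x) \<bullet> (A *\<^sub>v x))"
      using L(2)[OF Ax] transpose_mult_self_form[OF B(1) Ax] by simp
    also have "\<dots> \<le> L * (K * (x \<bullet> (A *\<^sub>v x)))"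
      using psd_norm_image_le[OF A sym psd _ x, of K] K(2) L(1) by (intro mult_left_mono) force+
    also have "\<dots> \<le> (L * K + 1) * (x \<bullet> (A *\<^sub>v x))"
      using psd[OF x] by (simp add: algebra_simps)
    finally show ?thesis .
  qed
  show thesis
  proof (rule that[of "1 / (L * K + 1)"])
    have "0 < L * K + 1"
      using K(1) L(1) by (simp add: add_nonneg_pos)
    then show "0 < 1 / (L * K + 1)" "\<And>x. x \<in> carrier_vec n \<Longrightarrow> 1 / (L * K + 1) * (x \<bullet> x) \<le> x \<bullet> (A *\<^sub>v x)"
      using * by (auto simp: field_simps)
  qed
qed

lemma nonsingular_imp_inverse:
  assumes A: "(A :: real mat) \<in> carrier_mat n n" and "Determinant.det A \<noteq> 0"
  obtains B where "B \<in> carrier_mat n n" "A * B = 1\<^sub>m n" "B * A = 1\<^sub>m n" "mat_inverse A = Some B"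
proof (cases "mat_inverse A")
  case None
  then show thesis
    using mat_inverse(1)[OF A None, of "()"] det_non_zero_imp_unit[OF assms, of "()"] by blast
next
  case (Some B)
  then show thesis
    using mat_inverse(2)[OF A Some] that by blast
qed

text \<open>The set of all \<open>t\<close> with \<open>A - t\<close> positive semidefinite is closed, and its supremum must be an
  eigenvalue: otherwise \<open>A - t\<close> would be invertible there, hence coercive, and \<open>t\<close> could be increased.\<close>

lemma eigenvalue_lower_bound_imp_form_ge:
  assumes A: "(A :: real mat) \<in> carrier_mat n n" and sym: "transpose_mat A = A"
    and l: "\<And>k. eigenvalue A k \<Longrightarrow> l \<le> k" and x: "x \<in> carrier_vec n"
  shows "l * (x \<bullet> x) \<le> x \<bullet> (A *\<^sub>v x)"
proof (rule ccontr)
  assume neg: "\<not> l * (x \<bullet> x) \<le> x \<bullet> (A *\<^sub>v x)"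
  define P where "P = {t :: real. \<forall>y :: real Matrix.vec\<in>carrier_vec n. t * (y \<bullet> y) \<le> y \<bullet> (A *\<^sub>v y)}"
  obtain K where K: "0 \<le> K" "\<And>y. y \<in> carrier_vec n \<Longrightarrow> \<bar>y \<bullet> (A *\<^sub>v y)\<bar> \<le> K * (y \<bullet> y)"
    using quadratic_form_bounded[OF A] by blast
  have nonempty: "- K \<in> P"
    using K(2) by (force simp: P_def)
  have "x \<bullet> x \<noteq> 0"
  proof
    assume "x \<bullet> x = 0"
    then have "x = 0\<^sub>v n"
      using scalar_prod_self_eq_0_iff[OF x] by simp
    then have "x \<bullet> (A *\<^sub>v x) = 0"
      using A by simp
    then show False
      using neg \<open>x \<bullet> x = 0\<close> by simp
  qed
  then have xx: "0 < x \<bullet> x"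
    using scalar_prod_self_ge_0[of x] by simp
  have less: "t < l" if "t \<in> P" for t
  proof -
    have "t * (x \<bullet> x) \<le> x \<bullet> (A *\<^sub>v x)"
      using that x by (simp add: P_def)
    then have "t * (x \<bullet> x) < l * (x \<bullet> x)"
      using neg by linarith
    then show ?thesis
      using xx by simp
  qed
  then have bdd: "bdd_above P"
    by (meson bdd_above.I less_imp_le)
  define t where "t = Sup P"
  have tP: "t \<in> P"
    unfolding P_def
  proof (intro CollectI ballI)
    fix y :: "real Matrix.vec" assume y: "y \<in> carrier_vec n"
    show "t * (y \<bullet> y) \<le> y \<bullet> (A *\<^sub>v y)"
    proof (cases "y \<bullet> y = 0")
      case True
      then show ?thesis
        using nonempty y by (force simp: P_def)
    next
      case False
      then have yy: "0 < y \<bullet> y"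
        using scalar_prod_self_ge_0[of y] by simp
      have "t \<le> y \<bullet> (A *\<^sub>v y) / (y \<bullet> y)"
        unfolding t_def
      proof (rule cSup_least)
        show "s \<le> y \<bullet> (A *\<^sub>v y) / (y \<bullet> y)" if "s \<in> P" for s
          using that y yy by (simp add: P_def pos_le_divide_eq)
      qed (use nonempty in blast)
      then show ?thesis
        using yy by (simp add: pos_le_divide_eq)
    qed
  qed
  define N where "N = char_matrix A t"
  have N: "N \<in> carrier_mat n n"
    using A by (simp add: N_def)
  have symN: "transpose_mat N = N"
    using A symmetric_index[OF A sym] by (intro eq_matI) (auto simp: N_def char_matrix_def)
  have formN: "y \<bullet> (N *\<^sub>v y) = y \<bullet> (A *\<^sub>v y) - t * (y \<bullet> y)" if y: "y \<in> carrier_vec n" for y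
  proof -
    have "N *\<^sub>v y = A *\<^sub>v y + (- t) \<cdot>\<^sub>v y"
      unfolding N_def char_matrix_def using A y
      by (intro eq_vecI) (auto simp: add_scalar_prod_distrib[of _ n])
    then show ?thesis
      using A y by (simp add: scalar_prod_add_distrib[of _ n])
  qed
  have psdN: "0 \<le> y \<bullet> (N *\<^sub>v y)" if "y \<in> carrier_vec n" for y
    using tP formN[OF that] that by (simp add: P_def)
  have "\<not> eigenvalue A t"
    using l[of t] less[OF tP] by auto
  then have "Determinant.det N \<noteq> 0"
    using eigenvalue_det[OF A] by (simp add: N_def)
  then obtain B where "B \<in> carrier_mat n n" "B * N = 1\<^sub>m n"
    using nonsingular_imp_inverse[OF N] by metis
  then obtain c where c: "0 < c" "\<And>y. y \<in> carrier_vec n \<Longrightarrow> c * (y \<bullet> y) \<le> y \<bullet> (N *\<^sub>v y)"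
    using psd_invertible_imp_coercive[OF N symN psdN] by blast
  then have "t + c \<in> P"
    using formN by (force simp: P_def algebra_simps)
  then have "t + c \<le> t"
    unfolding t_def using bdd by (rule cSup_upper)
  then show False
    using c(1) by simp
qed

lemma eigenvalue_upper_bound_imp_form_le:
  assumes A: "(A :: real mat) \<in> carrier_mat n n" and sym: "transpose_mat A = A"
    and u: "\<And>k. eigenvalue A k \<Longrightarrow> k \<le> u" and x: "x \<in> carrier_vec n"
  shows "x \<bullet> (A *\<^sub>v x) \<le> u * (x \<bullet> x)"
proof -
  have neg: "(- A) *\<^sub>v y = - (A *\<^sub>v y)" if "y \<in> carrier_vec n" for y
    using A that by (intro eq_vecI) auto
  have "- u \<le> k" if ev: "eigenvalue (- A) k" for k
  proof -
    obtain v where v: "v \<in> carrier_vec n" "v \<noteq> 0\<^sub>v n" "- (A *\<^sub>v v) = k \<cdot>\<^sub>v v"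
      using ev A neg unfolding eigenvalue_def eigenvector_def by auto
    have "A *\<^sub>v v = - (k \<cdot>\<^sub>v v)"
      using v(3) by (metis uminus_uminus_vec)
    also have "\<dots> = (- k) \<cdot>\<^sub>v v"
      by auto
    finally have "eigenvalue A (- k)"
      using v A by (auto simp: eigenvalue_def eigenvector_def)
    then show ?thesis
      using u by fastforce
  qed
  moreover have "transpose_mat (- A) = - A"
    using A symmetric_index[OF A sym] by (intro eq_matI) auto
  ultimately have "- u * (x \<bullet> x) \<le> x \<bullet> ((- A) *\<^sub>v x)"
    using A x by (intro eigenvalue_lower_bound_imp_form_ge[of "- A" n]) auto
  also have "\<dots> = - (x \<bullet> (A *\<^sub>v x))"
    using neg[OF x] A x by (simp add: scalar_prod_def sum_negf)
  finally show ?thesis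
    by simp
qed

text \<open>The segment from the identity matrix to A consists of positive definite matrices, so the
  determinant has no zero on it and keeps the sign it has at the identity.\<close>

lemma det_pos_of_pos_def:
  assumes A: "(A :: real mat) \<in> carrier_mat n n"
    and pd: "\<And>x. x \<in> carrier_vec n \<Longrightarrow> x \<noteq> 0\<^sub>v n \<Longrightarrow> 0 < x \<bullet> (A *\<^sub>v x)"
  shows "0 < Determinant.det A"
proof -
  define F where "F t = t \<cdot>\<^sub>m A + (1 - t) \<cdot>\<^sub>m 1\<^sub>m n" for t :: real
  have F: "F t \<in> carrier_mat n n" for t
    using A by (simp add: F_def)
  have nz: "Determinant.det (F t) \<noteq> 0" if t: "0 \<le> t" "t \<le> 1" for t
  proof
    assume "Determinant.det (F t) = 0"
    then obtain v where v: "v \<in> carrier_vec n" "v \<noteq> 0\<^sub>v n" "F t *\<^sub>v v = 0\<^sub>v n"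
      using det_0_iff_vec_prod_zero_field[OF F] by blast
    have "F t *\<^sub>v v = t \<cdot>\<^sub>v (A *\<^sub>v v) + (1 - t) \<cdot>\<^sub>v v"
      unfolding F_def using A v(1)
      by (intro eq_vecI) (auto simp: add_scalar_prod_distrib[of _ n])
    then have "v \<bullet> (t \<cdot>\<^sub>v (A *\<^sub>v v) + (1 - t) \<cdot>\<^sub>v v) = 0"
      using v by (metis scalar_prod_right_zero)
    then have "0 = t * (v \<bullet> (A *\<^sub>v v)) + (1 - t) * (v \<bullet> v)"
      using v(1) A by (simp add: scalar_prod_add_distrib[of _ n])
    moreover have "0 < v \<bullet> (A *\<^sub>v v)" "0 < v \<bullet> v"
      using pd v scalar_prod_self_eq_0_iff[OF v(1)] scalar_prod_self_ge_0[of v] by auto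
    then have "0 < t * (v \<bullet> (A *\<^sub>v v)) + (1 - t) * (v \<bullet> v)"
      using t by (cases "t = 0") (auto intro!: add_pos_nonneg)
    ultimately show False
      by simp
  qed
  have "continuous_on {0..1} (\<lambda>t. Determinant.det (F t))"
  proof -
    \<comment> \<open>The Leibniz formula exhibits the determinant as a polynomial in t.\<close>
    have "Determinant.det (F t) = (\<Sum>\<pi> | \<pi> permutes {0..<n}. signof \<pi> *
        (\<Prod>i = 0..<n. t * A $$ (i, \<pi> i) + (1 - t) * (if i = \<pi> i then 1 else 0)))" for t
      unfolding det_def'[OF F]
      by (intro sum.cong arg_cong2[where f="(*)"] prod.cong refl)
        (use A in \<open>auto simp: F_def dest: permutes_in_image\<close>)
    then show ?thesis
      by (simp only:) (intro continuous_intros)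
  qed
  moreover have "F 0 = 1\<^sub>m n"
    unfolding F_def using A by (intro eq_matI) auto
  ultimately have "\<not> Determinant.det (F 1) \<le> 0"
    using IVT2'[of "\<lambda>t. Determinant.det (F t)" 1 0 0] nz
    by (auto simp: \<open>F 0 = 1\<^sub>m n\<close>)
  moreover have "F 1 = A"
    unfolding F_def using A by (intro eq_matI) auto
  ultimately show ?thesis
    by simp
qed

text \<open>Linear independence speaks of the set of columns, so their distinctness must be secured
  first: the rank is the size of a maximal independent subset of this set, and a repeated column
  would leave fewer than p elements.\<close>

lemma full_column_rank_imp_injective:
  assumes X: "(X :: real mat) \<in> carrier_mat n p" and rank: "vec_space.rank n X = p"
    and v: "v \<in> carrier_vec p" "X *\<^sub>v v = 0\<^sub>v n"
  shows "v = 0\<^sub>v p"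
proof (rule ccontr)
  assume nz: "v \<noteq> 0\<^sub>v p"
  interpret V: vec_space "TYPE(real)" n .
  have dist: "distinct (cols X)"
  proof (rule ccontr)
    assume nd: "\<not> distinct (cols X)"
    obtain S where S: "finite S" "maximal S (\<lambda>T. T \<subseteq> set (cols X) \<and> V.lin_indpt T)"
      using maximal_exists_superset[of "set (cols X)" "\<lambda>T. T \<subseteq> set (cols X) \<and> V.lin_indpt T" "{}"]
        V.finite_lin_indpt2[of "{}"] by auto
    have "card S \<le> card (set (cols X))"
      using S(2) by (intro card_mono) (auto simp: maximal_def)
    also have "\<dots> < p"
      using nd card_length[of "cols X"] card_distinct[of "cols X"] X by fastforce
    finally show False
      using V.rank_card_indpt[OF X S(2)] rank by simp
  qed
  show False
    using V.lin_depI[OF X v(1) nz v(2) dist] V.full_rank_lin_indpt[OF X rank dist] by blast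
qed

lemma inv_mat_eq:
  assumes A: "(A :: real mat) \<in> carrier_mat n n" and B: "B \<in> carrier_mat n n"
    and AB: "A * B = 1\<^sub>m n"
  shows "inv_mat A = B"
proof -
  have "Determinant.det A * Determinant.det B = 1"
    using det_mult[OF A B] AB by simp
  then have "Determinant.det A \<noteq> 0"
    by auto
  then obtain C where C: "C \<in> carrier_mat n n" "C * A = 1\<^sub>m n" "mat_inverse A = Some C"
    using nonsingular_imp_inverse[OF A] by metis
  have "C = C * (A * B)"
    using AB C(1) by simp
  also have "\<dots> = B"
    using assoc_mult_mat[OF C(1) A B] C(2) B by simp
  finally show ?thesis
    using C(3) by (simp add: inv_mat_def)
qed

section \<open>The maximum norm and the Euclidean norm\<close>

lemma linf_norm_le_iff:
  assumes "0 \<le> \<epsilon>"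
  shows "linf_norm v \<le> \<epsilon> \<longleftrightarrow> (\<forall>i<dim_vec v. \<bar>v $ i\<bar> \<le> \<epsilon>)"
  unfolding linf_norm_def using assms by (subst Max_le_iff) auto

lemma linf_norm_nonneg: "0 \<le> linf_norm v"
  unfolding linf_norm_def by (rule Max_ge) auto

lemma index_le_linf_norm: "i < dim_vec v \<Longrightarrow> \<bar>v $ i\<bar> \<le> linf_norm v"
  using linf_norm_le_iff[OF linf_norm_nonneg, of v v] by simp

lemma linf_norm_add:
  assumes "v \<in> carrier_vec n" "w \<in> carrier_vec n"
  shows "linf_norm (v + w) \<le> linf_norm v + linf_norm w"
proof (subst linf_norm_le_iff)
  show "\<forall>i<dim_vec (v + w). \<bar>(v + w) $ i\<bar> \<le> linf_norm v + linf_norm w"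
  proof (intro allI impI)
    fix i assume "i < dim_vec (v + w)"
    then have "i < n"
      using assms by simp
    then show "\<bar>(v + w) $ i\<bar> \<le> linf_norm v + linf_norm w"
      using index_le_linf_norm[of i v] index_le_linf_norm[of i w] assms by simp
  qed
qed (simp add: linf_norm_nonneg)

lemma linf_norm_smult: "linf_norm (c \<cdot>\<^sub>v v) = \<bar>c\<bar> * linf_norm v"
proof -
  have le: "linf_norm (c \<cdot>\<^sub>v v) \<le> \<bar>c\<bar> * linf_norm v" for c and v :: "real Matrix.vec"
    by (subst linf_norm_le_iff)
       (auto simp: linf_norm_nonneg abs_mult intro!: mult_left_mono index_le_linf_norm)
  show ?thesis
  proof (cases "c = 0")
    case True
    then show ?thesis
      using le[of 0 v] linf_norm_nonneg[of "0 \<cdot>\<^sub>v v"] by simp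
  next
    case False
    then have "(1 / c) \<cdot>\<^sub>v (c \<cdot>\<^sub>v v) = v"
      by (simp add: smult_smult_assoc)
    then have "\<bar>c\<bar> * linf_norm v \<le> \<bar>c\<bar> * (\<bar>1 / c\<bar> * linf_norm (c \<cdot>\<^sub>v v))"
      using le[of "1 / c" "c \<cdot>\<^sub>v v"] by (intro mult_left_mono) auto
    also have "\<dots> = linf_norm (c \<cdot>\<^sub>v v)"
      using False by simp
    finally show ?thesis
      using le[of c v] by simp
  qed
qed

lemma linf_norm_sq_le: "(linf_norm v)\<^sup>2 \<le> v \<bullet> v"
proof -
  have "linf_norm v \<le> sqrt (v \<bullet> v)"
    by (subst linf_norm_le_iff)
       (auto simp: scalar_prod_self_ge_0 intro!: real_le_rsqrt sq_index_le_scalar_prod_self)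
  then show ?thesis
    using linf_norm_nonneg[of v] scalar_prod_self_ge_0[of v]
    by (metis power_mono real_sqrt_pow2)
qed

lemma l2_norm_sq: "(l2_norm v)\<^sup>2 = v \<bullet> v"
  by (simp add: l2_norm_def scalar_prod_self_ge_0)

section \<open>Gaussian integrals of quadratic forms\<close>

text \<open>Abstracts the Gram matrix and its inverse, so that the same Gaussian integrals are also
  available for the identity matrix on the sample space, see
  \<open>pos_def_pair_one\<close>.\<close>

locale pos_def_pair =
  fixes p :: nat and G Gi :: "real mat"
  assumes G: "G \<in> carrier_mat p p" and Gi: "Gi \<in> carrier_mat p p"
    and G_Gi: "G * Gi = 1\<^sub>m p" and Gi_G: "Gi * G = 1\<^sub>m p"
    and sym_G: "transpose_mat G = G" and sym_Gi: "transpose_mat Gi = Gi"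
    and form_nonneg: "\<And>x. x \<in> carrier_vec p \<Longrightarrow> 0 \<le> x \<bullet> (G *\<^sub>v x)"
begin

definition q :: "real Matrix.vec \<Rightarrow> real" where "q x = x \<bullet> (G *\<^sub>v x)"

text \<open>Unnormalized mass of the centred Gaussian with precision matrix \<open>c G\<close>. For
  general G it is only rescaled in c and finally cancelled, for which positivity and finiteness at c
  = 1 suffice.\<close>

definition Z :: "real \<Rightarrow> ennreal" where
  "Z c = (\<integral>\<^sup>+x. ennreal (exp (- (c * q x) / 2)) \<partial>vec_lborel p)"

lemma q_nonneg: "x \<in> carrier_vec p \<Longrightarrow> 0 \<le> q x"
  by (simp add: q_def form_nonneg)

lemma measurable_q:
  assumes "f \<in> measurable N (vec_lborel p)"
  shows "(\<lambda>x. q (f x)) \<in> borel_measurable N"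
  unfolding q_def by (rule measurable_scalar_prod[OF assms measurable_mult_mat_vec[OF G assms]])

lemmas [measurable] = measurable_q[OF measurable_vec_ident]

lemma G_Gi_vec: "x \<in> carrier_vec p \<Longrightarrow> G *\<^sub>v (Gi *\<^sub>v x) = x"
  using assoc_mult_mat_vec[OF G Gi] G_Gi by simp

lemma Gi_G_vec: "x \<in> carrier_vec p \<Longrightarrow> Gi *\<^sub>v (G *\<^sub>v x) = x"
  using assoc_mult_mat_vec[OF Gi G] Gi_G by simp

lemma q_Gi: "x \<in> carrier_vec p \<Longrightarrow> q (Gi *\<^sub>v x) = x \<bullet> (Gi *\<^sub>v x)"
  using Gi by (simp add: q_def G_Gi_vec comm_scalar_prod[of "Gi *\<^sub>v x" p])

lemma q_add:
  assumes "x \<in> carrier_vec p" "y \<in> carrier_vec p"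
  shows "q (x + t \<cdot>\<^sub>v y) = q x + 2 * t * (x \<bullet> (G *\<^sub>v y)) + t\<^sup>2 * q y"
  unfolding q_def by (rule quadratic_form_add[OF G sym_G assms])

lemma q_smult: "x \<in> carrier_vec p \<Longrightarrow> q (t \<cdot>\<^sub>v x) = t\<^sup>2 * q x"
  using G by (simp add: q_def mult_mat_vec[of _ p p] power2_eq_square)

lemma q_coercive:
  obtains c where "0 < c" "\<And>x. x \<in> carrier_vec p \<Longrightarrow> c * (x \<bullet> x) \<le> q x"
  using psd_invertible_imp_coercive[OF G sym_G form_nonneg Gi Gi_G] unfolding q_def by blast

lemma Z_scale:
  assumes c: "0 < c"
  shows "ennreal (sqrt c ^ p) * Z (c * d) = Z d"
proof -
  have "ennreal (\<bar>1 / sqrt c\<bar> ^ p) *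
      (\<integral>\<^sup>+x. ennreal (exp (- (c * d * q (0\<^sub>v p + (1 / sqrt c) \<cdot>\<^sub>v x)) / 2)) \<partial>vec_lborel p) = Z (c * d)"
    unfolding Z_def by (rule nn_integral_vec_affine) (use c in auto)
  also have "(\<integral>\<^sup>+x. ennreal (exp (- (c * d * q (0\<^sub>v p + (1 / sqrt c) \<cdot>\<^sub>v x)) / 2)) \<partial>vec_lborel p) = Z d"
    unfolding Z_def
  proof (rule nn_integral_cong)
    fix x :: "real Matrix.vec" assume "x \<in> space (vec_lborel p)"
    then have "0\<^sub>v p + (1 / sqrt c) \<cdot>\<^sub>v x = (1 / sqrt c) \<cdot>\<^sub>v x" "x \<in> carrier_vec p"
      by auto
    then show "ennreal (exp (- (c * d * q (0\<^sub>v p + (1 / sqrt c) \<cdot>\<^sub>v x)) / 2)) = ennreal (exp (- (d * q x) / 2))"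
      using c by (simp add: q_smult power_divide)
  qed
  finally have "ennreal (sqrt c ^ p) * Z (c * d) = ennreal (sqrt c ^ p) * (ennreal (\<bar>1 / sqrt c\<bar> ^ p) * Z d)"
    by simp
  also have "\<dots> = ennreal (sqrt c ^ p * \<bar>1 / sqrt c\<bar> ^ p) * Z d"
    using c by (simp add: ennreal_mult mult.assoc)
  also have "sqrt c ^ p * \<bar>1 / sqrt c\<bar> ^ p = 1"
    using c by (simp add: power_divide)
  finally show ?thesis
    by simp
qed

text \<open>Coercivity of the form dominates the integrand by a spherical Gaussian.\<close>

lemma Z_1_finite: "Z 1 < \<infinity>"
proof -
  obtain c where c: "0 < c" "\<And>x. x \<in> carrier_vec p \<Longrightarrow> c * (x \<bullet> x) \<le> q x"
    using q_coercive by blast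
  have "Z 1 \<le> (\<integral>\<^sup>+x. ennreal (exp (- (c * (x \<bullet> x)) / 2)) \<partial>vec_lborel p)"
    unfolding Z_def by (intro nn_integral_mono ennreal_leI) (use c in auto)
  also have "\<dots> = ennreal (sqrt (2 * pi / c) ^ p)"
    by (rule nn_integral_gaussian_vec[OF c(1)])
  finally show ?thesis
    using ennreal_less_top le_less_trans by fastforce
qed

text \<open>Boundedness of the form minorizes the integrand by a spherical Gaussian; its precision
  is \<open>K + 1\<close> because K may be 0.\<close>

lemma Z_1_pos: "0 < Z 1"
proof -
  obtain K where K: "0 \<le> K" "\<And>x. x \<in> carrier_vec p \<Longrightarrow> \<bar>q x\<bar> \<le> K * (x \<bullet> x)"
    using quadratic_form_bounded[OF G] unfolding q_def by blast
  have "0 < sqrt (2 * pi / (K + 1)) ^ p"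
    using K(1) by simp
  then have "0 < ennreal (sqrt (2 * pi / (K + 1)) ^ p)"
    by (simp only: ennreal_less_zero_iff)
  also have "\<dots> = (\<integral>\<^sup>+x. ennreal (exp (- ((K + 1) * (x \<bullet> x)) / 2)) \<partial>vec_lborel p)"
    using K(1) by (intro nn_integral_gaussian_vec[symmetric]) simp
  also have "\<dots> \<le> Z 1"
    unfolding Z_def
  proof (intro nn_integral_mono ennreal_leI)
    fix x :: "real Matrix.vec" assume "x \<in> space (vec_lborel p)"
    then have "q x \<le> (K + 1) * (x \<bullet> x)"
      using K(2)[of x] scalar_prod_self_ge_0[of x] by (simp add: algebra_simps)
    then show "exp (- ((K + 1) * (x \<bullet> x)) / 2) \<le> exp (- (1 * q x) / 2)"
      by simp
  qed
  finally show ?thesis .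
qed

lemma Z_eq:
  assumes c: "0 < c"
  shows "Z c = ennreal ((1 / sqrt c) ^ p) * Z 1"
proof -
  have "ennreal ((1 / sqrt c) ^ p) * (ennreal (sqrt c ^ p) * Z (c * 1)) = ennreal ((1 / sqrt c) ^ p * sqrt c ^ p) * Z c"
    using c by (simp add: ennreal_mult mult.assoc)
  also have "(1 / sqrt c) ^ p * sqrt c ^ p = 1"
    using c by (simp flip: power_mult_distrib)
  finally show ?thesis
    using Z_scale[OF c, of 1] by simp
qed

lemma nn_integral_shift:
  assumes m: "m \<in> carrier_vec p" and f: "f \<in> borel_measurable (vec_lborel p)"
  shows "(\<integral>\<^sup>+x. f (m + x) \<partial>vec_lborel p) = (\<integral>\<^sup>+x. f x \<partial>vec_lborel p)"
proof -
  have "(\<integral>\<^sup>+x. f (m + 1 \<cdot>\<^sub>v x) \<partial>vec_lborel p) = (\<integral>\<^sup>+x. f x \<partial>vec_lborel p)"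
    using nn_integral_vec_affine[OF _ m f, of 1] by simp
  then show ?thesis
    by (simp add: one_smult_vec)
qed

lemma laplace_transform:
  assumes c: "0 < c" and l: "l \<in> carrier_vec p"
  shows "(\<integral>\<^sup>+x. ennreal (exp (- (c * q x) / 2 + l \<bullet> x)) \<partial>vec_lborel p) =
    ennreal (exp (l \<bullet> (Gi *\<^sub>v l) / (2 * c))) * Z c"
proof -
  \<comment> \<open>The maximizer of -c q(x)/2 + l . x; shifting by it completes the square.\<close>
  define m where "m = (1 / c) \<cdot>\<^sub>v (Gi *\<^sub>v l)"
  have Gil: "Gi *\<^sub>v l \<in> carrier_vec p"
    using Gi l by simp
  then have m: "m \<in> carrier_vec p"
    by (simp add: m_def)
  have [measurable]: "(\<lambda>x. l \<bullet> x) \<in> borel_measurable (vec_lborel p)"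
    by (rule measurable_scalar_prod[OF measurable_vec_const[OF l] measurable_vec_ident])
  have exponent: "- (c * q (m + y)) / 2 + l \<bullet> (m + y) = l \<bullet> (Gi *\<^sub>v l) / (2 * c) - (c * q y) / 2"
    if y: "y \<in> carrier_vec p" for y
  proof -
    have "m + y = y + (1 / c) \<cdot>\<^sub>v (Gi *\<^sub>v l)"
      using Gil y by (simp add: m_def comm_add_vec[of _ p])
    then have "q (m + y) = q y + 2 * (1 / c) * (y \<bullet> l) + (1 / c)\<^sup>2 * (l \<bullet> (Gi *\<^sub>v l))"
      using q_add[OF y Gil] l by (simp add: q_Gi G_Gi_vec)
    moreover have "l \<bullet> (m + y) = (1 / c) * (l \<bullet> (Gi *\<^sub>v l)) + y \<bullet> l"
      using l y Gil m comm_scalar_prod[OF l y]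
      by (simp add: scalar_prod_add_distrib[of _ p]) (simp add: m_def)
    ultimately show ?thesis
      using c by (simp add: field_simps power2_eq_square)
  qed
  have "(\<integral>\<^sup>+x. ennreal (exp (- (c * q x) / 2 + l \<bullet> x)) \<partial>vec_lborel p) =
      (\<integral>\<^sup>+y. ennreal (exp (- (c * q (m + y)) / 2 + l \<bullet> (m + y))) \<partial>vec_lborel p)"
    by (rule nn_integral_shift[OF m, symmetric]) measurable
  also have "\<dots> = (\<integral>\<^sup>+y. ennreal (exp (l \<bullet> (Gi *\<^sub>v l) / (2 * c))) * ennreal (exp (- (c * q y) / 2)) \<partial>vec_lborel p)"
  proof (rule nn_integral_cong)
    fix y :: "real Matrix.vec" assume "y \<in> space (vec_lborel p)"
    then have y: "y \<in> carrier_vec p"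
      by simp
    have "exp (- (c * q (m + y)) / 2 + l \<bullet> (m + y)) = exp (l \<bullet> (Gi *\<^sub>v l) / (2 * c)) * exp (- (c * q y) / 2)"
      by (simp only: exponent[OF y] flip: exp_add) simp
    then show "ennreal (exp (- (c * q (m + y)) / 2 + l \<bullet> (m + y))) =
        ennreal (exp (l \<bullet> (Gi *\<^sub>v l) / (2 * c))) * ennreal (exp (- (c * q y) / 2))"
      by (simp only: ennreal_mult exp_ge_zero)
  qed
  also have "\<dots> = ennreal (exp (l \<bullet> (Gi *\<^sub>v l) / (2 * c))) * Z c"
    unfolding Z_def by (rule nn_integral_cmult) measurable
  finally show ?thesis .
qed

end

text \<open>256 = 4^4 arises from raising y/4 \<le> exp(y/4) to the fourth power.\<close>

lemma power4_le_exp: "(x::real) ^ 4 \<le> 256 * (exp x + exp (- x))"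
proof -
  have *: "y ^ 4 \<le> 256 * exp y" if "0 \<le> y" for y :: real
  proof -
    have "(y / 4) ^ 4 \<le> exp (y / 4) ^ 4"
      using exp_ge_add_one_self[of "y / 4"] that by (intro power_mono) linarith+
    also have "exp (y / 4) ^ 4 = exp y"
      by (simp flip: exp_of_nat_mult)
    finally show ?thesis
      by (simp add: power_divide)
  qed
  show ?thesis
  proof (cases "0 \<le> x")
    case True
    then show ?thesis
      using *[of x] by (simp add: add_increasing2)
  next
    case False
    then show ?thesis
      using *[of "- x"] by (simp add: add_increasing)
  qed
qed

context pos_def_pair
begin

text \<open>The fourth power is bounded by exponentials of both signs, whose Gaussian integrals are
  Laplace transforms. The constant 1024 is 256 times 2 for the two signs times 2 for the bound on
  each integral.\<close>

lemma fourth_moment_le: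
  assumes c: "0 < c" and i: "i < p" and K: "Gi $$ (i, i) \<le> K" "0 < K"
  shows "(\<integral>\<^sup>+x. ennreal ((x $ i) ^ 4 * exp (- (c * q x) / 2)) \<partial>vec_lborel p) \<le> ennreal (1024 * (K / c)\<^sup>2) * Z c"
proof -
  \<comment> \<open>At the frequencies r and -r the Laplace factor is at most exp(1/2), hence at
    most 2.\<close>
  define r where "r = sqrt (c / K)"
  have r: "0 < r" "r\<^sup>2 = c / K"
    using c K(2) by (auto simp: r_def)
  define C where "C = 256 * (K / c)\<^sup>2"
  have C: "0 \<le> C"
    by (simp add: C_def)
  define l where "l s = s \<cdot>\<^sub>v unit_vec p i" for s :: real
  have l: "l s \<in> carrier_vec p" for s
    by (simp add: l_def)
  have lx: "l s \<bullet> x = s * x $ i" if "x \<in> carrier_vec p" for s x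
    using i that by (simp add: l_def)
  have lGl: "l s \<bullet> (Gi *\<^sub>v l s) = s\<^sup>2 * Gi $$ (i, i)" for s
  proof -
    have "l s \<bullet> (Gi *\<^sub>v l s) = s * (row Gi i \<bullet> l s)"
      using i Gi l by (subst lx) auto
    also have "row Gi i \<bullet> l s = l s \<bullet> row Gi i"
      using i Gi l by (intro comm_scalar_prod[of _ p]) auto
    also have "\<dots> = s * Gi $$ (i, i)"
      using i Gi by (subst lx) auto
    finally show ?thesis
      by (simp add: power2_eq_square)
  qed
  have [measurable]: "(\<lambda>x. l s \<bullet> x) \<in> borel_measurable (vec_lborel p)" for s
    by (rule measurable_scalar_prod[OF measurable_vec_const[OF l] measurable_vec_ident])
  have le: "(\<integral>\<^sup>+x. ennreal (exp (- (c * q x) / 2 + l s \<bullet> x)) \<partial>vec_lborel p) \<le> ennreal 2 * Z c" if "s\<^sup>2 = c / K" for s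
  proof -
    have "s\<^sup>2 * Gi $$ (i, i) \<le> s\<^sup>2 * K"
      using K(1) by (rule mult_left_mono) simp
    also have "\<dots> = c"
      using K(2) that by simp
    finally have "s\<^sup>2 * Gi $$ (i, i) / (2 * c) \<le> 1 / 2"
      using c by (simp add: field_simps)
    then have "exp (l s \<bullet> (Gi *\<^sub>v l s) / (2 * c)) \<le> exp (1 / 2)"
      by (simp add: lGl)
    also have "\<dots> \<le> (2 :: real)"
      using exp_bound_half[of "1 / 2 :: real"] by simp
    finally show ?thesis
      by (subst laplace_transform[OF c l]) (intro mult_right_mono ennreal_leI, auto)
  qed
  have "(\<integral>\<^sup>+x. ennreal ((x $ i) ^ 4 * exp (- (c * q x) / 2)) \<partial>vec_lborel p) \<le>
      (\<integral>\<^sup>+x. ennreal C * ennreal (exp (- (c * q x) / 2 + l r \<bullet> x)) +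
         ennreal C * ennreal (exp (- (c * q x) / 2 + l (- r) \<bullet> x)) \<partial>vec_lborel p)"
  proof (rule nn_integral_mono)
    fix x :: "real Matrix.vec" assume "x \<in> space (vec_lborel p)"
    then have x: "x \<in> carrier_vec p"
      by simp
    have "(r * x $ i) ^ 4 \<le> 256 * (exp (l r \<bullet> x) + exp (l (- r) \<bullet> x))"
      using power4_le_exp[of "r * x $ i"] by (simp add: lx[OF x])
    moreover have "(r * x $ i) ^ 4 = (c / K)\<^sup>2 * (x $ i) ^ 4"
      by (simp add: power_mult_distrib flip: r(2) power_mult)
    ultimately have "(K / c)\<^sup>2 * ((c / K)\<^sup>2 * (x $ i) ^ 4) \<le>
        (K / c)\<^sup>2 * (256 * (exp (l r \<bullet> x) + exp (l (- r) \<bullet> x)))"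
      by (intro mult_left_mono) auto
    then have "(x $ i) ^ 4 \<le> C * (exp (l r \<bullet> x) + exp (l (- r) \<bullet> x))"
      using c K(2) by (simp add: C_def power_divide mult.commute mult.left_commute)
    then have "(x $ i) ^ 4 * exp (- (c * q x) / 2) \<le>
        C * (exp (l r \<bullet> x) + exp (l (- r) \<bullet> x)) * exp (- (c * q x) / 2)"
      by (rule mult_right_mono) simp
    also have "\<dots> = C * exp (- (c * q x) / 2 + l r \<bullet> x) + C * exp (- (c * q x) / 2 + l (- r) \<bullet> x)"
      by (simp only: exp_add) (simp add: algebra_simps)
    finally show "ennreal ((x $ i) ^ 4 * exp (- (c * q x) / 2)) \<le>
        ennreal C * ennreal (exp (- (c * q x) / 2 + l r \<bullet> x)) +
        ennreal C * ennreal (exp (- (c * q x) / 2 + l (- r) \<bullet> x))"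
      using C by (simp flip: ennreal_mult ennreal_plus)
  qed
  also have "\<dots> = ennreal C * (\<integral>\<^sup>+x. ennreal (exp (- (c * q x) / 2 + l r \<bullet> x)) \<partial>vec_lborel p) +
      ennreal C * (\<integral>\<^sup>+x. ennreal (exp (- (c * q x) / 2 + l (- r) \<bullet> x)) \<partial>vec_lborel p)"
    by (simp add: nn_integral_add nn_integral_cmult)
  also have "\<dots> \<le> ennreal C * (ennreal 2 * Z c) + ennreal C * (ennreal 2 * Z c)"
    by (intro add_mono mult_left_mono le) (use r in auto)
  also have "\<dots> = (ennreal C * ennreal 2 + ennreal C * ennreal 2) * Z c"
    by (simp only: distrib_right mult.assoc)
  also have "ennreal C * ennreal 2 + ennreal C * ennreal 2 = ennreal (1024 * (K / c)\<^sup>2)"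
    using C by (simp only: C_def flip: ennreal_mult ennreal_plus) simp
  finally show ?thesis .
qed

end

section \<open>Moment generating functions under a spherical Gaussian\<close>

lemma pos_def_pair_one: "pos_def_pair n (1\<^sub>m n) (1\<^sub>m n)"
  by unfold_locales (auto simp: scalar_prod_self_ge_0)

text \<open>The value of \<open>Z c\<close> for the identity matrix, that is, the normalizing
  constant of N(0, I/c).\<close>

definition gaussian_mass :: "nat \<Rightarrow> real \<Rightarrow> real" where
  "gaussian_mass n c = sqrt (2 * pi / c) ^ n"

lemma gaussian_laplace_transform:
  assumes c: "0 < c" and l: "l \<in> carrier_vec n"
  shows "(\<integral>\<^sup>+x. ennreal (exp (- (c * (x \<bullet> x)) / 2 + l \<bullet> x)) \<partial>vec_lborel n) =
    ennreal (exp (l \<bullet> l / (2 * c))) * ennreal (gaussian_mass n c)"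
proof -
  interpret I: pos_def_pair n "1\<^sub>m n" "1\<^sub>m n"
    by (rule pos_def_pair_one)
  have q: "I.q x = x \<bullet> x" if "x \<in> carrier_vec n" for x
    using that by (simp add: I.q_def)
  have "I.Z c = (\<integral>\<^sup>+x. ennreal (exp (- (c * (x \<bullet> x)) / 2)) \<partial>vec_lborel n)"
    unfolding I.Z_def by (intro nn_integral_cong) (simp add: q)
  then have "I.Z c = ennreal (gaussian_mass n c)"
    using nn_integral_gaussian_vec[OF c] by (simp add: gaussian_mass_def)
  moreover have "(\<integral>\<^sup>+x. ennreal (exp (- (c * (x \<bullet> x)) / 2 + l \<bullet> x)) \<partial>vec_lborel n) =
      (\<integral>\<^sup>+x. ennreal (exp (- (c * I.q x) / 2 + l \<bullet> x)) \<partial>vec_lborel n)"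
    by (intro nn_integral_cong) (simp add: q)
  ultimately show ?thesis
    using I.laplace_transform[OF c l] l by simp
qed

text \<open>The Gaussian moment generating function of the quadratic form \<open>h\<close> is obtained without
  diagonalization: \<open>exp (\<tau> c h / 2)\<close> is itself a Laplace transform with respect to an auxiliary
  Gaussian vector, and Tonelli's theorem exchanges the two Gaussian integrals.\<close>

lemma (in pos_def_pair) projection_mgf:
  assumes X: "X \<in> carrier_mat n p" and GX: "G = transpose_mat X * X"
    and c: "0 < c" and \<tau>: "0 \<le> \<tau>" "\<tau> < 1"
  defines "h \<equiv> \<lambda>x. (transpose_mat X *\<^sub>v x) \<bullet> (Gi *\<^sub>v (transpose_mat X *\<^sub>v x))"
  shows "(\<integral>\<^sup>+x. ennreal (exp (- (c * (x \<bullet> x)) / 2 + \<tau> * c * h x / 2)) \<partial>vec_lborel n) =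
    ennreal ((1 / sqrt (1 - \<tau>)) ^ p * gaussian_mass n c)"
proof -
  \<comment> \<open>With this factor the Laplace transform in w, taken at r X^T x, has the exponent
    r^2 h/2 = \<tau> c h/2.\<close>
  define r where "r = sqrt (\<tau> * c)"
  have r: "r\<^sup>2 = \<tau> * c"
    using c \<tau> by (simp add: r_def)
  have XT: "transpose_mat X \<in> carrier_mat p n"
    using X by simp
  have mu: "(\<lambda>x. transpose_mat X *\<^sub>v x) \<in> measurable (vec_lborel n) (vec_lborel p)"
    by (rule measurable_mult_mat_vec[OF XT measurable_vec_ident])
  have [measurable]: "(\<lambda>x. x \<bullet> x) \<in> borel_measurable (vec_lborel n)"
    by (rule measurable_scalar_prod[OF measurable_vec_ident measurable_vec_ident])
  have [measurable]: "h \<in> borel_measurable (vec_lborel n)"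
    unfolding h_def by (rule measurable_scalar_prod[OF mu measurable_mult_mat_vec[OF Gi mu]])
  define B where "B x w = (r \<cdot>\<^sub>v (transpose_mat X *\<^sub>v x)) \<bullet> w" for x w
  have B: "B x w = (r \<cdot>\<^sub>v (X *\<^sub>v w)) \<bullet> x" if x: "x \<in> carrier_vec n" and w: "w \<in> carrier_vec p" for x w
    using transpose_vec_mult_scalar[OF X w x] X x w comm_scalar_prod[OF x, of "X *\<^sub>v w"]
    by (simp add: B_def)
  have B_meas [measurable]: "(\<lambda>xw. B (fst xw) (snd xw)) \<in> borel_measurable (vec_lborel n \<Otimes>\<^sub>M vec_lborel p)"
    unfolding B_def
    by (intro measurable_scalar_prod[where m=p] measurable_vec_smult measurable_mult_mat_vec[OF XT]) measurable
  have [measurable]: "(\<lambda>w. B x w) \<in> borel_measurable (vec_lborel p)" if "x \<in> carrier_vec n" for x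
    using measurable_compose[OF measurable_Pair1' B_meas, of x] that by simp
  define F where "F x w = ennreal (exp (- (c * (x \<bullet> x)) / 2)) * ennreal (exp (- (1 * q w) / 2 + B x w))" for x w
  have F_meas: "(\<lambda>(x, w). F x w) \<in> borel_measurable (vec_lborel n \<Otimes>\<^sub>M vec_lborel p)"
    unfolding F_def split_beta by measurable
  interpret P: pair_sigma_finite "vec_lborel n" "vec_lborel p"
    by (intro pair_sigma_finite.intro sigma_finite_vec_lborel)
  have inner_w: "(\<integral>\<^sup>+w. F x w \<partial>vec_lborel p) = ennreal (exp (- (c * (x \<bullet> x)) / 2 + \<tau> * c * h x / 2)) * Z 1"
    if x: "x \<in> carrier_vec n" for x
  proof -
    define u where "u = transpose_mat X *\<^sub>v x"
    have u: "u \<in> carrier_vec p"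
      using XT x by (simp add: u_def)
    have "(r \<cdot>\<^sub>v u) \<bullet> (Gi *\<^sub>v (r \<cdot>\<^sub>v u)) / (2 * 1) = \<tau> * c * h x / 2"
      using u Gi r by (simp add: mult_mat_vec[of _ p p] h_def u_def[symmetric] power2_eq_square)
    then have "(\<integral>\<^sup>+w. ennreal (exp (- (1 * q w) / 2 + B x w)) \<partial>vec_lborel p) = ennreal (exp (\<tau> * c * h x / 2)) * Z 1"
      unfolding B_def u_def[symmetric] using laplace_transform[of 1 "r \<cdot>\<^sub>v u"] u by simp
    then have "(\<integral>\<^sup>+w. F x w \<partial>vec_lborel p) = ennreal (exp (- (c * (x \<bullet> x)) / 2)) * (ennreal (exp (\<tau> * c * h x / 2)) * Z 1)"
      unfolding F_def using x by (subst nn_integral_cmult) auto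
    then show ?thesis
      by (simp only: exp_add ennreal_mult exp_ge_zero mult.assoc)
  qed
  \<comment> \<open>In the other order v = r X w has |v|^2 = \<tau> c q(w), and the Laplace
    transform in x turns the weight exp(-q(w)/2) into exp(-(1 - \<tau>) q(w)/2).\<close>
  have inner_x: "(\<integral>\<^sup>+x. F x w \<partial>vec_lborel n) = ennreal (gaussian_mass n c) * ennreal (exp (- ((1 - \<tau>) * q w) / 2))"
    if w: "w \<in> carrier_vec p" for w
  proof -
    define v where "v = r \<cdot>\<^sub>v (X *\<^sub>v w)"
    have v: "v \<in> carrier_vec n"
      using X w by (simp add: v_def)
    have vx [measurable]: "(\<lambda>x. v \<bullet> x) \<in> borel_measurable (vec_lborel n)"
      by (rule measurable_scalar_prod[OF measurable_vec_const[OF v] measurable_vec_ident])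
    have "v \<bullet> v = r\<^sup>2 * ((X *\<^sub>v w) \<bullet> (X *\<^sub>v w))"
      using X w by (simp add: v_def power2_eq_square)
    also have "(X *\<^sub>v w) \<bullet> (X *\<^sub>v w) = q w"
      using transpose_mult_self_form[OF X w] by (simp only: q_def GX[symmetric])
    finally have vv: "v \<bullet> v / (2 * c) = \<tau> * q w / 2"
      using c r by simp
    have "(\<integral>\<^sup>+x. F x w \<partial>vec_lborel n) =
        (\<integral>\<^sup>+x. ennreal (exp (- q w / 2)) * ennreal (exp (- (c * (x \<bullet> x)) / 2 + v \<bullet> x)) \<partial>vec_lborel n)"
    proof (rule nn_integral_cong)
      fix x :: "real Matrix.vec" assume "x \<in> space (vec_lborel n)"
      then have "B x w = v \<bullet> x"
        using B[of x w] w by (simp add: v_def)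
      then show "F x w = ennreal (exp (- q w / 2)) * ennreal (exp (- (c * (x \<bullet> x)) / 2 + v \<bullet> x))"
        unfolding F_def by (simp add: algebra_simps flip: ennreal_mult exp_add)
    qed
    also have "\<dots> = ennreal (exp (- q w / 2)) * (ennreal (exp (\<tau> * q w / 2)) * ennreal (gaussian_mass n c))"
      by (subst nn_integral_cmult, measurable) (simp only: gaussian_laplace_transform[OF c v] vv)
    also have "\<dots> = ennreal (exp (- q w / 2) * exp (\<tau> * q w / 2)) * ennreal (gaussian_mass n c)"
      by (simp only: ennreal_mult exp_ge_zero mult.assoc)
    also have "exp (- q w / 2) * exp (\<tau> * q w / 2) = exp (- ((1 - \<tau>) * q w) / 2)"
      by (simp add: algebra_simps add_divide_distrib diff_divide_distrib flip: exp_add)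
    finally show ?thesis
      by (simp add: mult.commute)
  qed
  have "(\<integral>\<^sup>+x. ennreal (exp (- (c * (x \<bullet> x)) / 2 + \<tau> * c * h x / 2)) \<partial>vec_lborel n) * Z 1 =
      (\<integral>\<^sup>+x. (\<integral>\<^sup>+w. F x w \<partial>vec_lborel p) \<partial>vec_lborel n)"
    by (subst nn_integral_multc[symmetric]) (auto simp: inner_w intro!: nn_integral_cong)
  also have "\<dots> = (\<integral>\<^sup>+w. (\<integral>\<^sup>+x. F x w \<partial>vec_lborel n) \<partial>vec_lborel p)"
    by (rule P.Fubini'[OF F_meas, symmetric])
  also have "\<dots> = (\<integral>\<^sup>+w. ennreal (gaussian_mass n c) * ennreal (exp (- ((1 - \<tau>) * q w) / 2)) \<partial>vec_lborel p)"
    by (rule nn_integral_cong) (simp add: inner_x)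
  also have "\<dots> = ennreal (gaussian_mass n c) * Z (1 - \<tau>)"
    unfolding Z_def by (rule nn_integral_cmult) measurable
  also have "\<dots> = ennreal ((1 / sqrt (1 - \<tau>)) ^ p * gaussian_mass n c) * Z 1"
    using \<tau> by (subst Z_eq) (auto simp: ennreal_mult gaussian_mass_def mult_ac c less_imp_le)
  finally have "Z 1 * (\<integral>\<^sup>+x. ennreal (exp (- (c * (x \<bullet> x)) / 2 + \<tau> * c * h x / 2)) \<partial>vec_lborel n) =
      Z 1 * ennreal ((1 / sqrt (1 - \<tau>)) ^ p * gaussian_mass n c)"
    by (simp only: mult.commute)
  then show ?thesis
    using Z_1_finite Z_1_pos by (subst (asm) ennreal_mult_cancel_left) auto
qed

section \<open>Inverse gamma integrals\<close>

text \<open>Kept as an integral: the posterior only involves its positivity, its finiteness and a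
  ratio of its values for the same b, which a recurrence in a supplies.\<close>

definition inverse_gamma_integral :: "real \<Rightarrow> real \<Rightarrow> ennreal" where
  "inverse_gamma_integral a b = (\<integral>\<^sup>+v. ennreal (inverse_gamma_kernel a b v) \<partial>lborel)"

lemma inverse_gamma_kernel_nonneg: "0 \<le> inverse_gamma_kernel a b v"
  by (simp add: inverse_gamma_kernel_def)

lemma measurable_inverse_gamma_kernel [measurable]: "inverse_gamma_kernel a b \<in> borel_measurable borel"
  unfolding inverse_gamma_kernel_def by measurable

text \<open>Near 0 the exponential beats every power of 1/v; on [1, \<infinity>) the kernel is at
  most 1/v^2 because 2 \<le> a.\<close>

lemma inverse_gamma_integral_finite:
  assumes a: "2 \<le> a" and b: "0 < b"
  shows "inverse_gamma_integral a b < \<infinity>"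
proof -
  obtain k :: nat where "a / 2 + 1 \<le> real k"
    using real_arch_simple by blast
  then have k: "a / 2 + 1 \<le> real k" "1 \<le> k"
    using a by linarith+
  define C where "C = (2 * real k / b) ^ k"
  have C: "0 \<le> C"
    using b by (simp add: C_def)
  have near: "inverse_gamma_kernel a b v \<le> C" if v: "0 < v" "v \<le> 1" for v
  proof -
    have "v powr (- a / 2 - 1) = (1 / v) powr (a / 2 + 1)"
      using v by (simp add: powr_divide flip: powr_minus_divide)
    also have "\<dots> \<le> (1 / v) powr (real k)"
      using v k by (intro powr_mono) auto
    also have "\<dots> = (1 / v) ^ k"
      using v by (simp add: powr_realpow)
    finally have "inverse_gamma_kernel a b v \<le> (1 / v) ^ k * exp (- b / (2 * v))"
      using v by (simp add: inverse_gamma_kernel_def)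
    \<comment> \<open>Rescaled so that y = b/(2 v k) satisfies y^k \<le> exp(y)^k = exp(b/(2 v)),
      which the exponential factor cancels.\<close>
    also have "\<dots> = (2 * real k / b) ^ k * ((b / (2 * v * real k)) ^ k * exp (- b / (2 * v)))"
    proof -
      have "1 / v = 2 * real k / b * (b / (2 * v * real k))"
        using b k v by simp
      then show ?thesis
        by (metis mult.assoc power_mult_distrib)
    qed
    also have "(b / (2 * v * real k)) ^ k * exp (- b / (2 * v)) \<le> 1"
    proof -
      have "(b / (2 * v * real k)) ^ k \<le> exp (b / (2 * v * real k)) ^ k"
      proof (rule power_mono)
        show "b / (2 * v * real k) \<le> exp (b / (2 * v * real k))"
          using exp_ge_add_one_self[of "b / (2 * v * real k)"] by linarith
        show "0 \<le> b / (2 * v * real k)"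
          using b v by simp
      qed
      also have "\<dots> = exp (b / (2 * v))"
        using k by (simp flip: exp_of_nat_mult)
      finally have "(b / (2 * v * real k)) ^ k * exp (- b / (2 * v)) \<le> exp (b / (2 * v)) * exp (- b / (2 * v))"
        by (intro mult_right_mono) auto
      then show ?thesis
        by (simp flip: exp_add)
    qed
    finally show ?thesis
      using C by (simp add: C_def mult_left_mono)
  qed
  have far: "inverse_gamma_kernel a b v \<le> 1 / v\<^sup>2" if v: "1 \<le> v" for v
  proof -
    have "v powr (- a / 2 - 1) \<le> v powr (- 2)"
      using v a by (intro powr_mono) auto
    also have "v powr (- 2) = 1 / v\<^sup>2"
      using v by (simp add: powr_minus_divide powr_numeral)
    finally have "v powr (- a / 2 - 1) * exp (- b / (2 * v)) \<le> 1 / v\<^sup>2 * 1"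
      using v b by (intro mult_mono) auto
    then show ?thesis
      using v by (simp add: inverse_gamma_kernel_def)
  qed
  have "inverse_gamma_integral a b \<le>
      (\<integral>\<^sup>+v. ennreal C * indicator {0..1} v + ennreal (1 / v\<^sup>2) * indicator {1..} v \<partial>lborel)"
    unfolding inverse_gamma_integral_def
  proof (rule nn_integral_mono)
    fix v :: real
    consider "v \<le> 0" | "0 < v" "v < 1" | "1 \<le> v"
      by linarith
    then show "ennreal (inverse_gamma_kernel a b v) \<le>
        ennreal C * indicator {0..1} v + ennreal (1 / v\<^sup>2) * indicator {1..} v"
    proof cases
      case 1
      then show ?thesis
        by (simp add: inverse_gamma_kernel_def)
    next
      case 2
      then show ?thesis
        using near[of v] by (auto intro!: ennreal_leI)
    next
      case 3
      then have "ennreal (inverse_gamma_kernel a b v) \<le> ennreal (1 / v\<^sup>2) * indicator {1..} v"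
        using far[of v] by (auto intro!: ennreal_leI)
      then show ?thesis
        by (simp add: add_increasing)
    qed
  qed
  also have "\<dots> = (\<integral>\<^sup>+v. ennreal C * indicator {0..1} (v::real) \<partial>lborel) +
      (\<integral>\<^sup>+v. ennreal (1 / v\<^sup>2) * indicator {1..} v \<partial>lborel)"
    by (rule nn_integral_add) auto
  also have "(\<integral>\<^sup>+v. ennreal (1 / v\<^sup>2) * indicator {1..} v \<partial>lborel) = ennreal (0 - - 1 / 1)"
  proof (rule nn_integral_FTC_atLeast[where F="\<lambda>v. - 1 / v"])
    show "DERIV (\<lambda>v. - 1 / v) x :> 1 / x\<^sup>2" if "1 \<le> x" for x :: real
      using that by (auto intro!: derivative_eq_intros simp: power2_eq_square)
    show "((\<lambda>v::real. - 1 / v) \<longlongrightarrow> 0) at_top"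
      by real_asymp
  qed auto
  also have "(\<integral>\<^sup>+v. ennreal C * indicator {0..1} (v::real) \<partial>lborel) = ennreal C"
    by (subst nn_integral_cmult_indicator) auto
  finally show ?thesis
    using le_less_trans by fastforce
qed

lemma inverse_gamma_integral_pos: "0 < inverse_gamma_integral a b"
proof (rule ccontr)
  assume "\<not> 0 < inverse_gamma_integral a b"
  then have "AE v in lborel. ennreal (inverse_gamma_kernel a b v) = 0"
    unfolding inverse_gamma_integral_def by (subst nn_integral_0_iff_AE[symmetric]) auto
  then have "AE v in lborel. v \<notin> {0<..<1::real}"
    by eventually_elim (auto simp: inverse_gamma_kernel_def mult_pos_pos)
  then have "emeasure lborel {0<..<1::real} = 0"
    by (subst AE_iff_measurable[symmetric, where P="\<lambda>v. v \<notin> {0<..<1::real}"]) auto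
  then show False
    by simp
qed

text \<open>Integration by parts: the derivative of \<open>F\<close> is b/2 times the kernel for a
  minus (a - 2)/2 times the kernel for a - 2, and \<open>F\<close> vanishes at both ends. The
  condition 4 \<le> a makes \<open>inverse_gamma_integral_finite\<close> available for both
  kernels.\<close>

lemma inverse_gamma_integral_reduce:
  assumes a: "4 \<le> a" and b: "0 < b"
  shows "ennreal (a - 2) * inverse_gamma_integral (a - 2) b = ennreal b * inverse_gamma_integral a b"
proof -
  define f g where "f = inverse_gamma_kernel (a - 2) b" and "g = inverse_gamma_kernel a b"
  define F where "F v = v powr (1 - a / 2) * exp (- b / (2 * v))" for v
  have fi: "integrable lborel f"
    unfolding f_def using inverse_gamma_integral_finite[of "a - 2" b] a b
    by (intro integrableI_nonneg) (auto simp: inverse_gamma_kernel_nonneg inverse_gamma_integral_def)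
  have gi: "integrable lborel g"
    unfolding g_def using inverse_gamma_integral_finite[of a b] a b
    by (intro integrableI_nonneg) (auto simp: inverse_gamma_kernel_nonneg inverse_gamma_integral_def)
  define d where "d v = (b / 2) * g v - ((a - 2) / 2) * f v" for v
  have di: "integrable lborel d"
    unfolding d_def using fi gi by auto
  have f_eq: "f v = v powr (- a / 2) * exp (- b / (2 * v))" if "0 < v" for v
    using that by (simp add: f_def inverse_gamma_kernel_def diff_divide_distrib)
  have g_eq: "g v = v powr (- a / 2 - 1) * exp (- b / (2 * v))" if "0 < v" for v
    using that by (simp add: g_def inverse_gamma_kernel_def)
  have "(LBINT v=0..\<infinity>. d v) = 0 - 0"
  proof (rule interval_integral_FTC_integrable[where F=F])
    show "(F has_vector_derivative d v) (at v)" if "0 < ereal v" for v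
    proof -
      have v: "0 < v"
        using that by (simp add: zero_ereal_def)
      have p: "v powr (1 - a / 2) / v\<^sup>2 = v powr (- a / 2 - 1)"
      proof -
        have "v powr (1 - a / 2) = v powr (- a / 2 - 1) * v powr 2"
          by (simp flip: powr_add)
        then show ?thesis
          using v by (simp add: powr_numeral)
      qed
      have "(F has_real_derivative
          (1 - a / 2) * v powr (1 - a / 2 - 1) * exp (- b / (2 * v)) +
          v powr (1 - a / 2) * (exp (- b / (2 * v)) * (b / (2 * v\<^sup>2)))) (at v)"
        unfolding F_def using v
        by (auto intro!: derivative_eq_intros simp: power2_eq_square)
      also have "(1 - a / 2) * v powr (1 - a / 2 - 1) * exp (- b / (2 * v)) +
          v powr (1 - a / 2) * (exp (- b / (2 * v)) * (b / (2 * v\<^sup>2))) =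
          (b / 2) * ((v powr (1 - a / 2) / v\<^sup>2) * exp (- b / (2 * v))) - ((a - 2) / 2) * f v"
        using f_eq[OF v] by (simp add: field_simps)
      also have "\<dots> = d v"
        using g_eq[OF v] by (simp add: d_def p)
      finally show ?thesis
        by (simp add: has_real_derivative_iff_has_vector_derivative)
    qed
    show "isCont d v" if "0 < ereal v" for v
    proof -
      have v: "0 < v"
        using that by (simp add: zero_ereal_def)
      have "isCont (\<lambda>v. (b / 2) * (v powr (- a / 2 - 1) * exp (- b / (2 * v))) -
          ((a - 2) / 2) * (v powr (- a / 2) * exp (- b / (2 * v)))) v"
        using v by (intro continuous_intros) auto
      moreover have "eventually (\<lambda>v. d v = (b / 2) * (v powr (- a / 2 - 1) * exp (- b / (2 * v))) -
          ((a - 2) / 2) * (v powr (- a / 2) * exp (- b / (2 * v)))) (nhds v)"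
        using eventually_nhds_in_open[of "{0<..}" v] v
        by (auto elim!: eventually_mono simp: d_def f_eq g_eq)
      ultimately show ?thesis
        by (subst isCont_cong)
    qed
    show "set_integrable lborel (einterval 0 \<infinity>) d"
      unfolding set_integrable_def using di by (intro integrable_mult_indicator) auto
    have "(F \<longlongrightarrow> 0) (at_right 0)"
      unfolding F_def using a b by real_asymp
    then show "((F \<circ> real_of_ereal) \<longlongrightarrow> 0) (at_right 0)"
      by (simp add: zero_ereal_def ereal_tendsto_simps)
    have "(F \<longlongrightarrow> 0) at_top"
      unfolding F_def using a b by real_asymp
    then show "((F \<circ> real_of_ereal) \<longlongrightarrow> 0) (at_left \<infinity>)"
      by (simp add: ereal_tendsto_simps)
  qed auto
  moreover have "(LBINT v=0..\<infinity>. d v) = (LBINT v. d v)"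
  proof -
    have "(LBINT v=0..\<infinity>. d v) = (LBINT v:{0<..}. d v)"
      by (simp add: interval_lebesgue_integral_def zero_ereal_def einterval_def greaterThan_def)
    also have "\<dots> = (LBINT v. d v)"
      unfolding set_lebesgue_integral_def
      by (intro Bochner_Integration.integral_cong) (auto simp: d_def f_def g_def inverse_gamma_kernel_def)
    finally show ?thesis .
  qed
  ultimately have "(LBINT v. d v) = 0"
    by simp
  moreover have "(LBINT v. d v) = (b / 2) * (LBINT v. g v) - ((a - 2) / 2) * (LBINT v. f v)"
    unfolding d_def using fi gi by simp
  ultimately have "(a - 2) * (LBINT v. f v) = b * (LBINT v. g v)"
    by simp
  moreover have "inverse_gamma_integral (a - 2) b = ennreal (LBINT v. f v)"
    unfolding inverse_gamma_integral_def f_def[symmetric]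
    by (rule nn_integral_eq_integral[OF fi]) (simp add: f_def inverse_gamma_kernel_nonneg)
  moreover have "inverse_gamma_integral a b = ennreal (LBINT v. g v)"
    unfolding inverse_gamma_integral_def g_def[symmetric]
    by (rule nn_integral_eq_integral[OF gi]) (simp add: g_def inverse_gamma_kernel_nonneg)
  ultimately show ?thesis
    using a b by (simp flip: ennreal_mult')
qed

text \<open>Multiplying the kernel by v^2 lowers a by 4, so the factor is the second moment of the
  inverse gamma distribution with parameters a/2 and b/2.\<close>

lemma inverse_gamma_integral_reduce2:
  assumes a: "6 \<le> a" and b: "0 < b"
  shows "inverse_gamma_integral (a - 4) b = ennreal (b\<^sup>2 / ((a - 2) * (a - 4))) * inverse_gamma_integral a b"
proof -
  have assoc: "ennreal x * (ennreal y * z) = ennreal (x * y) * z" if "0 \<le> x" "0 \<le> y" for x y z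
    using that by (simp add: ennreal_mult mult.assoc)
  have one: "inverse_gamma_integral (c - 2) b = ennreal (b / (c - 2)) * inverse_gamma_integral c b" if "4 \<le> c" for c
  proof -
    have "inverse_gamma_integral (c - 2) b = ennreal (1 / (c - 2)) * (ennreal (c - 2) * inverse_gamma_integral (c - 2) b)"
      using that by (subst assoc) auto
    also have "\<dots> = ennreal (1 / (c - 2)) * (ennreal b * inverse_gamma_integral c b)"
      using that b by (simp only: inverse_gamma_integral_reduce)
    also have "\<dots> = ennreal (b / (c - 2)) * inverse_gamma_integral c b"
      using that b by (subst assoc) auto
    finally show ?thesis .
  qed
  have "inverse_gamma_integral (a - 4) b = ennreal (b / (a - 4)) * inverse_gamma_integral (a - 2) b"
    using one[of "a - 2"] a by simp
  also have "\<dots> = ennreal (b / (a - 4)) * (ennreal (b / (a - 2)) * inverse_gamma_integral a b)"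
    using one[of a] a by simp
  also have "\<dots> = ennreal (b\<^sup>2 / ((a - 2) * (a - 4))) * inverse_gamma_integral a b"
    using a b by (subst assoc) (auto simp: power2_eq_square mult.commute)
  finally show ?thesis .
qed

section \<open>The posterior under the g-prior\<close>

locale gaussian_linear_model = pos_def_pair p "transpose_mat X * X" "gram_inv X" for p :: nat and X :: "real mat" +
  fixes n :: nat
  assumes X: "X \<in> carrier_mat n p" and p_less_n: "p < n"
    and det_gram_inv: "0 < Determinant.det (gram_inv X)"
begin

definition norm_const :: real where
  "norm_const = sqrt ((2 * pi) ^ p * Determinant.det (gram_inv X))"

lemma norm_const_pos: "0 < norm_const"
  using det_gram_inv by (simp add: norm_const_def)

lemma mvn_density_gram_inv:
  assumes c: "0 < c" and x: "x \<in> carrier_vec p" and \<mu>: "\<mu> \<in> carrier_vec p"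
  shows "mvn_density \<mu> (c \<cdot>\<^sub>m gram_inv X) x = exp (- (q (x - \<mu>) / (2 * c))) / (sqrt c ^ p * norm_const)"
proof -
  let ?G = "transpose_mat X * X"
  have "(c \<cdot>\<^sub>m gram_inv X) * ((1 / c) \<cdot>\<^sub>m ?G) = (c * (1 / c)) \<cdot>\<^sub>m (gram_inv X * ?G)"
    using G Gi by (intro eq_matI) (auto simp: row_smult col_smult)
  also have "\<dots> = 1\<^sub>m p"
    using c by (simp only: Gi_G) (intro eq_matI, auto)
  finally have "inv_mat (c \<cdot>\<^sub>m gram_inv X) = (1 / c) \<cdot>\<^sub>m ?G"
    using G Gi by (intro inv_mat_eq[of _ p]) auto
  moreover have "((1 / c) \<cdot>\<^sub>m ?G) *\<^sub>v (x - \<mu>) = (1 / c) \<cdot>\<^sub>v (?G *\<^sub>v (x - \<mu>))"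
    using G x \<mu> by (intro eq_vecI) auto
  moreover have "(x - \<mu>) \<bullet> ((1 / c) \<cdot>\<^sub>v (?G *\<^sub>v (x - \<mu>))) = q (x - \<mu>) / c"
    using X x \<mu> by (simp add: q_def)
  moreover have "sqrt ((2 * pi) ^ dim_vec \<mu> * Determinant.det (c \<cdot>\<^sub>m gram_inv X)) = sqrt c ^ p * norm_const"
    using Gi \<mu> by (simp add: norm_const_def real_sqrt_mult real_sqrt_power)
  ultimately show ?thesis
    by (simp add: mvn_density_def)
qed

lemma measurable_mvn_density:
  assumes c: "0 < c" and \<mu>: "\<mu> \<in> carrier_vec p"
  shows "mvn_density \<mu> (c \<cdot>\<^sub>m gram_inv X) \<in> borel_measurable (vec_lborel p)"
proof -
  have [measurable]: "(\<lambda>x. q (x - \<mu>)) \<in> borel_measurable (vec_lborel p)"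
    by (rule measurable_q[OF measurable_vec_minus[OF measurable_vec_ident measurable_vec_const[OF \<mu>]]])
  have "(\<lambda>x. exp (- (q (x - \<mu>) / (2 * c))) / (sqrt c ^ p * norm_const)) \<in> borel_measurable (vec_lborel p)"
    by measurable
  then show ?thesis
    by (subst measurable_cong[OF mvn_density_gram_inv[OF c _ \<mu>]]) auto
qed

end

locale g_posterior = gaussian_linear_model +
  fixes a b s g :: real and bhat \<gamma> :: "real Matrix.vec"
  assumes s: "0 < s" and b: "0 \<le> b" and g: "0 \<le> g"
    and bhat: "bhat \<in> carrier_vec p" and \<gamma>: "\<gamma> \<in> carrier_vec p"
begin

text \<open>Collects the factors of the likelihood that depend neither on \<beta> nor on v.\<close>

definition lik_const :: real where
  "lik_const = s powr ((real n - real p) / 2 - 1) /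
     (norm_const * (2 powr ((real n - real p) / 2) * Gamma ((real n - real p) / 2)))"

definition post_mean :: "real Matrix.vec" where
  "post_mean = (g / (g + 1)) \<cdot>\<^sub>v bhat + (1 / (g + 1)) \<cdot>\<^sub>v \<gamma>"

text \<open>The marginal posterior of the variance is inverse gamma with parameters (a + n)/2 and
  \<open>post_scale\<close>/2.\<close>

definition post_scale :: real where
  "post_scale = b + s + q (bhat - \<gamma>) / (g + 1)"

lemma lik_const_pos: "0 < lik_const"
  using s p_less_n norm_const_pos by (auto simp: lik_const_def intro!: divide_pos_pos mult_pos_pos Gamma_real_pos)

lemma post_mean_carrier: "post_mean \<in> carrier_vec p"
  using bhat \<gamma> by (simp add: post_mean_def)

lemma post_scale_pos: "0 < post_scale"
  using s b g bhat \<gamma> q_nonneg[of "bhat - \<gamma>"] by (simp add: post_scale_def add_nonneg_pos add_pos_nonneg)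

text \<open>The powers of 1/v from the prior, the Gaussian density, the chi-square density and its
  Jacobian add up to a/2 + 1 + p/2 - ((n - p)/2 - 1) + corrections only after (s/v) is expanded: the
  chi-square factor contributes its power of v in the denominator with the sign of s/v inverted, and
  the total exponent is -(a + n)/2 - 1.\<close>

lemma kernel_mult_likelihood:
  assumes v: "0 < v" and \<beta>: "\<beta> \<in> carrier_vec p"
  shows "inverse_gamma_kernel a b v * likelihood X bhat s \<beta> v =
    lik_const * inverse_gamma_kernel (a + n) (b + s + q (bhat - \<beta>)) v"
proof -
  define k where "k = real n - real p"
  define E where "E = 2 powr (k / 2) * Gamma (k / 2)"
  have lc: "lik_const = s powr (k / 2 - 1) / (norm_const * E)"
    by (simp add: lik_const_def k_def E_def)
  have sq: "sqrt v ^ p = v powr (real p / 2)"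
    using v by (simp add: powr_half_sqrt[symmetric] powr_power)
  have "likelihood X bhat s \<beta> v = exp (- (q (bhat - \<beta>) / (2 * v))) / (sqrt v ^ p * norm_const) *
      ((s / v) powr (k / 2 - 1) * exp (- (s / v) / 2) / E / v)"
    using X s v by (simp add: likelihood_def mvn_density_gram_inv[OF v bhat \<beta>] chi_square_density_def k_def E_def)
  also have "(s / v) powr (k / 2 - 1) = s powr (k / 2 - 1) / v powr (k / 2 - 1)"
    using s v by (simp add: powr_divide)
  finally have "inverse_gamma_kernel a b v * likelihood X bhat s \<beta> v =
      lik_const * ((v powr (- a / 2 - 1) / (v powr (real p / 2) * v powr (k / 2 - 1) * v)) *
        (exp (- b / (2 * v)) * exp (- (q (bhat - \<beta>) / (2 * v))) * exp (- (s / v) / 2)))"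
    using v by (simp add: inverse_gamma_kernel_def lc sq field_simps)
  also have "v powr (- a / 2 - 1) / (v powr (real p / 2) * v powr (k / 2 - 1) * v) =
      v powr (- a / 2 - 1) / (v powr (real p / 2) * v powr (k / 2 - 1) * v powr 1)"
    using v by simp
  also have "\<dots> = v powr (- a / 2 - 1 - (real p / 2 + (k / 2 - 1) + 1))"
    by (simp only: powr_add powr_diff)
  also have "- a / 2 - 1 - (real p / 2 + (k / 2 - 1) + 1) = - (a + real n) / 2 - 1"
    by (simp add: k_def field_simps)
  also have "exp (- b / (2 * v)) * exp (- (q (bhat - \<beta>) / (2 * v))) * exp (- (s / v) / 2) =
      exp (- (b + s + q (bhat - \<beta>)) / (2 * v))"
    using v by (simp add: add_divide_distrib diff_divide_distrib flip: exp_add)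
  finally show ?thesis
    using v by (simp add: inverse_gamma_kernel_def)
qed

lemma measurable_likelihood:
  assumes v: "0 < v"
  shows "(\<lambda>\<beta>. likelihood X bhat s \<beta> v) \<in> borel_measurable (vec_lborel p)"
proof -
  have [measurable]: "(\<lambda>x. q (bhat - x)) \<in> borel_measurable (vec_lborel p)"
    by (rule measurable_q[OF measurable_vec_minus[OF measurable_vec_const[OF bhat] measurable_vec_ident]])
  have "(\<lambda>x. exp (- (q (bhat - x) / (2 * v))) / (sqrt v ^ p * norm_const) *
      (chi_square_density (real (dim_row X) - real (dim_col X)) (s / v) / v)) \<in> borel_measurable (vec_lborel p)"
    by measurable
  then show ?thesis
    unfolding likelihood_def
    by (subst measurable_cong[where g="\<lambda>x. exp (- (q (bhat - x) / (2 * v))) / (sqrt v ^ p * norm_const) *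
      (chi_square_density (real (dim_row X) - real (dim_col X)) (s / v) / v)"])
       (use mvn_density_gram_inv[OF v bhat] in auto)
qed

lemma likelihood_nonneg:
  assumes v: "0 < v" and \<beta>: "\<beta> \<in> carrier_vec p"
  shows "0 \<le> likelihood X bhat s \<beta> v"
  using mvn_density_gram_inv[OF v bhat \<beta>] v s X p_less_n norm_const_pos
  by (simp add: likelihood_def chi_square_density_def Gamma_real_pos less_imp_le)

lemma measurable_q_centered [measurable]:
  "(\<lambda>\<beta>. q (\<beta> - post_mean)) \<in> borel_measurable (vec_lborel p)"
  by (rule measurable_q[OF measurable_vec_minus[OF measurable_vec_ident measurable_vec_const[OF post_mean_carrier]]])

text \<open>In terms of w = \<beta> - \<open>post_mean\<close> and d = bhat - \<gamma>, the two
  arguments are -(w - d/(g + 1)) and w + g d/(g + 1). Weighted by 1 and 1/g, their cross terms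
  cancel.\<close>

lemma q_complete_square:
  assumes g_pos: "0 < g" and \<beta>: "\<beta> \<in> carrier_vec p"
  shows "q (bhat - \<beta>) + q (\<beta> - \<gamma>) / g = (g + 1) / g * q (\<beta> - post_mean) + q (bhat - \<gamma>) / (g + 1)"
proof -
  define w d where "w = \<beta> - post_mean" and "d = bhat - \<gamma>"
  have w: "w \<in> carrier_vec p" and d: "d \<in> carrier_vec p"
    using \<beta> bhat \<gamma> post_mean_carrier by (auto simp: w_def d_def)
  have coeff: "g / (g + 1) = 1 - 1 / (g + 1)" "- 1 / (g + 1) = - (1 / (g + 1))"
    using g by (auto simp: field_simps)
  have "bhat - \<beta> = (-1) \<cdot>\<^sub>v (w + (- 1 / (g + 1)) \<cdot>\<^sub>v d)"
  proof (rule eq_vecI)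
    fix i assume "i < dim_vec ((-1) \<cdot>\<^sub>v (w + (- 1 / (g + 1)) \<cdot>\<^sub>v d))"
    then have i: "i < p"
      using d by simp
    have eq: "x - y = - (y - (g / (g + 1) * x + 1 / (g + 1) * z) + - 1 / (g + 1) * (x - z))" for x y z :: real
      unfolding coeff by (simp add: algebra_simps diff_divide_distrib)
    show "(bhat - \<beta>) $ i = ((-1) \<cdot>\<^sub>v (w + (- 1 / (g + 1)) \<cdot>\<^sub>v d)) $ i"
      using i \<beta> bhat \<gamma> w d eq[of "bhat $ i" "\<beta> $ i" "\<gamma> $ i"]
      by (simp add: w_def d_def post_mean_def)
  qed (use \<beta> bhat d in auto)
  then have "q (bhat - \<beta>) = q (w + (- 1 / (g + 1)) \<cdot>\<^sub>v d)"
    using w d by (simp only: q_smult add_carrier_vec smult_carrier_vec) simp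
  then have 1: "q (bhat - \<beta>) = q w + 2 * (- 1 / (g + 1)) * (w \<bullet> ((transpose_mat X * X) *\<^sub>v d)) + (- 1 / (g + 1))\<^sup>2 * q d"
    by (simp only: q_add[OF w d])
  have "\<beta> - \<gamma> = w + (g / (g + 1)) \<cdot>\<^sub>v d"
  proof (rule eq_vecI)
    fix i assume "i < dim_vec (w + (g / (g + 1)) \<cdot>\<^sub>v d)"
    then have i: "i < p"
      using d by simp
    have eq: "y - z = y - (g / (g + 1) * x + 1 / (g + 1) * z) + g / (g + 1) * (x - z)" for x y z :: real
      unfolding coeff by (simp add: algebra_simps diff_divide_distrib)
    show "(\<beta> - \<gamma>) $ i = (w + (g / (g + 1)) \<cdot>\<^sub>v d) $ i"
      using i \<beta> bhat \<gamma> w d eq[of "\<beta> $ i" "\<gamma> $ i" "bhat $ i"]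
      by (simp add: w_def d_def post_mean_def)
  qed (use \<beta> \<gamma> d in auto)
  then have 2: "q (\<beta> - \<gamma>) = q w + 2 * (g / (g + 1)) * (w \<bullet> ((transpose_mat X * X) *\<^sub>v d)) + (g / (g + 1))\<^sup>2 * q d"
    by (simp only: q_add[OF w d])
  have eq: "x + 2 * (- 1 / (g + 1)) * y + (- 1 / (g + 1))\<^sup>2 * z +
      (x + 2 * (g / (g + 1)) * y + (g / (g + 1))\<^sup>2 * z) / g = (g + 1) / g * x + z / (g + 1)" for x y z :: real
  proof -
    have "(- 1 / (g + 1))\<^sup>2 * z + (g / (g + 1))\<^sup>2 * z / g = (1 + g) / (g + 1)\<^sup>2 * z"
    proof -
      have "(g / (g + 1))\<^sup>2 * z / g = g / (g + 1)\<^sup>2 * z"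
        using g_pos by (simp add: power_divide power2_eq_square)
      then show ?thesis
        by (simp add: power_divide add_divide_distrib distrib_right)
    qed
    also have "(1 + g) / (g + 1)\<^sup>2 = 1 / (g + 1)"
      using g_pos by (simp add: power2_eq_square divide_simps)
    finally have sq: "(- 1 / (g + 1))\<^sup>2 * z + (g / (g + 1))\<^sup>2 * z / g = z / (g + 1)"
      by simp
    have lin: "x + 2 * (- 1 / (g + 1)) * y + P + (x + 2 * (g / (g + 1)) * y + Q) / g = x + x / g + (P + Q / g)" for P Q
      using g_pos by (simp add: add_divide_distrib)
    have "(g + 1) / g * x = x + x / g"
      using g_pos by (simp add: field_simps)
    then show ?thesis
      unfolding lin sq by simp
  qed
  show ?thesis
    unfolding 1 2 eq w_def[symmetric] d_def[symmetric] ..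
qed

text \<open>Product of the constants of likelihood and prior. It is only used for 0 < g; the point
  mass prior is treated in \<open>posterior_mass_zero_g\<close>.\<close>

definition joint_const :: real where
  "joint_const = lik_const / (norm_const * sqrt g ^ p)"

abbreviation post_mass :: "real Matrix.vec set \<Rightarrow> ennreal" where
  "post_mass \<equiv> posterior_mass X \<gamma> a b g bhat s"

abbreviation post_kernel :: "real \<Rightarrow> real" where
  "post_kernel \<equiv> inverse_gamma_kernel (a + n) post_scale"

abbreviation post_integral :: ennreal where
  "post_integral \<equiv> inverse_gamma_integral (a + n) post_scale"

abbreviation joint_weight :: "real \<Rightarrow> ennreal" where
  "joint_weight v \<equiv> ennreal (joint_const / sqrt v ^ p * post_kernel v)"

abbreviation centered_kernel :: "real \<Rightarrow> real Matrix.vec \<Rightarrow> ennreal" where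
  "centered_kernel v \<beta> \<equiv> ennreal (exp (- ((g + 1) / (g * v) * q (\<beta> - post_mean)) / 2))"

text \<open>Conjugacy of the normal and inverse gamma families: after completing the square, the
  joint density splits into a factor in v alone and a Gaussian kernel around
  \<open>post_mean\<close>.\<close>

lemma kernel_mult_inner_integral:
  assumes v: "0 < v" and g_pos: "0 < g" and B [measurable]: "B \<in> sets (vec_lborel p)"
  shows "ennreal (inverse_gamma_kernel a b v) *
      (\<integral>\<^sup>+\<beta>. ennreal (likelihood X bhat s \<beta> v) * indicator B \<beta> \<partial>g_prior X \<gamma> g v) =
    joint_weight v *
      (\<integral>\<^sup>+\<beta>. centered_kernel v \<beta> * indicator B \<beta> \<partial>vec_lborel p)"
    (is "?l = ?c * ?r")
proof -
  have gv: "0 < g * v"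
    using v g_pos by simp
  have dim: "dim_col X = p"
    using X by simp
  have [measurable]: "(\<lambda>\<beta>. likelihood X bhat s \<beta> v) \<in> borel_measurable (vec_lborel p)"
    "mvn_density \<gamma> ((g * v) \<cdot>\<^sub>m gram_inv X) \<in> borel_measurable (vec_lborel p)"
    by (fact measurable_likelihood[OF v] measurable_mvn_density[OF gv \<gamma>])+
  have pointwise: "ennreal (inverse_gamma_kernel a b v) *
      (ennreal (mvn_density \<gamma> ((g * v) \<cdot>\<^sub>m gram_inv X) \<beta>) * (ennreal (likelihood X bhat s \<beta> v) * indicator B \<beta>)) =
    ?c * (centered_kernel v \<beta> * indicator B \<beta>)"
    if \<beta>: "\<beta> \<in> carrier_vec p" for \<beta>
  proof -
    have dens: "mvn_density \<gamma> ((g * v) \<cdot>\<^sub>m gram_inv X) \<beta> = exp (- (q (\<beta> - \<gamma>) / (2 * (g * v)))) / (sqrt (g * v) ^ p * norm_const)"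
      by (rule mvn_density_gram_inv[OF gv \<beta> \<gamma>])
    have "- (b + s + q (bhat - \<beta>)) / (2 * v) + - (q (\<beta> - \<gamma>) / (2 * (g * v))) =
        - (b + s + (q (bhat - \<beta>) + q (\<beta> - \<gamma>) / g)) / (2 * v)"
      using v g_pos by (simp add: field_simps)
    also have "\<dots> = - post_scale / (2 * v) + - ((g + 1) / (g * v) * q (\<beta> - post_mean)) / 2"
    proof -
      have 1: "- (x + (y + z)) / (2 * v) = - (x + z) / (2 * v) + - (y / v) / 2" for x y z
        using v by (simp add: field_simps)
      have 2: "(g + 1) / (g * v) * y = (g + 1) / g * y / v" for y
        by simp
      show ?thesis
        unfolding q_complete_square[OF g_pos \<beta>] post_scale_def by (simp only: 1 2)
    qed
    finally have exps: "exp (- (b + s + q (bhat - \<beta>)) / (2 * v)) * exp (- (q (\<beta> - \<gamma>) / (2 * (g * v)))) =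
        exp (- post_scale / (2 * v)) * exp (- ((g + 1) / (g * v) * q (\<beta> - post_mean)) / 2)"
      by (simp only: flip: exp_add)
    have "inverse_gamma_kernel a b v * (mvn_density \<gamma> ((g * v) \<cdot>\<^sub>m gram_inv X) \<beta> * likelihood X bhat s \<beta> v) =
        (inverse_gamma_kernel a b v * likelihood X bhat s \<beta> v) * mvn_density \<gamma> ((g * v) \<cdot>\<^sub>m gram_inv X) \<beta>"
      by simp
    also have "\<dots> = lik_const * v powr (- (a + n) / 2 - 1) / (sqrt (g * v) ^ p * norm_const) *
        (exp (- (b + s + q (bhat - \<beta>)) / (2 * v)) * exp (- (q (\<beta> - \<gamma>) / (2 * (g * v)))))"
      unfolding kernel_mult_likelihood[OF v \<beta>] dens using v by (simp add: inverse_gamma_kernel_def)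
    also have "\<dots> = joint_const / sqrt v ^ p * post_kernel v *
        exp (- ((g + 1) / (g * v) * q (\<beta> - post_mean)) / 2)"
      unfolding exps using v by (simp add: inverse_gamma_kernel_def joint_const_def real_sqrt_mult power_mult_distrib mult_ac)
    finally have eq: "inverse_gamma_kernel a b v * (mvn_density \<gamma> ((g * v) \<cdot>\<^sub>m gram_inv X) \<beta> * likelihood X bhat s \<beta> v) =
        joint_const / sqrt v ^ p * post_kernel v *
        exp (- ((g + 1) / (g * v) * q (\<beta> - post_mean)) / 2)" .
    have nn: "0 \<le> mvn_density \<gamma> ((g * v) \<cdot>\<^sub>m gram_inv X) \<beta>" "0 \<le> likelihood X bhat s \<beta> v"
      using dens gv norm_const_pos likelihood_nonneg[OF v \<beta>] by auto
    have cn: "0 \<le> joint_const / sqrt v ^ p * post_kernel v"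
      using v g_pos lik_const_pos norm_const_pos by (simp add: joint_const_def inverse_gamma_kernel_nonneg)
    show ?thesis
      using arg_cong[OF eq, of ennreal] nn cn
      by (simp only: ennreal_mult ennreal_mult'' exp_ge_zero inverse_gamma_kernel_nonneg mult_nonneg_nonneg mult.assoc)
         (simp only: mult.assoc[symmetric])
  qed
  have "?l = ennreal (inverse_gamma_kernel a b v) * (\<integral>\<^sup>+\<beta>. ennreal (mvn_density \<gamma> ((g * v) \<cdot>\<^sub>m gram_inv X) \<beta>) *
      (ennreal (likelihood X bhat s \<beta> v) * indicator B \<beta>) \<partial>vec_lborel p)"
    using g_pos by (simp add: g_prior_def dim) (subst nn_integral_density, auto)
  also have "\<dots> = (\<integral>\<^sup>+\<beta>. ennreal (inverse_gamma_kernel a b v) * (ennreal (mvn_density \<gamma> ((g * v) \<cdot>\<^sub>m gram_inv X) \<beta>) *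
      (ennreal (likelihood X bhat s \<beta> v) * indicator B \<beta>)) \<partial>vec_lborel p)"
    by (rule nn_integral_cmult[symmetric]) measurable
  also have "\<dots> = (\<integral>\<^sup>+\<beta>. ?c * (centered_kernel v \<beta> * indicator B \<beta>) \<partial>vec_lborel p)"
    by (rule nn_integral_cong) (use pointwise in simp)
  also have "\<dots> = ?c * ?r"
    by (rule nn_integral_cmult) measurable
  finally show ?thesis .
qed

lemma posterior_mass_pos_g:
  assumes g_pos: "0 < g" and B: "B \<in> sets (vec_lborel p)"
  shows "post_mass B =
    (\<integral>\<^sup>+v. joint_weight v *
      (\<integral>\<^sup>+\<beta>. centered_kernel v \<beta> * indicator B \<beta> \<partial>vec_lborel p) \<partial>lborel)"
  unfolding posterior_mass_def
proof (rule nn_integral_cong)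
  fix v :: real
  show "ennreal (inverse_gamma_kernel a b v) *
      (\<integral>\<^sup>+\<beta>. ennreal (likelihood X bhat s \<beta> v) * indicator B \<beta> \<partial>g_prior X \<gamma> g v) =
    joint_weight v *
      (\<integral>\<^sup>+\<beta>. centered_kernel v \<beta> * indicator B \<beta> \<partial>vec_lborel p)"
  proof (cases "0 < v")
    case True
    then show ?thesis
      by (rule kernel_mult_inner_integral[OF _ g_pos B])
  next
    case False
    then show ?thesis
      by (simp add: inverse_gamma_kernel_def)
  qed
qed

lemma posterior_mass_zero_g:
  assumes g0: "g = 0" and B: "B \<in> sets (vec_lborel p)"
  shows "post_mass B =
    indicator B \<gamma> * (ennreal lik_const * post_integral)"
proof -
  have dim: "dim_col X = p"
    using X by simp
  have scale: "post_scale = b + s + q (bhat - \<gamma>)"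
    unfolding post_scale_def by (simp add: g0)
  have "post_mass B =
      (\<integral>\<^sup>+v. indicator B \<gamma> * (ennreal lik_const * ennreal (post_kernel v)) \<partial>lborel)"
    unfolding posterior_mass_def
  proof (rule nn_integral_cong)
    fix v :: real
    show "ennreal (inverse_gamma_kernel a b v) *
        (\<integral>\<^sup>+\<beta>. ennreal (likelihood X bhat s \<beta> v) * indicator B \<beta> \<partial>g_prior X \<gamma> g v) =
      indicator B \<gamma> * (ennreal lik_const * ennreal (post_kernel v))"
    proof (cases "0 < v")
      case True
      have [measurable]: "(\<lambda>\<beta>. likelihood X bhat s \<beta> v) \<in> borel_measurable (vec_lborel p)"
        by (rule measurable_likelihood[OF True])
      have "(\<integral>\<^sup>+\<beta>. ennreal (likelihood X bhat s \<beta> v) * indicator B \<beta> \<partial>g_prior X \<gamma> g v) =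
          ennreal (likelihood X bhat s \<gamma> v) * indicator B \<gamma>"
        unfolding g_prior_def using g0 dim \<gamma> B by (simp add: nn_integral_return)
      moreover have "ennreal (inverse_gamma_kernel a b v) * ennreal (likelihood X bhat s \<gamma> v) =
          ennreal lik_const * ennreal (post_kernel v)"
        using kernel_mult_likelihood[OF True \<gamma>] lik_const_pos
          likelihood_nonneg[OF True \<gamma>] inverse_gamma_kernel_nonneg
        by (simp add: scale flip: ennreal_mult)
      ultimately show ?thesis
        by (metis mult.assoc mult.commute)
    next
      case False
      then show ?thesis
        by (simp add: inverse_gamma_kernel_def)
    qed
  qed
  also have "\<dots> = indicator B \<gamma> * (ennreal lik_const * post_integral)"
    unfolding inverse_gamma_integral_def by (subst nn_integral_cmult, measurable)+
  finally show ?thesis .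
qed

end

section \<open>Total mass, symmetry and tails of the posterior\<close>

lemma linf_ball_complement_measurable:
  assumes \<beta>: "\<beta>\<^sub>0 \<in> carrier_vec p" and \<epsilon>: "0 \<le> \<epsilon>"
  shows "{\<beta> \<in> carrier_vec p. \<epsilon> < linf_norm (\<beta> - \<beta>\<^sub>0)} \<in> sets (vec_lborel p)"
proof -
  have "{\<beta> \<in> space (vec_lborel p). \<exists>i\<in>{..<p}. \<epsilon> < \<bar>\<beta> $ i - \<beta>\<^sub>0 $ i\<bar>} \<in> sets (vec_lborel p)"
    by measurable
  also have "{\<beta> \<in> space (vec_lborel p). \<exists>i\<in>{..<p}. \<epsilon> < \<bar>\<beta> $ i - \<beta>\<^sub>0 $ i\<bar>} =
      {\<beta> \<in> carrier_vec p. \<epsilon> < linf_norm (\<beta> - \<beta>\<^sub>0)}"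
    using \<beta> by (auto simp: linf_norm_le_iff[OF \<epsilon>] not_le[symmetric])
  finally show ?thesis .
qed

context g_posterior
begin

lemma dim_col_X: "dim_col X = p"
  using X by simp

lemma carrier_vec_sets: "carrier_vec p \<in> sets (vec_lborel p)"
  using sets.top[of "vec_lborel p"] by simp

lemma nn_integral_centered:
  assumes m: "m \<in> carrier_vec p" and f [measurable]: "f \<in> borel_measurable (vec_lborel p)"
  shows "(\<integral>\<^sup>+\<beta>. f (\<beta> - m) \<partial>vec_lborel p) = (\<integral>\<^sup>+w. f w \<partial>vec_lborel p)"
proof -
  have "(\<lambda>\<beta>. f (\<beta> - m)) \<in> borel_measurable (vec_lborel p)"
    by (rule measurable_compose[OF measurable_vec_minus[OF measurable_vec_ident measurable_vec_const[OF m]] f])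
  then have "(\<integral>\<^sup>+w. f (m + w - m) \<partial>vec_lborel p) = (\<integral>\<^sup>+\<beta>. f (\<beta> - m) \<partial>vec_lborel p)"
    by (rule nn_integral_shift[OF m])
  moreover have "m + w - m = w" if "w \<in> carrier_vec p" for w
    using m that by (intro eq_vecI) auto
  then have "(\<integral>\<^sup>+w. f (m + w - m) \<partial>vec_lborel p) = (\<integral>\<^sup>+w. f w \<partial>vec_lborel p)"
    by (intro nn_integral_cong) simp
  ultimately show ?thesis
    by simp
qed

lemma post_mean_zero_g:
  assumes "g = 0"
  shows "post_mean = \<gamma>"
proof -
  have "(g / (g + 1)) \<cdot>\<^sub>v bhat + (1 / (g + 1)) \<cdot>\<^sub>v \<gamma> = \<gamma>"
    using assms bhat \<gamma> by (intro eq_vecI) auto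
  then show ?thesis
    by (simp only: post_mean_def)
qed

definition post_const :: real where
  "post_const = joint_const * sqrt (g / (g + 1)) ^ p"

lemma post_const_pos: "0 < g \<Longrightarrow> 0 < post_const"
  using lik_const_pos norm_const_pos by (simp add: post_const_def joint_const_def)

lemma joint_const_pos: "0 < g \<Longrightarrow> 0 < joint_const"
  using lik_const_pos norm_const_pos by (simp add: joint_const_def)

text \<open>The Gaussian integral contributes v^(p/2), which cancels the same power in
  \<open>joint_weight\<close>; what remains is the kernel of the marginal posterior of the
  variance.\<close>

lemma kernel_mult_Z:
  assumes v: "0 < v" and g_pos: "0 < g"
  shows "joint_weight v * Z ((g + 1) / (g * v)) =
    ennreal post_const * Z 1 * ennreal (post_kernel v)"
proof -
  have c: "0 < (g + 1) / (g * v)"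
    using v g_pos by simp
  have "1 / sqrt ((g + 1) / (g * v)) = sqrt (g / (g + 1)) * sqrt v"
    using v g_pos by (simp add: real_sqrt_divide real_sqrt_mult)
  then have "joint_const / sqrt v ^ p * post_kernel v * (1 / sqrt ((g + 1) / (g * v))) ^ p =
      post_const * post_kernel v"
    using v by (simp add: power_mult_distrib post_const_def)
  moreover have "0 \<le> joint_const / sqrt v ^ p * post_kernel v"
    using v joint_const_pos[OF g_pos] inverse_gamma_kernel_nonneg by simp
  moreover have "0 \<le> (1 / sqrt ((g + 1) / (g * v))) ^ p"
    using c by simp
  ultimately have JS: "joint_weight v *
      ennreal ((1 / sqrt ((g + 1) / (g * v))) ^ p) =
      ennreal post_const * ennreal (post_kernel v)"
    using post_const_pos[OF g_pos] inverse_gamma_kernel_nonneg by (metis ennreal_mult less_imp_le)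
  show ?thesis
    unfolding Z_eq[OF c] mult.assoc[symmetric] JS by (simp only: mult_ac)
qed

lemma centered_integral:
  assumes v: "0 < v" and g_pos: "0 < g"
  shows "(\<integral>\<^sup>+\<beta>. centered_kernel v \<beta> \<partial>vec_lborel p) = Z ((g + 1) / (g * v))"
  unfolding Z_def
  by (rule nn_integral_centered[OF post_mean_carrier, of "\<lambda>w. ennreal (exp (- ((g + 1) / (g * v) * q w) / 2))"]) measurable

lemma posterior_mass_total_pos_g:
  assumes g_pos: "0 < g"
  shows "post_mass (carrier_vec p) =
    ennreal post_const * Z 1 * post_integral"
proof -
  have "post_mass (carrier_vec p) =
      (\<integral>\<^sup>+v. ennreal post_const * Z 1 * ennreal (post_kernel v) \<partial>lborel)"
    unfolding posterior_mass_pos_g[OF g_pos carrier_vec_sets]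
  proof (rule nn_integral_cong)
    fix v :: real
    show "joint_weight v *
        (\<integral>\<^sup>+\<beta>. centered_kernel v \<beta> * indicator (carrier_vec p) \<beta> \<partial>vec_lborel p) =
      ennreal post_const * Z 1 * ennreal (post_kernel v)"
    proof (cases "0 < v")
      case True
      have "(\<integral>\<^sup>+\<beta>. centered_kernel v \<beta> * indicator (carrier_vec p) \<beta> \<partial>vec_lborel p) =
          Z ((g + 1) / (g * v))"
        by (subst centered_integral[OF True g_pos, symmetric]) (auto intro!: nn_integral_cong)
      then show ?thesis
        using kernel_mult_Z[OF True g_pos] by simp
    next
      case False
      then show ?thesis
        by (simp add: inverse_gamma_kernel_def)
    qed
  qed
  also have "\<dots> = ennreal post_const * Z 1 * post_integral"
    unfolding inverse_gamma_integral_def by (rule nn_integral_cmult) measurable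
  finally show ?thesis .
qed

text \<open>Properness of the posterior: in both cases of g the total mass is a positive finite
  constant times \<open>post_integral\<close>. This licenses the division in Bayes' formula.\<close>

lemma posterior_mass_total:
  assumes an: "2 \<le> a + n"
  shows "0 < post_mass (carrier_vec p)"
    and "post_mass (carrier_vec p) < \<infinity>"
proof -
  have I: "0 < post_integral" "post_integral < \<infinity>"
    using inverse_gamma_integral_pos inverse_gamma_integral_finite[OF an post_scale_pos] by auto
  obtain c where c: "0 < c" "c < \<infinity>"
    "post_mass (carrier_vec p) = c * post_integral"
  proof (cases "g = 0")
    case True
    show thesis
      by (rule that[of "ennreal lik_const"])
        (use posterior_mass_zero_g[OF True carrier_vec_sets] \<gamma> lik_const_pos in simp_all)
  next
    case False
    then have "0 < g"
      using g by simp
    then show thesis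
      by (intro that[of "ennreal post_const * Z 1"] posterior_mass_total_pos_g)
        (use post_const_pos Z_1_pos Z_1_finite in \<open>simp_all add: ennreal_zero_less_mult_iff ennreal_mult_less_top\<close>)
  qed
  show "0 < post_mass (carrier_vec p)"
    using c I by (simp add: ennreal_zero_less_mult_iff)
  show "post_mass (carrier_vec p) < \<infinity>"
    using c I by (simp add: ennreal_mult_less_top)
qed

text \<open>The posterior of \<open>\<beta>\<close> is symmetric about its mean \<open>m\<close>, and the reflection \<open>\<beta> \<mapsto> 2 m - \<beta>\<close> maps the
  \<open>\<epsilon>\<close>-ball around \<open>\<beta>\<^sub>0\<close> into its complement whenever \<open>m\<close> is not in the ball.\<close>

lemma posterior_prob_ge_half:
  assumes an: "2 \<le> a + n" and \<beta>0: "\<beta>\<^sub>0 \<in> carrier_vec p" and \<epsilon>: "0 \<le> \<epsilon>"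
    and far: "\<epsilon> < linf_norm (post_mean - \<beta>\<^sub>0)"
  shows "ennreal (1 / 2) \<le> posterior_prob X \<gamma> a b g bhat s {\<beta> \<in> carrier_vec p. \<epsilon> < linf_norm (\<beta> - \<beta>\<^sub>0)}"
proof -
  let ?B = "{\<beta> \<in> carrier_vec p. \<epsilon> < linf_norm (\<beta> - \<beta>\<^sub>0)}"
  let ?T = "post_mass (carrier_vec p)"
  note m = post_mean_carrier
  have B [measurable]: "?B \<in> sets (vec_lborel p)"
    by (rule linf_ball_complement_measurable[OF \<beta>0 \<epsilon>])
  have reflect: "post_mean - w \<in> ?B" if w: "w \<in> carrier_vec p" and "post_mean + w \<notin> ?B" for w
  proof -
    have le: "linf_norm (post_mean + w - \<beta>\<^sub>0) \<le> \<epsilon>"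
      using that m by auto
    have "2 \<cdot>\<^sub>v (post_mean - \<beta>\<^sub>0) = (post_mean + w - \<beta>\<^sub>0) + (post_mean - w - \<beta>\<^sub>0)"
      using m w \<beta>0 by (intro eq_vecI) auto
    then have "2 * linf_norm (post_mean - \<beta>\<^sub>0) \<le> linf_norm (post_mean + w - \<beta>\<^sub>0) + linf_norm (post_mean - w - \<beta>\<^sub>0)"
      using linf_norm_add[of "post_mean + w - \<beta>\<^sub>0" p "post_mean - w - \<beta>\<^sub>0"] m w \<beta>0
        linf_norm_smult[of 2 "post_mean - \<beta>\<^sub>0"] by simp
    then have "\<epsilon> < linf_norm (post_mean - w - \<beta>\<^sub>0)"
      using le far by linarith
    then show ?thesis
      using m w by simp
  qed
  have "ennreal (1 / 2) * ?T \<le> post_mass ?B"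
  proof (cases "g = 0")
    case True
    have "post_mean = \<gamma>"
      by (rule post_mean_zero_g[OF True])
    then have "\<gamma> \<in> ?B"
      using far \<gamma> by simp
    then have "post_mass ?B = ?T"
      using posterior_mass_zero_g[OF True B] posterior_mass_zero_g[OF True carrier_vec_sets] \<gamma> by simp
    moreover have "ennreal (1 / 2) * ?T \<le> 1 * ?T"
      by (rule mult_right_mono, subst ennreal_le_1) auto
    ultimately show ?thesis
      by simp
  next
    case False
    then have g_pos: "0 < g"
      using g by simp
    have half: "ennreal (1 / 2) * Z ((g + 1) / (g * v)) \<le>
        (\<integral>\<^sup>+\<beta>. centered_kernel v \<beta> * indicator ?B \<beta> \<partial>vec_lborel p)"
      (is "_ \<le> ?I") if v: "0 < v" for v
    proof -
      define c where "c = (g + 1) / (g * v)"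
      define E where "E w = ennreal (exp (- (c * q w) / 2))" for w
      have [measurable]: "E \<in> borel_measurable (vec_lborel p)"
        unfolding E_def by measurable
      have neg: "(-1) \<cdot>\<^sub>v w = - w" for w :: "real Matrix.vec"
        by (intro eq_vecI) auto
      have mw [measurable]: "(\<lambda>w. post_mean + w) \<in> measurable (vec_lborel p) (vec_lborel p)"
        by (rule measurable_vec_add[OF measurable_vec_const[OF m] measurable_vec_ident])
      have uw [measurable]: "(\<lambda>w. - w) \<in> measurable (vec_lborel p) (vec_lborel p)"
        using measurable_vec_smult[OF measurable_vec_ident, of "-1" p] by (simp add: neg)
      have "?I = (\<integral>\<^sup>+\<beta>. E (\<beta> - post_mean) * indicator ?B (post_mean + (\<beta> - post_mean)) \<partial>vec_lborel p)"
      proof (rule nn_integral_cong)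
        fix \<beta> :: "real Matrix.vec" assume "\<beta> \<in> space (vec_lborel p)"
        then have "post_mean + (\<beta> - post_mean) = \<beta>"
          using m by (intro eq_vecI) auto
        then show "centered_kernel v \<beta> * indicator ?B \<beta> =
            E (\<beta> - post_mean) * indicator ?B (post_mean + (\<beta> - post_mean))"
          by (simp add: E_def c_def)
      qed
      also have "\<dots> = (\<integral>\<^sup>+w. E w * indicator ?B (post_mean + w) \<partial>vec_lborel p)"
        by (rule nn_integral_centered[OF m, of "\<lambda>w. E w * indicator ?B (post_mean + w)"]) measurable
      finally have I: "?I = (\<integral>\<^sup>+w. E w * indicator ?B (post_mean + w) \<partial>vec_lborel p)" .
      have "ennreal (\<bar>-1\<bar> ^ p) * (\<integral>\<^sup>+w. E (0\<^sub>v p + (-1) \<cdot>\<^sub>v w) * indicator ?B (post_mean + (0\<^sub>v p + (-1) \<cdot>\<^sub>v w)) \<partial>vec_lborel p) = ?I"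
        unfolding I by (rule nn_integral_vec_affine) auto
      also have "(\<integral>\<^sup>+w. E (0\<^sub>v p + (-1) \<cdot>\<^sub>v w) * indicator ?B (post_mean + (0\<^sub>v p + (-1) \<cdot>\<^sub>v w)) \<partial>vec_lborel p) =
          (\<integral>\<^sup>+w. E w * indicator ?B (post_mean + - w) \<partial>vec_lborel p)"
      proof (rule nn_integral_cong)
        fix w :: "real Matrix.vec" assume "w \<in> space (vec_lborel p)"
        then have w: "w \<in> carrier_vec p"
          by simp
        then have "0\<^sub>v p + (-1) \<cdot>\<^sub>v w = (-1) \<cdot>\<^sub>v w"
          by simp
        moreover have "E ((-1) \<cdot>\<^sub>v w) = E w"
          using w by (simp only: E_def q_smult) simp
        ultimately show "E (0\<^sub>v p + (-1) \<cdot>\<^sub>v w) * indicator ?B (post_mean + (0\<^sub>v p + (-1) \<cdot>\<^sub>v w)) = E w * indicator ?B (post_mean + - w)"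
          by (simp only: neg)
      qed
      finally have I': "?I = (\<integral>\<^sup>+w. E w * indicator ?B (post_mean + - w) \<partial>vec_lborel p)"
        by simp
      \<comment> \<open>For every w at least one of the two reflected points lies in the set, so the
        two indicators sum to at least 1.\<close>
      have "Z c \<le> (\<integral>\<^sup>+w. E w * indicator ?B (post_mean + w) + E w * indicator ?B (post_mean + - w) \<partial>vec_lborel p)"
        unfolding Z_def
      proof (rule nn_integral_mono)
        fix w :: "real Matrix.vec" assume "w \<in> space (vec_lborel p)"
        then have w: "w \<in> carrier_vec p"
          by simp
        have "post_mean + - w = post_mean - w"
          using m w by (intro eq_vecI) auto
        then show "ennreal (exp (- (c * q w) / 2)) \<le> E w * indicator ?B (post_mean + w) + E w * indicator ?B (post_mean + - w)"
          using reflect[OF w] unfolding E_def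
          by (cases "post_mean + w \<in> ?B") (simp_all add: indicator_def)
      qed
      also have "\<dots> = ?I + ?I"
      proof (subst nn_integral_add)
        show "(\<lambda>w. E w * indicator ?B (post_mean + w)) \<in> borel_measurable (vec_lborel p)"
          "(\<lambda>w. E w * indicator ?B (post_mean + - w)) \<in> borel_measurable (vec_lborel p)"
          by measurable
      qed (simp only: I[symmetric] I'[symmetric])
      also have "\<dots> = ennreal 2 * ?I"
        by (simp add: mult_2[symmetric])
      finally have "ennreal (1 / 2) * Z c \<le> ennreal (1 / 2) * (ennreal 2 * ?I)"
        by (rule mult_left_mono) simp
      also have "\<dots> = ?I"
        by (subst mult.assoc[symmetric], subst ennreal_mult[symmetric]) auto
      finally show ?thesis
        by (simp only: c_def)
    qed
    have "ennreal (1 / 2) * ?T =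
        (\<integral>\<^sup>+v. ennreal (1 / 2) * (ennreal post_const * Z 1) * ennreal (post_kernel v) \<partial>lborel)"
    proof -
      have "(\<integral>\<^sup>+v. ennreal (1 / 2) * (ennreal post_const * Z 1) * ennreal (post_kernel v) \<partial>lborel) =
          ennreal (1 / 2) * (ennreal post_const * Z 1) * post_integral"
        unfolding inverse_gamma_integral_def by (rule nn_integral_cmult) measurable
      then show ?thesis
        by (simp only: posterior_mass_total_pos_g[OF g_pos] mult.assoc)
    qed
    also have "\<dots> \<le> post_mass ?B"
      unfolding posterior_mass_pos_g[OF g_pos B]
    proof (rule nn_integral_mono)
      fix v :: real
      show "ennreal (1 / 2) * (ennreal post_const * Z 1) * ennreal (post_kernel v) \<le>
        joint_weight v *
        (\<integral>\<^sup>+\<beta>. centered_kernel v \<beta> * indicator ?B \<beta> \<partial>vec_lborel p)"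
      proof (cases "0 < v")
        case True
        have "ennreal (1 / 2) * (ennreal post_const * Z 1) * ennreal (post_kernel v) =
            joint_weight v * (ennreal (1 / 2) * Z ((g + 1) / (g * v)))"
          unfolding mult.left_commute[of "joint_weight v"]
            kernel_mult_Z[OF True g_pos] by (simp only: mult.assoc)
        also have "\<dots> \<le> joint_weight v *
            (\<integral>\<^sup>+\<beta>. centered_kernel v \<beta> * indicator ?B \<beta> \<partial>vec_lborel p)"
          by (rule mult_left_mono[OF half[OF True]]) simp
        finally show ?thesis .
      next
        case False
        then show ?thesis
          by (simp add: inverse_gamma_kernel_def)
      qed
    qed
    finally show ?thesis .
  qed
  then have "ennreal (1 / 2) * ?T / ?T \<le> posterior_prob X \<gamma> a b g bhat s ?B"
    unfolding posterior_prob_def dim_col_X by (rule divide_right_mono_ennreal)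
  moreover have "ennreal (1 / 2) * ?T / ?T = ennreal (1 / 2)"
    using posterior_mass_total[OF an] by (subst ennreal_mult_divide_eq) auto
  ultimately show ?thesis
    by simp
qed

text \<open>Markov's inequality with fourth powers: outside the ball some coordinate of \<beta> -
  \<open>post_mean\<close> exceeds \<epsilon>/2. Given v, the fourth moments are of order K^2 v^2,
  and averaging v^2 over its marginal posterior yields the last factor.\<close>

lemma posterior_prob_le:
  assumes an: "6 \<le> a + n" and \<beta>0: "\<beta>\<^sub>0 \<in> carrier_vec p" and \<epsilon>: "0 < \<epsilon>"
    and near: "linf_norm (post_mean - \<beta>\<^sub>0) \<le> \<epsilon> / 2"
    and K: "\<And>i. i < p \<Longrightarrow> gram_inv X $$ (i, i) \<le> K" "0 < K"
  shows "posterior_prob X \<gamma> a b g bhat s {\<beta> \<in> carrier_vec p. \<epsilon> < linf_norm (\<beta> - \<beta>\<^sub>0)} \<le>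
    ennreal (1024 * (2 / \<epsilon>) ^ 4 * p * K\<^sup>2 * (post_scale\<^sup>2 / ((a + n - 2) * (a + n - 4))))"
proof -
  let ?B = "{\<beta> \<in> carrier_vec p. \<epsilon> < linf_norm (\<beta> - \<beta>\<^sub>0)}"
  let ?T = "post_mass (carrier_vec p)"
  define C where "C = 1024 * (2 / \<epsilon>) ^ 4 * p * K\<^sup>2"
  define R where "R = post_scale\<^sup>2 / ((a + n - 2) * (a + n - 4))"
  have C: "0 \<le> C"
    using \<epsilon> by (simp add: C_def)
  have R: "0 \<le> R"
    using an by (simp add: R_def)
  note m = post_mean_carrier
  have B [measurable]: "?B \<in> sets (vec_lborel p)"
    using linf_ball_complement_measurable[OF \<beta>0, of \<epsilon>] \<epsilon> by simp
  have "post_mass ?B \<le> ennreal (C * R) * ?T"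
  proof (cases "g = 0")
    case True
    have "post_mean = \<gamma>"
      by (rule post_mean_zero_g[OF True])
    then have "\<gamma> \<notin> ?B"
      using near \<epsilon> by auto
    then show ?thesis
      using posterior_mass_zero_g[OF True B] by simp
  next
    case False
    then have g_pos: "0 < g"
      using g by simp
    have tail: "(\<integral>\<^sup>+\<beta>. centered_kernel v \<beta> * indicator ?B \<beta> \<partial>vec_lborel p) \<le>
        ennreal (C * v\<^sup>2) * Z ((g + 1) / (g * v))" (is "?I \<le> _") if v: "0 < v" for v
    proof -
      define c where "c = (g + 1) / (g * v)"
      have c: "0 < c"
        using v g_pos by (simp add: c_def)
      \<comment> \<open>Shrinkage only reduces the conditional covariance, as g/(g + 1) \<le> 1;
        hence a bound uniform in g.\<close>
      have "1 / c = v * (g / (g + 1))"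
        using v g_pos by (simp add: c_def)
      also have "\<dots> \<le> v * 1"
        using v g_pos by (intro mult_left_mono) auto
      finally have cv: "1 / c \<le> v"
        by simp
      have "?I \<le> (\<integral>\<^sup>+\<beta>. ennreal (exp (- (c * q (\<beta> - post_mean)) / 2)) *
          (\<Sum>i<p. ennreal ((2 / \<epsilon>) ^ 4) * ennreal (((\<beta> - post_mean) $ i) ^ 4)) \<partial>vec_lborel p)"
      proof (rule nn_integral_mono)
        fix \<beta> :: "real Matrix.vec" assume "\<beta> \<in> space (vec_lborel p)"
        then have \<beta>: "\<beta> \<in> carrier_vec p"
          by simp
        have "indicator ?B \<beta> \<le> (\<Sum>i<p. ennreal ((2 / \<epsilon>) ^ 4) * ennreal (((\<beta> - post_mean) $ i) ^ 4))"
        proof (cases "\<beta> \<in> ?B")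
          case True
          have "\<not> linf_norm (\<beta> - post_mean) \<le> \<epsilon> / 2"
          proof
            assume le: "linf_norm (\<beta> - post_mean) \<le> \<epsilon> / 2"
            have "\<beta> - \<beta>\<^sub>0 = (\<beta> - post_mean) + (post_mean - \<beta>\<^sub>0)"
              using \<beta> m \<beta>0 by (intro eq_vecI) auto
            then have "linf_norm (\<beta> - \<beta>\<^sub>0) \<le> \<epsilon>"
              using linf_norm_add[of "\<beta> - post_mean" p "post_mean - \<beta>\<^sub>0"] le near \<beta> m \<beta>0 by simp
            then show False
              using True by simp
          qed
          then obtain i where i: "i < p" "\<epsilon> / 2 < \<bar>(\<beta> - post_mean) $ i\<bar>"
            using linf_norm_le_iff[of "\<epsilon> / 2" "\<beta> - post_mean"] \<epsilon> m by (auto simp: not_le)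
          define y where "y = (\<beta> - post_mean) $ i"
          have "1 \<le> 2 / \<epsilon> * \<bar>y\<bar>"
            using i(2) \<epsilon> by (simp add: y_def field_simps)
          then have "1 \<le> (2 / \<epsilon> * \<bar>y\<bar>) ^ 4"
            by (rule one_le_power)
          also have "\<dots> = (2 / \<epsilon>) ^ 4 * y ^ 4"
            by (simp only: power_mult_distrib power_even_abs_numeral even_numeral)
          finally have "1 \<le> ennreal ((2 / \<epsilon>) ^ 4) * ennreal (y ^ 4)"
            using \<epsilon> by (simp flip: ennreal_mult)
          also have "\<dots> \<le> (\<Sum>i<p. ennreal ((2 / \<epsilon>) ^ 4) * ennreal (((\<beta> - post_mean) $ i) ^ 4))"
            unfolding y_def using i(1)
            by (intro member_le_sum[where f="\<lambda>i. ennreal ((2 / \<epsilon>) ^ 4) * ennreal (((\<beta> - post_mean) $ i) ^ 4)"]) auto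
          finally show ?thesis
            using True by simp
        qed simp
        then show "centered_kernel v \<beta> * indicator ?B \<beta> \<le>
            ennreal (exp (- (c * q (\<beta> - post_mean)) / 2)) *
            (\<Sum>i<p. ennreal ((2 / \<epsilon>) ^ 4) * ennreal (((\<beta> - post_mean) $ i) ^ 4))"
          unfolding c_def by (rule mult_left_mono) simp
      qed
      also have "\<dots> = (\<integral>\<^sup>+w. ennreal (exp (- (c * q w) / 2)) *
          (\<Sum>i<p. ennreal ((2 / \<epsilon>) ^ 4) * ennreal ((w $ i) ^ 4)) \<partial>vec_lborel p)"
        by (rule nn_integral_centered[OF m, of "\<lambda>w. ennreal (exp (- (c * q w) / 2)) *
          (\<Sum>i<p. ennreal ((2 / \<epsilon>) ^ 4) * ennreal ((w $ i) ^ 4))"]) measurable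
      also have "\<dots> = (\<integral>\<^sup>+w. (\<Sum>i<p. ennreal ((2 / \<epsilon>) ^ 4) * ennreal ((w $ i) ^ 4 * exp (- (c * q w) / 2))) \<partial>vec_lborel p)"
        by (intro nn_integral_cong) (simp add: sum_distrib_left ennreal_mult mult_ac)
      also have "\<dots> = (\<Sum>i<p. ennreal ((2 / \<epsilon>) ^ 4) * (\<integral>\<^sup>+w. ennreal ((w $ i) ^ 4 * exp (- (c * q w) / 2)) \<partial>vec_lborel p))"
      proof (subst nn_integral_sum)
        show "(\<lambda>w. ennreal ((2 / \<epsilon>) ^ 4) * ennreal ((w $ i) ^ 4 * exp (- (c * q w) / 2))) \<in> borel_measurable (vec_lborel p)"
          if i: "i \<in> {..<p}" for i
        proof -
          have [measurable]: "(\<lambda>w. w $ i) \<in> borel_measurable (vec_lborel p)"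
            using i by (intro measurable_vec_index) simp
          show ?thesis
            by measurable
        qed
        show "(\<Sum>i<p. \<integral>\<^sup>+w. ennreal ((2 / \<epsilon>) ^ 4) * ennreal ((w $ i) ^ 4 * exp (- (c * q w) / 2)) \<partial>vec_lborel p) =
            (\<Sum>i<p. ennreal ((2 / \<epsilon>) ^ 4) * (\<integral>\<^sup>+w. ennreal ((w $ i) ^ 4 * exp (- (c * q w) / 2)) \<partial>vec_lborel p))"
        proof (intro sum.cong refl nn_integral_cmult)
          fix i assume i: "i \<in> {..<p}"
          have [measurable]: "(\<lambda>w. w $ i) \<in> borel_measurable (vec_lborel p)"
            using i by (intro measurable_vec_index) simp
          show "(\<lambda>w. ennreal ((w $ i) ^ 4 * exp (- (c * q w) / 2))) \<in> borel_measurable (vec_lborel p)"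
            by measurable
        qed
      qed
      also have "\<dots> \<le> (\<Sum>i<p. ennreal ((2 / \<epsilon>) ^ 4) * (ennreal (1024 * (K * v)\<^sup>2) * Z c))"
      proof (intro sum_mono mult_left_mono)
        fix i assume "i \<in> {..<p}"
        then have "(\<integral>\<^sup>+w. ennreal ((w $ i) ^ 4 * exp (- (c * q w) / 2)) \<partial>vec_lborel p) \<le> ennreal (1024 * (K / c)\<^sup>2) * Z c"
          using K by (intro fourth_moment_le[OF c]) auto
        also have "\<dots> \<le> ennreal (1024 * (K * v)\<^sup>2) * Z c"
        proof (intro mult_right_mono ennreal_leI mult_left_mono power_mono)
          show "K / c \<le> K * v"
            using cv K(2) mult_left_mono[OF cv, of K] by simp
        qed (use c K in auto)
        finally show "(\<integral>\<^sup>+w. ennreal ((w $ i) ^ 4 * exp (- (c * q w) / 2)) \<partial>vec_lborel p) \<le> ennreal (1024 * (K * v)\<^sup>2) * Z c" .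
      qed auto
      also have "\<dots> = (ennreal p * (ennreal ((2 / \<epsilon>) ^ 4) * ennreal (1024 * (K * v)\<^sup>2))) * Z c"
        by (simp add: ennreal_of_nat_eq_real_of_nat mult.assoc)
      also have "ennreal p * (ennreal ((2 / \<epsilon>) ^ 4) * ennreal (1024 * (K * v)\<^sup>2)) = ennreal (C * v\<^sup>2)"
        using \<epsilon> by (subst ennreal_mult[symmetric], simp, simp, subst ennreal_mult[symmetric])
          (auto simp: C_def power_mult_distrib mult_ac)
      finally show ?thesis
        by (simp only: c_def)
    qed
    have "post_mass ?B \<le>
        (\<integral>\<^sup>+v. ennreal C * (ennreal post_const * Z 1) * ennreal (inverse_gamma_kernel (a + n - 4) post_scale v) \<partial>lborel)"
      unfolding posterior_mass_pos_g[OF g_pos B]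
    proof (rule nn_integral_mono)
      fix v :: real
      show "joint_weight v *
        (\<integral>\<^sup>+\<beta>. centered_kernel v \<beta> * indicator ?B \<beta> \<partial>vec_lborel p) \<le>
        ennreal C * (ennreal post_const * Z 1) * ennreal (inverse_gamma_kernel (a + n - 4) post_scale v)"
      proof (cases "0 < v")
        case True
        \<comment> \<open>Absorbing v^2 shifts a + n to a + n - 4;
          \<open>inverse_gamma_integral_reduce2\<close>, available for 6 \<le> a + n, returns to the
          normalizing integral.\<close>
        have "v\<^sup>2 * post_kernel v = inverse_gamma_kernel (a + n - 4) post_scale v"
        proof -
          have "v\<^sup>2 * v powr (- (a + n) / 2 - 1) = v powr (2 + (- (a + n) / 2 - 1))"
            using True by (simp only: powr_add) (simp add: powr_numeral)
          also have "2 + (- (a + n) / 2 - 1) = - (a + n - 4) / 2 - 1"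
            by (simp add: field_simps)
          finally show ?thesis
            using True by (simp add: inverse_gamma_kernel_def flip: mult.assoc)
        qed
        then have "ennreal (v\<^sup>2) * ennreal (post_kernel v) = ennreal (inverse_gamma_kernel (a + n - 4) post_scale v)"
          using inverse_gamma_kernel_nonneg by (simp flip: ennreal_mult)
        moreover have "joint_weight v *
            (\<integral>\<^sup>+\<beta>. centered_kernel v \<beta> * indicator ?B \<beta> \<partial>vec_lborel p) \<le>
            joint_weight v * (ennreal (C * v\<^sup>2) * Z ((g + 1) / (g * v)))"
          by (rule mult_left_mono[OF tail[OF True]]) simp
        moreover have "joint_weight v *
            (ennreal (C * v\<^sup>2) * Z ((g + 1) / (g * v))) =
            ennreal C * (ennreal post_const * Z 1) * (ennreal (v\<^sup>2) * ennreal (post_kernel v))"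
          unfolding mult.left_commute[of "joint_weight v"]
            kernel_mult_Z[OF True g_pos] ennreal_mult[OF C zero_le_power2] by (simp only: mult_ac)
        ultimately show ?thesis
          by simp
      next
        case False
        then show ?thesis
          by (simp add: inverse_gamma_kernel_def)
      qed
    qed
    also have "\<dots> = ennreal C * (ennreal post_const * Z 1) * inverse_gamma_integral (a + n - 4) post_scale"
      unfolding inverse_gamma_integral_def by (rule nn_integral_cmult) measurable
    also have "\<dots> = ennreal C * (ennreal post_const * Z 1) * (ennreal R * post_integral)"
      unfolding R_def inverse_gamma_integral_reduce2[OF an post_scale_pos] ..
    also have "\<dots> = ennreal (C * R) * ?T"
      unfolding posterior_mass_total_pos_g[OF g_pos] using C R by (simp add: ennreal_mult mult_ac)
    finally show ?thesis .
  qed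
  then have "posterior_prob X \<gamma> a b g bhat s ?B \<le> ennreal (C * R) * ?T / ?T"
    unfolding posterior_prob_def dim_col_X by (rule divide_right_mono_ennreal)
  also have "\<dots> = ennreal (C * R)"
    using posterior_mass_total an by (subst ennreal_mult_divide_eq) auto
  finally show ?thesis
    by (simp add: C_def R_def)
qed

end

section \<open>Deviation bounds for the errors\<close>

context gaussian_linear_model
begin

text \<open>The least squares map applied to the error vector; by \<open>ols_model\<close> this is
  the estimation error.\<close>

definition err_proj :: "real Matrix.vec \<Rightarrow> real Matrix.vec" where
  "err_proj x = gram_inv X *\<^sub>v (transpose_mat X *\<^sub>v x)"

text \<open>The residual sum of squares of the error vector in Pythagorean form, see
  \<open>err_rss_eq\<close>; in this shape \<open>projection_mgf\<close> applies to it.\<close>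

definition err_rss :: "real Matrix.vec \<Rightarrow> real" where
  "err_rss x = x \<bullet> x - q (err_proj x)"

lemma XT: "transpose_mat X \<in> carrier_mat p n"
  using X by simp

lemma err_proj_carrier: "x \<in> carrier_vec n \<Longrightarrow> err_proj x \<in> carrier_vec p"
  using XT Gi by (simp add: err_proj_def)

lemma measurable_err_proj: "err_proj \<in> measurable (vec_lborel n) (vec_lborel p)"
  unfolding err_proj_def[abs_def]
  by (rule measurable_mult_mat_vec[OF Gi measurable_mult_mat_vec[OF XT measurable_vec_ident]])

lemmas measurable_q_err_proj [measurable] = measurable_q[OF measurable_err_proj]

lemma measurable_norm_sq [measurable]: "(\<lambda>x. x \<bullet> x) \<in> borel_measurable (vec_lborel m)"
  by (rule measurable_scalar_prod[OF measurable_vec_ident measurable_vec_ident])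

lemma measurable_err_rss [measurable]: "err_rss \<in> borel_measurable (vec_lborel n)"
  unfolding err_rss_def[abs_def] by measurable

lemma q_err_proj:
  assumes "x \<in> carrier_vec n"
  shows "q (err_proj x) = (transpose_mat X *\<^sub>v x) \<bullet> (gram_inv X *\<^sub>v (transpose_mat X *\<^sub>v x))"
  using q_Gi XT assms by (simp add: err_proj_def)

lemma q_eq_norm_sq: "w \<in> carrier_vec p \<Longrightarrow> q w = (X *\<^sub>v w) \<bullet> (X *\<^sub>v w)"
  using transpose_mult_self_form[OF X] by (simp only: q_def)

lemma err_rss_eq:
  assumes x: "x \<in> carrier_vec n"
  shows "err_rss x = (x - X *\<^sub>v err_proj x) \<bullet> (x - X *\<^sub>v err_proj x)"
proof -
  define z where "z = err_proj x"
  have z: "z \<in> carrier_vec p"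
    using x by (simp add: z_def err_proj_carrier)
  have Xz: "X *\<^sub>v z \<in> carrier_vec n"
    using X z by simp
  have "x \<bullet> (X *\<^sub>v z) = (transpose_mat X *\<^sub>v x) \<bullet> z"
    by (rule transpose_vec_mult_scalar[OF X z x, symmetric])
  also have "\<dots> = q z"
    using q_err_proj[OF x] by (simp add: z_def err_proj_def)
  finally have xXz: "x \<bullet> (X *\<^sub>v z) = q z" .
  have "(x - X *\<^sub>v z) \<bullet> (x - X *\<^sub>v z) = x \<bullet> x - x \<bullet> (X *\<^sub>v z) - (X *\<^sub>v z) \<bullet> x + (X *\<^sub>v z) \<bullet> (X *\<^sub>v z)"
    using x Xz by (simp add: minus_scalar_prod_distrib[of _ n] scalar_prod_minus_distrib[of _ n])
  then show ?thesis
    using xXz q_eq_norm_sq[OF z] comm_scalar_prod[OF x Xz] by (simp add: err_rss_def z_def)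
qed

lemma err_rss_nonneg: "x \<in> carrier_vec n \<Longrightarrow> 0 \<le> err_rss x"
  by (simp add: err_rss_eq scalar_prod_self_ge_0)

lemma q_err_proj_le: "x \<in> carrier_vec n \<Longrightarrow> q (err_proj x) \<le> x \<bullet> x"
  using err_rss_nonneg[of x] by (simp add: err_rss_def)

lemma ols_model:
  assumes \<beta>: "\<beta> \<in> carrier_vec p" and x: "x \<in> carrier_vec n"
  shows "ols X (X *\<^sub>v \<beta> + x) = \<beta> + err_proj x"
proof -
  have "transpose_mat X *\<^sub>v (X *\<^sub>v \<beta> + x) = (transpose_mat X * X) *\<^sub>v \<beta> + transpose_mat X *\<^sub>v x"
    using assoc_mult_mat_vec[OF XT X \<beta>] X XT x \<beta> by (simp add: mult_add_distrib_mat_vec[of _ p n])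
  then have "ols X (X *\<^sub>v \<beta> + x) = gram_inv X *\<^sub>v ((transpose_mat X * X) *\<^sub>v \<beta>) + err_proj x"
    using X XT x \<beta> G Gi mult_add_distrib_mat_vec[OF Gi, of "(transpose_mat X * X) *\<^sub>v \<beta>" "transpose_mat X *\<^sub>v x"]
    by (simp add: ols_def err_proj_def)
  then show ?thesis
    by (simp only: Gi_G_vec[OF \<beta>])
qed

lemma rss_model:
  assumes \<beta>: "\<beta> \<in> carrier_vec p" and x: "x \<in> carrier_vec n"
  shows "rss X (X *\<^sub>v \<beta> + x) = err_rss x"
proof -
  have "X *\<^sub>v \<beta> + x - X *\<^sub>v (\<beta> + err_proj x) = x - X *\<^sub>v err_proj x"
    using X \<beta> x err_proj_carrier[OF x] mult_add_distrib_mat_vec[OF X \<beta> err_proj_carrier[OF x]]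
    by (intro eq_vecI) (auto simp: scalar_prod_add_distrib[of _ p])
  then show ?thesis
    unfolding rss_def ols_model[OF \<beta> x] l2_norm_sq err_rss_eq[OF x] by simp
qed

text \<open>The functional is l = X (X^T X)^{-1} u for the unit vector u of index i. Its squared
  length, times \<sigma>^2, is the variance of this coordinate of the estimation error.\<close>

lemma err_proj_index:
  assumes i: "i < p"
  obtains l where "l \<in> carrier_vec n" "\<And>x. x \<in> carrier_vec n \<Longrightarrow> err_proj x $ i = l \<bullet> x"
    "l \<bullet> l = gram_inv X $$ (i, i)"
proof
  define u :: "real Matrix.vec" where "u = unit_vec p i"
  have ux: "u \<bullet> y = y $ i" if "y \<in> carrier_vec p" for y
    using i that by (auto simp: u_def)
  have u: "u \<in> carrier_vec p"
    by (simp add: u_def)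
  have Gu: "gram_inv X *\<^sub>v u \<in> carrier_vec p"
    using Gi u by simp
  show "X *\<^sub>v (gram_inv X *\<^sub>v u) \<in> carrier_vec n"
    using X Gu by simp
  show "err_proj x $ i = (X *\<^sub>v (gram_inv X *\<^sub>v u)) \<bullet> x" if x: "x \<in> carrier_vec n" for x
  proof -
    have y: "transpose_mat X *\<^sub>v x \<in> carrier_vec p"
      using XT x by simp
    have "err_proj x $ i = u \<bullet> (gram_inv X *\<^sub>v (transpose_mat X *\<^sub>v x))"
      using ux[OF err_proj_carrier[OF x]] by (simp add: err_proj_def)
    also have "\<dots> = (transpose_mat X *\<^sub>v x) \<bullet> (gram_inv X *\<^sub>v u)"
      by (rule symmetric_scalar_prod[OF Gi sym_Gi u y])
    also have "\<dots> = x \<bullet> (X *\<^sub>v (gram_inv X *\<^sub>v u))"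
      by (rule transpose_vec_mult_scalar[OF X Gu x])
    also have "\<dots> = (X *\<^sub>v (gram_inv X *\<^sub>v u)) \<bullet> x"
      using X Gu x by (intro comm_scalar_prod[of _ n]) auto
    finally show ?thesis .
  qed
  have "(X *\<^sub>v (gram_inv X *\<^sub>v u)) \<bullet> (X *\<^sub>v (gram_inv X *\<^sub>v u)) = u \<bullet> (gram_inv X *\<^sub>v u)"
    using q_eq_norm_sq[OF Gu] q_Gi[OF u] by simp
  also have "\<dots> = (gram_inv X *\<^sub>v u) $ i"
    using ux[OF Gu] .
  also have "\<dots> = gram_inv X $$ (i, i)"
    using Gi i by (simp add: u_def)
  finally show "(X *\<^sub>v (gram_inv X *\<^sub>v u)) \<bullet> (X *\<^sub>v (gram_inv X *\<^sub>v u)) = gram_inv X $$ (i, i)" .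
qed

end

section \<open>Chernoff bounds for the Gaussian errors\<close>

lemma (in prob_space) chernoff:
  assumes f [measurable]: "f \<in> borel_measurable M"
    and C: "(\<integral>\<^sup>+x. ennreal (exp (f x)) \<partial>M) \<le> ennreal C" "0 \<le> C"
  shows "prob {x \<in> space M. u \<le> f x} \<le> C * exp (- u)"
proof -
  have "emeasure M {x \<in> space M. u \<le> f x} = emeasure M {x \<in> space M. 1 \<le> ennreal (exp (- u)) * ennreal (exp (f x))}"
  proof (rule arg_cong[where f="emeasure M"], rule Collect_cong, rule conj_cong[OF refl])
    fix x
    have "1 \<le> ennreal (exp (- u)) * ennreal (exp (f x)) \<longleftrightarrow> 1 \<le> exp (f x - u)"
      by (simp flip: ennreal_mult exp_add)
    then show "u \<le> f x \<longleftrightarrow> 1 \<le> ennreal (exp (- u)) * ennreal (exp (f x))"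
      by simp
  qed
  also have "\<dots> \<le> ennreal (exp (- u)) * (\<integral>\<^sup>+x. ennreal (exp (f x)) * indicator (space M) x \<partial>M)"
    using nn_integral_Markov_inequality[of "\<lambda>x. ennreal (exp (f x))" "space M" M "ennreal (exp (- u))"] by simp
  also have "(\<integral>\<^sup>+x. ennreal (exp (f x)) * indicator (space M) x \<partial>M) = (\<integral>\<^sup>+x. ennreal (exp (f x)) \<partial>M)"
    by (intro nn_integral_cong) simp
  also have "ennreal (exp (- u)) * \<dots> \<le> ennreal (exp (- u)) * ennreal C"
    by (rule mult_left_mono[OF C(1)]) simp
  also have "\<dots> = ennreal (C * exp (- u))"
    using C(2) by (simp add: ennreal_mult mult.commute)
  finally show ?thesis
    using C(2) by (simp add: emeasure_eq_measure)
qed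

lemma sqrt_2_le_exp: "sqrt 2 \<le> exp (1 / 2)"
proof -
  have "sqrt 2 \<le> sqrt (exp 1)"
    using exp_ge_add_one_self[of 1] by simp
  also have "\<dots> = exp (1 / 2)"
    by (rule real_sqrt_unique) (auto simp: power2_eq_square simp flip: exp_add)
  finally show ?thesis .
qed

locale gaussian_errors = gaussian_linear_model + prob_space M for M :: "'w measure" +
  fixes e :: "'w \<Rightarrow> real Matrix.vec" and \<sigma> :: real
  assumes \<sigma>: "0 < \<sigma>"
    and errors: "distributed M (vec_lborel n) e (\<lambda>x. ennreal (mvn_density (0\<^sub>v n) (\<sigma>\<^sup>2 \<cdot>\<^sub>m 1\<^sub>m n) x))"
begin

lemma measurable_e [measurable]: "e \<in> measurable M (vec_lborel n)"
  using errors by (rule distributed_measurable)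

lemma e_carrier: "\<omega> \<in> space M \<Longrightarrow> e \<omega> \<in> carrier_vec n"
  using measurable_vec_lborelD[OF measurable_e] .

lemma error_density:
  assumes x: "x \<in> carrier_vec n"
  shows "mvn_density (0\<^sub>v n) (\<sigma>\<^sup>2 \<cdot>\<^sub>m 1\<^sub>m n) x = exp (- (1 / \<sigma>\<^sup>2 * (x \<bullet> x)) / 2) / gaussian_mass n (1 / \<sigma>\<^sup>2)"
proof -
  have "(\<sigma>\<^sup>2 \<cdot>\<^sub>m 1\<^sub>m n) * ((1 / \<sigma>\<^sup>2) \<cdot>\<^sub>m 1\<^sub>m n) = 1\<^sub>m n"
    using \<sigma> by (intro eq_matI) (auto simp: row_smult col_smult)
  then have "inv_mat (\<sigma>\<^sup>2 \<cdot>\<^sub>m 1\<^sub>m n) = (1 / \<sigma>\<^sup>2) \<cdot>\<^sub>m 1\<^sub>m n"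
    by (intro inv_mat_eq[of _ n]) auto
  moreover have "((1 / \<sigma>\<^sup>2) \<cdot>\<^sub>m 1\<^sub>m n) *\<^sub>v x = (1 / \<sigma>\<^sup>2) \<cdot>\<^sub>v x"
    using x by (intro eq_vecI) auto
  moreover have "sqrt ((2 * pi) ^ n * (\<sigma>\<^sup>2) ^ n) = gaussian_mass n (1 / \<sigma>\<^sup>2)"
    unfolding gaussian_mass_def power_mult_distrib[symmetric] real_sqrt_power by simp
  moreover have "x - 0\<^sub>v n = x"
    using x by (intro eq_vecI) auto
  ultimately show ?thesis
    using x by (simp add: mvn_density_def)
qed

text \<open>With the normalizing constant moved to the left, the right side is an unnormalized
  integral of the kind evaluated by the Laplace transforms.\<close>

lemma nn_integral_errors:
  assumes [measurable]: "f \<in> borel_measurable (vec_lborel n)"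
  shows "(\<integral>\<^sup>+\<omega>. ennreal (exp (f (e \<omega>))) \<partial>M) * ennreal (gaussian_mass n (1 / \<sigma>\<^sup>2)) =
    (\<integral>\<^sup>+x. ennreal (exp (- (1 / \<sigma>\<^sup>2 * (x \<bullet> x)) / 2 + f x)) \<partial>vec_lborel n)"
proof -
  have gm: "0 < gaussian_mass n (1 / \<sigma>\<^sup>2)"
    using \<sigma> by (simp add: gaussian_mass_def)
  have "(\<integral>\<^sup>+\<omega>. ennreal (exp (f (e \<omega>))) \<partial>M) =
      (\<integral>\<^sup>+x. ennreal (mvn_density (0\<^sub>v n) (\<sigma>\<^sup>2 \<cdot>\<^sub>m 1\<^sub>m n) x) * ennreal (exp (f x)) \<partial>vec_lborel n)"
    by (rule distributed_nn_integral[OF errors, symmetric]) measurable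
  also have "\<dots> = (\<integral>\<^sup>+x. ennreal (1 / gaussian_mass n (1 / \<sigma>\<^sup>2)) *
      ennreal (exp (- (1 / \<sigma>\<^sup>2 * (x \<bullet> x)) / 2 + f x)) \<partial>vec_lborel n)"
  proof (rule nn_integral_cong)
    fix x :: "real Matrix.vec" assume "x \<in> space (vec_lborel n)"
    then have "mvn_density (0\<^sub>v n) (\<sigma>\<^sup>2 \<cdot>\<^sub>m 1\<^sub>m n) x * exp (f x) =
        1 / gaussian_mass n (1 / \<sigma>\<^sup>2) * exp (- (1 / \<sigma>\<^sup>2 * (x \<bullet> x)) / 2 + f x)"
      unfolding exp_add by (simp add: error_density)
    moreover have "0 \<le> mvn_density (0\<^sub>v n) (\<sigma>\<^sup>2 \<cdot>\<^sub>m 1\<^sub>m n) x"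
      using error_density gm \<open>x \<in> space (vec_lborel n)\<close> by simp
    ultimately show "ennreal (mvn_density (0\<^sub>v n) (\<sigma>\<^sup>2 \<cdot>\<^sub>m 1\<^sub>m n) x) * ennreal (exp (f x)) =
        ennreal (1 / gaussian_mass n (1 / \<sigma>\<^sup>2)) * ennreal (exp (- (1 / \<sigma>\<^sup>2 * (x \<bullet> x)) / 2 + f x))"
      using gm by (subst (1 2) ennreal_mult[symmetric]) auto
  qed
  also have "\<dots> = ennreal (1 / gaussian_mass n (1 / \<sigma>\<^sup>2)) *
      (\<integral>\<^sup>+x. ennreal (exp (- (1 / \<sigma>\<^sup>2 * (x \<bullet> x)) / 2 + f x)) \<partial>vec_lborel n)"
    by (rule nn_integral_cmult) measurable
  finally have "(\<integral>\<^sup>+\<omega>. ennreal (exp (f (e \<omega>))) \<partial>M) * ennreal (gaussian_mass n (1 / \<sigma>\<^sup>2)) =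
      (ennreal (1 / gaussian_mass n (1 / \<sigma>\<^sup>2)) * ennreal (gaussian_mass n (1 / \<sigma>\<^sup>2))) *
      (\<integral>\<^sup>+x. ennreal (exp (- (1 / \<sigma>\<^sup>2 * (x \<bullet> x)) / 2 + f x)) \<partial>vec_lborel n)"
    by (simp only: mult_ac)
  also have "ennreal (1 / gaussian_mass n (1 / \<sigma>\<^sup>2)) * ennreal (gaussian_mass n (1 / \<sigma>\<^sup>2)) = 1"
    using gm by (simp flip: ennreal_mult)
  finally show ?thesis
    by simp
qed

lemma errors_mgfI:
  assumes "f \<in> borel_measurable (vec_lborel n)" and C: "0 \<le> C"
    and "(\<integral>\<^sup>+x. ennreal (exp (- (1 / \<sigma>\<^sup>2 * (x \<bullet> x)) / 2 + f x)) \<partial>vec_lborel n) = ennreal (C * gaussian_mass n (1 / \<sigma>\<^sup>2))"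
  shows "(\<integral>\<^sup>+\<omega>. ennreal (exp (f (e \<omega>))) \<partial>M) \<le> ennreal C"
proof -
  have gm: "0 < gaussian_mass n (1 / \<sigma>\<^sup>2)"
    using \<sigma> by (simp add: gaussian_mass_def)
  have "ennreal (gaussian_mass n (1 / \<sigma>\<^sup>2)) * (\<integral>\<^sup>+\<omega>. ennreal (exp (f (e \<omega>))) \<partial>M) =
      ennreal (gaussian_mass n (1 / \<sigma>\<^sup>2)) * ennreal C"
    using nn_integral_errors[OF assms(1)] assms(3) C gm by (simp add: ennreal_mult mult.commute)
  then show ?thesis
    using gm by (subst (asm) ennreal_mult_cancel_left) auto
qed

text \<open>Chernoff bound at half the critical exponent 1/(2 \<sigma>^2): the moment generating
  function is sqrt 2 to the power n, and sqrt 2 \<le> exp(1/2) leaves the rate 1/2.\<close>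

lemma prob_norm_sq_ge: "prob {\<omega> \<in> space M. 4 * \<sigma>\<^sup>2 * n \<le> e \<omega> \<bullet> e \<omega>} \<le> exp (- 1 / 2) ^ n"
proof -
  define f where "f x = (x \<bullet> x) / (4 * \<sigma>\<^sup>2)" for x :: "real Matrix.vec"
  have [measurable]: "f \<in> borel_measurable (vec_lborel n)"
    unfolding f_def[abs_def] by measurable
  have "(\<integral>\<^sup>+x. ennreal (exp (- (1 / \<sigma>\<^sup>2 * (x \<bullet> x)) / 2 + f x)) \<partial>vec_lborel n) =
      (\<integral>\<^sup>+x. ennreal (exp (- (1 / (2 * \<sigma>\<^sup>2) * (x \<bullet> x)) / 2)) \<partial>vec_lborel n)"
  proof -
    have "- (1 / \<sigma>\<^sup>2 * y) / 2 + y / (4 * \<sigma>\<^sup>2) = - (1 / (2 * \<sigma>\<^sup>2) * y) / 2" for y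
      using \<sigma> by (simp add: field_simps)
    then show ?thesis
      by (simp only: f_def)
  qed
  also have "\<dots> = ennreal (sqrt (2 * pi / (1 / (2 * \<sigma>\<^sup>2))) ^ n)"
    using \<sigma> by (intro nn_integral_gaussian_vec) simp
  also have "sqrt (2 * pi / (1 / (2 * \<sigma>\<^sup>2))) ^ n = sqrt 2 ^ n * gaussian_mass n (1 / \<sigma>\<^sup>2)"
    unfolding gaussian_mass_def power_mult_distrib[symmetric] real_sqrt_mult[symmetric] by (simp add: mult_ac)
  finally have "(\<integral>\<^sup>+\<omega>. ennreal (exp (f (e \<omega>))) \<partial>M) \<le> ennreal (sqrt 2 ^ n)"
    by (intro errors_mgfI) auto
  then have "prob {\<omega> \<in> space M. real n \<le> f (e \<omega>)} \<le> sqrt 2 ^ n * exp (- real n)"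
    by (intro chernoff) auto
  also have "\<dots> = (sqrt 2 * exp (- 1)) ^ n"
    by (simp add: power_mult_distrib flip: exp_of_nat_mult)
  also have "\<dots> \<le> exp (- 1 / 2) ^ n"
  proof (rule power_mono)
    have "sqrt 2 * exp (- 1) \<le> exp (1 / 2) * exp (- 1)"
      by (intro mult_right_mono sqrt_2_le_exp) simp
    also have "\<dots> = exp (- 1 / 2)"
      by (simp flip: exp_add)
    finally show "sqrt 2 * exp (- 1) \<le> exp (- 1 / 2)" .
  qed auto
  finally show ?thesis
    using \<sigma> by (simp add: f_def field_simps)
qed

text \<open>The same exponent, now with \<tau> = 1/2 in \<open>projection_mgf\<close>: the moment
  generating function is sqrt 2 to the power p, so the bound is governed by p instead of n.\<close>

lemma prob_q_err_proj_ge: "prob {\<omega> \<in> space M. 4 * \<sigma>\<^sup>2 * u \<le> q (err_proj (e \<omega>))} \<le> exp (real p / 2 - u)"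
proof -
  define f where "f x = q (err_proj x) / (4 * \<sigma>\<^sup>2)" for x
  have [measurable]: "f \<in> borel_measurable (vec_lborel n)"
    unfolding f_def[abs_def] by measurable
  have "(\<integral>\<^sup>+x. ennreal (exp (- (1 / \<sigma>\<^sup>2 * (x \<bullet> x)) / 2 + f x)) \<partial>vec_lborel n) =
      (\<integral>\<^sup>+x. ennreal (exp (- (1 / \<sigma>\<^sup>2 * (x \<bullet> x)) / 2 + 1 / 2 * (1 / \<sigma>\<^sup>2) *
        ((transpose_mat X *\<^sub>v x) \<bullet> (gram_inv X *\<^sub>v (transpose_mat X *\<^sub>v x))) / 2)) \<partial>vec_lborel n)"
    using \<sigma> by (intro nn_integral_cong) (simp add: f_def q_err_proj)
  also have "\<dots> = ennreal ((1 / sqrt (1 - 1 / 2)) ^ p * gaussian_mass n (1 / \<sigma>\<^sup>2))"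
    using \<sigma> by (intro projection_mgf[OF X refl]) auto
  also have "1 / sqrt (1 - 1 / 2) = sqrt (2 :: real)"
    by (simp add: real_sqrt_divide)
  finally have "(\<integral>\<^sup>+\<omega>. ennreal (exp (f (e \<omega>))) \<partial>M) \<le> ennreal (sqrt 2 ^ p)"
    by (intro errors_mgfI) auto
  then have "prob {\<omega> \<in> space M. u \<le> f (e \<omega>)} \<le> sqrt 2 ^ p * exp (- u)"
    by (intro chernoff) auto
  also have "\<dots> \<le> exp (1 / 2) ^ p * exp (- u)"
  proof (intro mult_right_mono power_mono)
    show "sqrt 2 \<le> exp (1 / 2 :: real)"
      by (rule sqrt_2_le_exp)
  qed auto
  also have "\<dots> = exp (real p / 2 - u)"
    unfolding exp_of_nat_mult[symmetric] exp_add[symmetric] by simp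
  finally show ?thesis
    using \<sigma> by (simp add: f_def field_simps)
qed

text \<open>The negative exponent -t/(2 \<sigma>^2) raises the Gaussian precision to (1 +
  t)/\<sigma>^2 and leaves the projection form with \<tau> = t/(1 + t) < 1. The outcome is the
  Laplace transform of a chi-square variable with n - p degrees of freedom.\<close>

lemma prob_err_rss_le:
  assumes t: "0 < t"
  shows "prob {\<omega> \<in> space M. err_rss (e \<omega>) \<le> 2 * \<sigma>\<^sup>2 * u} \<le> (1 + t) powr (- (real n - real p) / 2) * exp (t * u)"
proof -
  define f where "f x = - (t * err_rss x / (2 * \<sigma>\<^sup>2))" for x
  have [measurable]: "f \<in> borel_measurable (vec_lborel n)"
    unfolding f_def[abs_def] by measurable
  have "(\<integral>\<^sup>+x. ennreal (exp (- (1 / \<sigma>\<^sup>2 * (x \<bullet> x)) / 2 + f x)) \<partial>vec_lborel n) =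
      (\<integral>\<^sup>+x. ennreal (exp (- ((1 + t) / \<sigma>\<^sup>2 * (x \<bullet> x)) / 2 + t / (1 + t) * ((1 + t) / \<sigma>\<^sup>2) *
        ((transpose_mat X *\<^sub>v x) \<bullet> (gram_inv X *\<^sub>v (transpose_mat X *\<^sub>v x))) / 2)) \<partial>vec_lborel n)"
  proof (intro nn_integral_cong arg_cong[where f="\<lambda>y. ennreal (exp y)"])
    fix x :: "real Matrix.vec" assume "x \<in> space (vec_lborel n)"
    then have h: "(transpose_mat X *\<^sub>v x) \<bullet> (gram_inv X *\<^sub>v (transpose_mat X *\<^sub>v x)) = q (err_proj x)"
      by (simp add: q_err_proj)
    have t': "t / (1 + t) * ((1 + t) / \<sigma>\<^sup>2) = t / \<sigma>\<^sup>2"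
      using t by simp
    show "- (1 / \<sigma>\<^sup>2 * (x \<bullet> x)) / 2 + f x = - ((1 + t) / \<sigma>\<^sup>2 * (x \<bullet> x)) / 2 + t / (1 + t) * ((1 + t) / \<sigma>\<^sup>2) *
        ((transpose_mat X *\<^sub>v x) \<bullet> (gram_inv X *\<^sub>v (transpose_mat X *\<^sub>v x))) / 2"
      unfolding h t' f_def err_rss_def using \<sigma> by (simp add: field_simps)
  qed
  also have "\<dots> = ennreal ((1 / sqrt (1 - t / (1 + t))) ^ p * gaussian_mass n ((1 + t) / \<sigma>\<^sup>2))"
    using \<sigma> t by (intro projection_mgf[OF X refl]) auto
  also have "1 / sqrt (1 - t / (1 + t)) = sqrt (1 + t)"
  proof -
    have "1 - t / (1 + t) = 1 / (1 + t)"
      using t by (simp add: field_simps)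
    then show ?thesis
      by (simp add: real_sqrt_divide)
  qed
  also have "gaussian_mass n ((1 + t) / \<sigma>\<^sup>2) = (1 / sqrt (1 + t)) ^ n * gaussian_mass n (1 / \<sigma>\<^sup>2)"
    using t by (simp add: gaussian_mass_def real_sqrt_mult real_sqrt_divide power_divide power_mult_distrib)
  finally have "(\<integral>\<^sup>+\<omega>. ennreal (exp (f (e \<omega>))) \<partial>M) \<le> ennreal (sqrt (1 + t) ^ p * (1 / sqrt (1 + t)) ^ n)"
    using t by (intro errors_mgfI) (auto simp: mult.assoc)
  then have "prob {\<omega> \<in> space M. - (t * u) \<le> f (e \<omega>)} \<le> sqrt (1 + t) ^ p * (1 / sqrt (1 + t)) ^ n * exp (- (- (t * u)))"
    using t by (intro chernoff) auto
  also have "sqrt (1 + t) ^ p * (1 / sqrt (1 + t)) ^ n = (1 + t) powr (- (real n - real p) / 2)"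
  proof -
    have "sqrt (1 + t) ^ m = (1 + t) powr (real m / 2)" for m
      using t by (simp add: powr_half_sqrt[symmetric] powr_power)
    then show ?thesis
      by (simp add: power_divide powr_divide powr_diff powr_minus_divide diff_divide_distrib)
  qed
  finally show ?thesis
    using \<sigma> t by (simp add: f_def field_simps)
qed

text \<open>The lower tail bound at level u = 0, with t tending to infinity; p < n makes the
  exponent at most -1/2.\<close>

lemma AE_err_rss_pos: "AE \<omega> in M. 0 < err_rss (e \<omega>)"
proof -
  let ?P = "prob {\<omega> \<in> space M. err_rss (e \<omega>) \<le> 0}"
  have le: "?P \<le> (1 + t) powr (- 1 / 2)" if t: "0 < t" for t
  proof -
    have "?P \<le> (1 + t) powr (- (real n - real p) / 2)"
      using prob_err_rss_le[OF t, of 0] by simp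
    also have "\<dots> \<le> (1 + t) powr (- 1 / 2)"
      using p_less_n t by (intro powr_mono) auto
    finally show ?thesis .
  qed
  have "((\<lambda>t::real. (1 + t) powr (- 1 / 2)) \<longlongrightarrow> 0) at_top"
    by real_asymp
  then have "?P \<le> 0"
    by (rule tendsto_lowerbound[OF _ eventually_mono[OF eventually_gt_at_top[of 0] le]])
      (auto intro: trivial_limit_at_top_linorder)
  then have "?P = 0"
    by (simp add: measure_le_0_iff)
  then have "AE \<omega> in M. \<not> err_rss (e \<omega>) \<le> 0"
    by (subst AE_iff_measurable[OF _ refl]) (auto simp: emeasure_eq_measure)
  then show ?thesis
    by (simp add: not_le)
qed

lemma prob_linf_err_proj_ge:
  assumes K: "\<And>i. i < p \<Longrightarrow> gram_inv X $$ (i, i) \<le> K" "0 < K" and \<eta>: "0 < \<eta>"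
  shows "prob {\<omega> \<in> space M. \<eta> < linf_norm (err_proj (e \<omega>))} \<le> 2 * real p * exp (- (\<eta>\<^sup>2 / (2 * \<sigma>\<^sup>2 * K)))"
proof -
  have one: "prob {\<omega> \<in> space M. \<eta> \<le> s * err_proj (e \<omega>) $ i} \<le> exp (- (\<eta>\<^sup>2 / (2 * \<sigma>\<^sup>2 * K)))"
    if i: "i < p" and s: "s = 1 \<or> s = - 1" for i s
  proof -
    obtain l where l: "l \<in> carrier_vec n" "\<And>x. x \<in> carrier_vec n \<Longrightarrow> err_proj x $ i = l \<bullet> x"
      "l \<bullet> l = gram_inv X $$ (i, i)"
      using err_proj_index[OF i] by blast
    \<comment> \<open>Up to the sign s, the minimizer of the Chernoff exponent r^2 \<sigma>^2 K/2 -
      r \<eta>.\<close>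
    define r where "r = s * (\<eta> / (\<sigma>\<^sup>2 * K))"
    define f where "f x = (r \<cdot>\<^sub>v l) \<bullet> x" for x
    have rl: "r \<cdot>\<^sub>v l \<in> carrier_vec n"
      using l(1) by simp
    have [measurable]: "f \<in> borel_measurable (vec_lborel n)"
      unfolding f_def[abs_def] by (rule measurable_scalar_prod[OF measurable_vec_const[OF rl] measurable_vec_ident])
    have "s * s = 1"
      using s by auto
    then have r2: "r * r = (\<eta> / (\<sigma>\<^sup>2 * K))\<^sup>2"
      by (simp add: r_def power2_eq_square mult_ac)
    have "(r \<cdot>\<^sub>v l) \<bullet> (r \<cdot>\<^sub>v l) / (2 * (1 / \<sigma>\<^sup>2)) = (\<eta> / (\<sigma>\<^sup>2 * K))\<^sup>2 * \<sigma>\<^sup>2 / 2 * gram_inv X $$ (i, i)"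
      using l r2 by simp
    also have "\<dots> \<le> (\<eta> / (\<sigma>\<^sup>2 * K))\<^sup>2 * \<sigma>\<^sup>2 / 2 * K"
      by (rule mult_left_mono[OF K(1)[OF i]]) simp
    also have "\<dots> = \<eta>\<^sup>2 / (2 * \<sigma>\<^sup>2 * K)"
      using \<sigma> K(2) by (simp add: power2_eq_square)
    finally have le: "(r \<cdot>\<^sub>v l) \<bullet> (r \<cdot>\<^sub>v l) / (2 * (1 / \<sigma>\<^sup>2)) \<le> \<eta>\<^sup>2 / (2 * \<sigma>\<^sup>2 * K)" .
    have "(\<integral>\<^sup>+\<omega>. ennreal (exp (f (e \<omega>))) \<partial>M) \<le> ennreal (exp ((r \<cdot>\<^sub>v l) \<bullet> (r \<cdot>\<^sub>v l) / (2 * (1 / \<sigma>\<^sup>2))))"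
    proof (rule errors_mgfI)
      show "(\<integral>\<^sup>+x. ennreal (exp (- (1 / \<sigma>\<^sup>2 * (x \<bullet> x)) / 2 + f x)) \<partial>vec_lborel n) =
          ennreal (exp ((r \<cdot>\<^sub>v l) \<bullet> (r \<cdot>\<^sub>v l) / (2 * (1 / \<sigma>\<^sup>2))) * gaussian_mass n (1 / \<sigma>\<^sup>2))"
        using gaussian_laplace_transform[OF _ rl, of "1 / \<sigma>\<^sup>2"] \<sigma>
        by (simp add: f_def ennreal_mult gaussian_mass_def)
    qed auto
    also have "\<dots> \<le> ennreal (exp (\<eta>\<^sup>2 / (2 * \<sigma>\<^sup>2 * K)))"
      using le by (intro ennreal_leI) simp
    finally have "prob {\<omega> \<in> space M. \<eta>\<^sup>2 / (\<sigma>\<^sup>2 * K) \<le> f (e \<omega>)} \<le>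
        exp (\<eta>\<^sup>2 / (2 * \<sigma>\<^sup>2 * K)) * exp (- (\<eta>\<^sup>2 / (\<sigma>\<^sup>2 * K)))"
      by (intro chernoff) auto
    also have "\<dots> = exp (- (\<eta>\<^sup>2 / (2 * \<sigma>\<^sup>2 * K)))"
      by (simp flip: exp_add)
    also have "{\<omega> \<in> space M. \<eta>\<^sup>2 / (\<sigma>\<^sup>2 * K) \<le> f (e \<omega>)} = {\<omega> \<in> space M. \<eta> \<le> s * err_proj (e \<omega>) $ i}"
    proof (rule Collect_cong, rule conj_cong[OF refl])
      fix \<omega> assume "\<omega> \<in> space M"
      then have "f (e \<omega>) = \<eta> / (\<sigma>\<^sup>2 * K) * (s * err_proj (e \<omega>) $ i)"
        using l e_carrier by (simp add: f_def r_def)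
      moreover have "\<eta>\<^sup>2 / (\<sigma>\<^sup>2 * K) = \<eta> / (\<sigma>\<^sup>2 * K) * \<eta>"
        by (simp add: power2_eq_square)
      moreover have "0 < \<eta> / (\<sigma>\<^sup>2 * K)"
        using \<eta> \<sigma> K(2) by simp
      ultimately show "\<eta>\<^sup>2 / (\<sigma>\<^sup>2 * K) \<le> f (e \<omega>) \<longleftrightarrow> \<eta> \<le> s * err_proj (e \<omega>) $ i"
        by (simp only: mult_le_cancel_left_pos)
    qed
    finally show ?thesis .
  qed
  have meas: "{\<omega> \<in> space M. \<eta> \<le> s * err_proj (e \<omega>) $ i} \<in> events" if "i < p" for i s
  proof -
    have [measurable]: "(\<lambda>\<omega>. err_proj (e \<omega>) $ i) \<in> borel_measurable M"
      by (rule measurable_compose[OF measurable_compose[OF measurable_e measurable_err_proj] measurable_vec_index[OF that]])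
    show ?thesis
      by measurable
  qed
  have "{\<omega> \<in> space M. \<eta> < linf_norm (err_proj (e \<omega>))} \<subseteq>
      (\<Union>i<p. {\<omega> \<in> space M. \<eta> \<le> 1 * err_proj (e \<omega>) $ i} \<union> {\<omega> \<in> space M. \<eta> \<le> (- 1) * err_proj (e \<omega>) $ i})"
  proof
    fix \<omega> assume "\<omega> \<in> {\<omega> \<in> space M. \<eta> < linf_norm (err_proj (e \<omega>))}"
    then have \<omega>: "\<omega> \<in> space M" "\<not> linf_norm (err_proj (e \<omega>)) \<le> \<eta>"
      by auto
    then obtain i where "i < p" "\<eta> < \<bar>err_proj (e \<omega>) $ i\<bar>"
      using linf_norm_le_iff[of \<eta> "err_proj (e \<omega>)"] \<eta> err_proj_carrier[OF e_carrier[OF \<omega>(1)]] by (auto simp: not_le)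
    then show "\<omega> \<in> (\<Union>i<p. {\<omega> \<in> space M. \<eta> \<le> 1 * err_proj (e \<omega>) $ i} \<union> {\<omega> \<in> space M. \<eta> \<le> (- 1) * err_proj (e \<omega>) $ i})"
      using \<omega>(1) by (auto simp: abs_if split: if_splits intro!: bexI[of _ i])
  qed
  then have "prob {\<omega> \<in> space M. \<eta> < linf_norm (err_proj (e \<omega>))} \<le>
      prob (\<Union>i<p. {\<omega> \<in> space M. \<eta> \<le> 1 * err_proj (e \<omega>) $ i} \<union> {\<omega> \<in> space M. \<eta> \<le> (- 1) * err_proj (e \<omega>) $ i})"
    by (intro finite_measure_mono sets.finite_UN sets.Un meas) auto
  also have "\<dots> \<le> (\<Sum>i<p. prob ({\<omega> \<in> space M. \<eta> \<le> 1 * err_proj (e \<omega>) $ i} \<union> {\<omega> \<in> space M. \<eta> \<le> (- 1) * err_proj (e \<omega>) $ i}))"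
    using meas[of _ 1] meas[of _ "- 1"] by (intro finite_measure_subadditive_finite) (auto intro!: sets.Un)
  also have "\<dots> \<le> (\<Sum>i<p. exp (- (\<eta>\<^sup>2 / (2 * \<sigma>\<^sup>2 * K))) + exp (- (\<eta>\<^sup>2 / (2 * \<sigma>\<^sup>2 * K))))"
  proof (rule sum_mono)
    fix i assume "i \<in> {..<p}"
    then have i: "i < p"
      by simp
    have "prob ({\<omega> \<in> space M. \<eta> \<le> 1 * err_proj (e \<omega>) $ i} \<union> {\<omega> \<in> space M. \<eta> \<le> (- 1) * err_proj (e \<omega>) $ i}) \<le>
        prob {\<omega> \<in> space M. \<eta> \<le> 1 * err_proj (e \<omega>) $ i} + prob {\<omega> \<in> space M. \<eta> \<le> (- 1) * err_proj (e \<omega>) $ i}"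
      by (rule measure_Un_le) (rule meas[OF i])+
    also have "\<dots> \<le> exp (- (\<eta>\<^sup>2 / (2 * \<sigma>\<^sup>2 * K))) + exp (- (\<eta>\<^sup>2 / (2 * \<sigma>\<^sup>2 * K)))"
      by (intro add_mono one i) auto
    finally show "prob ({\<omega> \<in> space M. \<eta> \<le> 1 * err_proj (e \<omega>) $ i} \<union> {\<omega> \<in> space M. \<eta> \<le> (- 1) * err_proj (e \<omega>) $ i}) \<le>
        exp (- (\<eta>\<^sup>2 / (2 * \<sigma>\<^sup>2 * K))) + exp (- (\<eta>\<^sup>2 / (2 * \<sigma>\<^sup>2 * K)))" .
  qed
  finally show ?thesis
    by simp
qed

end

text \<open>First Borel-Cantelli lemma. The models start at n = 1, so the event of index 0, about
  which nothing is known, is replaced by the empty set.\<close>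

lemma (in prob_space) AE_eventually_of_summable:
  assumes A: "\<And>n. 1 \<le> n \<Longrightarrow> {x \<in> space M. P n x} \<in> events"
    and le: "eventually (\<lambda>n. prob {x \<in> space M. P n x} \<le> b n) sequentially" and sum: "summable b"
  shows "AE x in M. eventually (\<lambda>n. \<not> P n x) sequentially"
proof -
  define B where "B n = (if 1 \<le> n then {x \<in> space M. P n x} else {})" for n
  have "AE x in M. eventually (\<lambda>n. x \<in> space M - B n) sequentially"
  proof (rule borel_cantelli_AE1)
    show "B n \<in> events" "emeasure M (B n) < \<infinity>" for n
      using A by (auto simp: B_def less_top[symmetric])
    have "eventually (\<lambda>n. norm (prob (B n)) \<le> b n) sequentially"
      using le eventually_ge_at_top[of 1] by eventually_elim (simp add: B_def)
    then show "summable (\<lambda>n. prob (B n))"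
      using sum by (rule summable_comparison_test_ev)
  qed
  then show ?thesis
  proof eventually_elim
    case (elim x)
    then show ?case
      using eventually_ge_at_top[of 1] by eventually_elim (auto simp: B_def)
  qed
qed

section \<open>Shrinkage of the posterior mean\<close>

lemma mult_mat_zero_vec: "(A :: real mat) \<in> carrier_mat n m \<Longrightarrow> A *\<^sub>v 0\<^sub>v m = 0\<^sub>v n"
  by (intro eq_vecI) auto

text \<open>Since x . G x = |X x|^2 for the Gram matrix G, full column rank makes G nonsingular. Its
  inverse is symmetric because its transpose is a left inverse too, and positive definite because
  its form at x is \<open>q\<close> at the image of x.\<close>

lemma gaussian_linear_model_full_rank:
  assumes X: "X \<in> carrier_mat n p" and rank: "vec_space.rank n X = p" and pn: "p < n"
  shows "gaussian_linear_model p X n"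
proof -
  let ?G = "transpose_mat X * X"
  have G: "?G \<in> carrier_mat p p"
    using X by simp
  have sym: "transpose_mat ?G = ?G"
    using X transpose_mult[of "transpose_mat X" p n X p] by simp
  have form: "x \<bullet> (?G *\<^sub>v x) = (X *\<^sub>v x) \<bullet> (X *\<^sub>v x)" if "x \<in> carrier_vec p" for x
    by (rule transpose_mult_self_form[OF X that])
  have kernel: "x = 0\<^sub>v p" if x: "x \<in> carrier_vec p" and "x \<bullet> (?G *\<^sub>v x) = 0" for x
  proof -
    have "X *\<^sub>v x \<in> carrier_vec n"
      using X x by simp
    then have "X *\<^sub>v x = 0\<^sub>v n"
      using scalar_prod_self_eq_0_iff[of "X *\<^sub>v x" n] form[OF x] that(2) by simp
    then show ?thesis
      by (rule full_column_rank_imp_injective[OF X rank x])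
  qed
  have "Determinant.det ?G \<noteq> 0"
  proof
    assume "Determinant.det ?G = 0"
    then obtain v where "v \<in> carrier_vec p" "v \<noteq> 0\<^sub>v p" "?G *\<^sub>v v = 0\<^sub>v p"
      using det_0_iff_vec_prod_zero_field[OF G] by blast
    then show False
      using kernel[of v] by simp
  qed
  then obtain B where B: "B \<in> carrier_mat p p" "?G * B = 1\<^sub>m p" "B * ?G = 1\<^sub>m p" "mat_inverse ?G = Some B"
    using nonsingular_imp_inverse[OF G] by metis
  have inv: "gram_inv X = B"
    using B(4) by (simp add: gram_inv_def inv_mat_def)
  have "transpose_mat B * ?G = 1\<^sub>m p"
    using transpose_mult[OF G B(1)] B(2) sym by simp
  then have "transpose_mat B = transpose_mat B * (?G * B)"
    using B by simp
  also have "\<dots> = (transpose_mat B * ?G) * B"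
    using B(1) G by (intro assoc_mult_mat[symmetric, of _ p p _ p _ p]) auto
  also have "\<dots> = B"
    using B(1) \<open>transpose_mat B * ?G = 1\<^sub>m p\<close> by simp
  finally have symB: "transpose_mat B = B" .
  interpret pos_def_pair p ?G "gram_inv X"
    using G B sym symB form by unfold_locales (auto simp: inv scalar_prod_self_ge_0)
  have "0 < Determinant.det (gram_inv X)"
  proof (rule det_pos_of_pos_def[OF Gi])
    fix x :: "real Matrix.vec" assume x: "x \<in> carrier_vec p" "x \<noteq> 0\<^sub>v p"
    have Gx: "gram_inv X *\<^sub>v x \<in> carrier_vec p"
      using Gi x by simp
    have "q (gram_inv X *\<^sub>v x) \<noteq> 0"
    proof
      assume "q (gram_inv X *\<^sub>v x) = 0"
      then have "gram_inv X *\<^sub>v x = 0\<^sub>v p"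
        using kernel[OF Gx] by (simp add: q_def)
      then show False
        using G_Gi_vec[OF x(1)] mult_mat_zero_vec[OF G] x(2) by metis
    qed
    then show "0 < x \<bullet> (gram_inv X *\<^sub>v x)"
      using q_nonneg[OF Gx] q_Gi[OF x(1)] by simp
  qed
  then show ?thesis
    using X pn by unfold_locales auto
qed

context gaussian_linear_model
begin

lemma gram_inv_form_bounds:
  assumes ev: "\<And>l. eigenvalue (real n \<cdot>\<^sub>m gram_inv X) l \<Longrightarrow> lmin \<le> l \<and> l \<le> L" and x: "x \<in> carrier_vec p"
  shows "lmin / n * (x \<bullet> x) \<le> x \<bullet> (gram_inv X *\<^sub>v x)" "x \<bullet> (gram_inv X *\<^sub>v x) \<le> L / n * (x \<bullet> x)"
proof -
  let ?A = "real n \<cdot>\<^sub>m gram_inv X"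
  have n: "0 < real n"
    using p_less_n by simp
  have A: "?A \<in> carrier_mat p p" "transpose_mat ?A = ?A"
    using Gi symmetric_index[OF Gi sym_Gi] by (auto intro!: eq_matI)
  have "?A *\<^sub>v x = real n \<cdot>\<^sub>v (gram_inv X *\<^sub>v x)"
    using Gi x by (intro eq_vecI) auto
  then have form: "x \<bullet> (?A *\<^sub>v x) = real n * (x \<bullet> (gram_inv X *\<^sub>v x))"
    using Gi x by simp
  show "lmin / n * (x \<bullet> x) \<le> x \<bullet> (gram_inv X *\<^sub>v x)"
    using eigenvalue_lower_bound_imp_form_ge[OF A, of lmin x] ev x n form by (simp add: field_simps)
  show "x \<bullet> (gram_inv X *\<^sub>v x) \<le> L / n * (x \<bullet> x)"
    using eigenvalue_upper_bound_imp_form_le[OF A, of L x] ev x n form by (simp add: field_simps)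
qed

lemma gram_inv_diag_le:
  assumes ev: "\<And>l. eigenvalue (real n \<cdot>\<^sub>m gram_inv X) l \<Longrightarrow> lmin \<le> l \<and> l \<le> L" and i: "i < p"
  shows "gram_inv X $$ (i, i) \<le> L / n"
proof -
  have "unit_vec p i \<bullet> (gram_inv X *\<^sub>v unit_vec p i) = gram_inv X $$ (i, i)"
    using Gi i by simp
  moreover have "unit_vec p i \<bullet> (unit_vec p i :: real Matrix.vec) = 1"
    using i by simp
  ultimately show ?thesis
    using gram_inv_form_bounds(2)[OF ev, of "unit_vec p i"] by simp
qed

text \<open>Bounds on the form of the inverse are transferred through y = G x: the lower bound is
  \<open>psd_norm_image_le\<close> for the inverse, the upper one is Cauchy-Schwarz for x . y
  together with |y|^2 \<le> (n/lmin) q x.\<close>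

lemma q_bounds:
  assumes ev: "\<And>l. eigenvalue (real n \<cdot>\<^sub>m gram_inv X) l \<Longrightarrow> lmin \<le> l \<and> l \<le> L" and lmin: "0 < lmin" and L: "0 < L"
    and x: "x \<in> carrier_vec p"
  shows "n / L * (x \<bullet> x) \<le> q x" "q x \<le> n / lmin * (x \<bullet> x)"
proof -
  have n: "0 < real n"
    using p_less_n by simp
  define y where "y = (transpose_mat X * X) *\<^sub>v x"
  have y: "y \<in> carrier_vec p"
    using G x by (simp add: y_def)
  have Giy: "gram_inv X *\<^sub>v y = x"
    by (simp only: y_def Gi_G_vec[OF x])
  have yGiy: "y \<bullet> (gram_inv X *\<^sub>v y) = q x"
    using q_Gi[OF y] Giy by simp
  have psd: "0 \<le> w \<bullet> (gram_inv X *\<^sub>v w)" if "w \<in> carrier_vec p" for w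
    using q_Gi[OF that] q_nonneg[of "gram_inv X *\<^sub>v w"] Gi that by simp
  have "(gram_inv X *\<^sub>v y) \<bullet> (gram_inv X *\<^sub>v y) \<le> L / n * (y \<bullet> (gram_inv X *\<^sub>v y))"
    by (rule psd_norm_image_le[OF Gi sym_Gi psd gram_inv_form_bounds(2)[OF ev] y])
  then show "n / L * (x \<bullet> x) \<le> q x"
    using L n yGiy unfolding Giy by (simp add: field_simps)
  have "(q x)\<^sup>2 = (x \<bullet> (1\<^sub>m p *\<^sub>v y))\<^sup>2"
    using y by (simp add: q_def y_def)
  also have "\<dots> \<le> (x \<bullet> (1\<^sub>m p *\<^sub>v x)) * (y \<bullet> (1\<^sub>m p *\<^sub>v y))"
    using x y by (intro psd_cauchy_schwarz[of _ p]) (auto simp: scalar_prod_self_ge_0)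
  also have "\<dots> = (x \<bullet> x) * (y \<bullet> y)"
    using x y by simp
  also have "\<dots> \<le> (x \<bullet> x) * (n / lmin * q x)"
  proof (rule mult_left_mono)
    show "y \<bullet> y \<le> n / lmin * q x"
      using gram_inv_form_bounds(1)[OF ev y] yGiy n lmin by (simp add: field_simps)
  qed (rule scalar_prod_self_ge_0)
  finally have *: "q x * q x \<le> q x * (n / lmin * (x \<bullet> x))"
    by (simp add: power2_eq_square mult_ac)
  show "q x \<le> n / lmin * (x \<bullet> x)"
  proof (cases "q x = 0")
    case True
    then show ?thesis
      using n lmin scalar_prod_self_ge_0[of x] by simp
  next
    case False
    then have "0 < q x"
      using q_nonneg[OF x] by simp
    then show ?thesis
      using * by (simp only: mult_le_cancel_left_pos)
  qed
qed

text \<open>Both are the parallelogram law with one nonnegative term dropped, for the pair z, d and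
  for the pair z - d, z.\<close>

lemma q_diff_bounds:
  assumes z: "z \<in> carrier_vec p" and d: "d \<in> carrier_vec p"
  shows "q d / 2 - q z \<le> q (z - d)" "q (z - d) \<le> 2 * q z + 2 * q d"
proof -
  have half: "q (v + (-1) \<cdot>\<^sub>v w) + q (v + 1 \<cdot>\<^sub>v w) = 2 * q v + 2 * q w"
    if v: "v \<in> carrier_vec p" and w: "w \<in> carrier_vec p" for v w
    by (simp only: q_add[OF v w]) simp
  have minus: "v + (-1) \<cdot>\<^sub>v w = v - w" if "v \<in> carrier_vec p" "w \<in> carrier_vec p" for v w :: "real Matrix.vec"
    using that by (intro eq_vecI) auto
  have 1: "q (z - d) + q (z + d) = 2 * q z + 2 * q d"
    using half[OF z d] minus[OF z d] by simp
  then show "q (z - d) \<le> 2 * q z + 2 * q d"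
    using q_nonneg[of "z + d"] z d by simp
  have zd: "z - d \<in> carrier_vec p"
    using z d by simp
  have "(z - d) - z = (-1) \<cdot>\<^sub>v d"
    using z d by (intro eq_vecI) auto
  then have "q ((z - d) - z) = q d"
    using q_smult[OF d, of "-1"] by simp
  then have "q d + q ((z - d) + z) = 2 * q (z - d) + 2 * q z"
    using half[OF zd z] minus[OF zd z] by simp
  then show "q d / 2 - q z \<le> q (z - d)"
    using q_nonneg[of "(z - d) + z"] z d by simp
qed

lemma g_EB_eq:
  "g_EB X \<gamma> a b bhat s =
    max 0 ((real n - real p + a - 2) / (s + b) * (q (bhat - \<gamma>) / real p) - 1)"
  using X by (simp add: g_EB_def Let_def q_def)

lemma g_EB_nonneg: "0 \<le> g_EB X \<gamma> a b bhat s"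
  by (simp add: g_EB_eq)

text \<open>By its definition the estimate plus 1 dominates a multiple of the same quadratic form,
  which therefore cancels. This keeps \<open>post_scale\<close> of order n even when \<gamma> is
  arbitrarily far from \<open>\<beta>\<^sub>0\<close>.\<close>

lemma q_div_g_EB_le:
  assumes N: "0 < real n - real p + a - 2" and sb: "0 < s + b"
    and bhat: "bhat \<in> carrier_vec p" and \<gamma>: "\<gamma> \<in> carrier_vec p"
  shows "q (bhat - \<gamma>) / (g_EB X \<gamma> a b bhat s + 1) \<le> real p * (s + b) / (real n - real p + a - 2)"
proof (cases "p = 0")
  case True
  then show ?thesis
    using bhat \<gamma> by (simp add: q_def scalar_prod_def)
next
  case False
  define T where "T = q (bhat - \<gamma>)"
  define N where "N = real n - real p + a - 2"
  define g where "g = g_EB X \<gamma> a b bhat s"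
  have g0: "0 \<le> g"
    by (simp add: g_def g_EB_nonneg)
  have "N / (s + b) * (T / real p) \<le> g + 1"
    unfolding g_def g_EB_eq N_def T_def by simp
  then have "real p * (s + b) / N * (N / (s + b) * (T / real p)) \<le> real p * (s + b) / N * (g + 1)"
    using N sb False unfolding N_def[symmetric] by (intro mult_left_mono) auto
  moreover have "real p * (s + b) / N * (N / (s + b) * (T / real p)) = T"
    using N sb False unfolding N_def[symmetric] by simp
  ultimately have "T \<le> real p * (s + b) / N * (g + 1)"
    by simp
  then show ?thesis
    using g0 unfolding T_def[symmetric] N_def[symmetric] g_def[symmetric] by (simp add: divide_le_eq)
qed

end

context g_posterior
begin

lemma post_mean_deviation:
  assumes \<beta>: "\<beta>\<^sub>0 \<in> carrier_vec p" and z: "z \<in> carrier_vec p" and bhat_eq: "bhat = \<beta>\<^sub>0 + z"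
  shows "linf_norm (post_mean - \<beta>\<^sub>0) \<le> linf_norm z + linf_norm (\<gamma> - \<beta>\<^sub>0) / (g + 1)"
    and "linf_norm (\<gamma> - \<beta>\<^sub>0) / (g + 1) - linf_norm z \<le> linf_norm (post_mean - \<beta>\<^sub>0)"
proof -
  have coeff: "g / (g + 1) = 1 - 1 / (g + 1)"
    using g by (simp add: field_simps)
  have eq: "g / (g + 1) * (u + w) + 1 / (g + 1) * c - u = g / (g + 1) * w + 1 / (g + 1) * (c - u)" for u w c
    unfolding coeff by (simp add: algebra_simps add_divide_distrib diff_divide_distrib)
  have pm: "post_mean = (g / (g + 1)) \<cdot>\<^sub>v (\<beta>\<^sub>0 + z) + (1 / (g + 1)) \<cdot>\<^sub>v \<gamma>"
    unfolding post_mean_def by (simp only: bhat_eq)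
  have mean: "post_mean - \<beta>\<^sub>0 = (g / (g + 1)) \<cdot>\<^sub>v z + (1 / (g + 1)) \<cdot>\<^sub>v (\<gamma> - \<beta>\<^sub>0)"
  proof (rule eq_vecI)
    fix i assume "i < dim_vec ((g / (g + 1)) \<cdot>\<^sub>v z + (1 / (g + 1)) \<cdot>\<^sub>v (\<gamma> - \<beta>\<^sub>0))"
    then show "(post_mean - \<beta>\<^sub>0) $ i = ((g / (g + 1)) \<cdot>\<^sub>v z + (1 / (g + 1)) \<cdot>\<^sub>v (\<gamma> - \<beta>\<^sub>0)) $ i"
      using \<beta> z \<gamma> eq[of "\<beta>\<^sub>0 $ i" "z $ i" "\<gamma> $ i"] by (simp add: pm)
  qed (use \<beta> \<gamma> in \<open>simp add: post_mean_def\<close>)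
  have d: "\<gamma> - \<beta>\<^sub>0 \<in> carrier_vec p"
    using \<gamma> \<beta> by simp
  have gz: "g / (g + 1) * linf_norm z \<le> linf_norm z"
    using g linf_norm_nonneg[of z] by (intro mult_left_le_one_le) auto
  have abs: "\<bar>g / (g + 1)\<bar> = g / (g + 1)" "\<bar>1 / (g + 1)\<bar> = 1 / (g + 1)" "\<bar>- (g / (g + 1))\<bar> = g / (g + 1)"
    using g by auto
  have "linf_norm (post_mean - \<beta>\<^sub>0) \<le> g / (g + 1) * linf_norm z + 1 / (g + 1) * linf_norm (\<gamma> - \<beta>\<^sub>0)"
    unfolding mean using linf_norm_add[of "(g / (g + 1)) \<cdot>\<^sub>v z" p "(1 / (g + 1)) \<cdot>\<^sub>v (\<gamma> - \<beta>\<^sub>0)"] z d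
    by (simp only: linf_norm_smult abs smult_carrier_vec)
  then show "linf_norm (post_mean - \<beta>\<^sub>0) \<le> linf_norm z + linf_norm (\<gamma> - \<beta>\<^sub>0) / (g + 1)"
    using gz by simp
  have "(1 / (g + 1)) \<cdot>\<^sub>v (\<gamma> - \<beta>\<^sub>0) = (post_mean - \<beta>\<^sub>0) + (- (g / (g + 1))) \<cdot>\<^sub>v z"
    unfolding mean using z \<beta> \<gamma> by (intro eq_vecI) auto
  then have "1 / (g + 1) * linf_norm (\<gamma> - \<beta>\<^sub>0) \<le> linf_norm (post_mean - \<beta>\<^sub>0) + g / (g + 1) * linf_norm z"
    using linf_norm_add[of "post_mean - \<beta>\<^sub>0" p "(- (g / (g + 1))) \<cdot>\<^sub>v z"] z \<beta> post_mean_carrier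
      linf_norm_smult[of "1 / (g + 1)" "\<gamma> - \<beta>\<^sub>0"] linf_norm_smult[of "- (g / (g + 1))" z]
    by (simp only: abs smult_carrier_vec minus_carrier_vec)
  then show "linf_norm (\<gamma> - \<beta>\<^sub>0) / (g + 1) - linf_norm z \<le> linf_norm (post_mean - \<beta>\<^sub>0)"
    using gz by simp
qed

end

context gaussian_linear_model
begin

text \<open>A prior centre \<open>\<gamma>\<close> far from \<open>\<beta>\<^sub>0\<close> makes the estimate of \<open>g\<close> of order \<open>\<parallel>\<gamma> - \<beta>\<^sub>0\<parallel>\<^sup>2\<close>, which
  outweighs the prior bias \<open>\<parallel>\<gamma> - \<beta>\<^sub>0\<parallel> / (g + 1)\<close>.\<close>

lemma shrinkage_bias_le:
  assumes ev: "\<And>l. eigenvalue (real n \<cdot>\<^sub>m gram_inv X) l \<Longrightarrow> lmin \<le> l \<and> l \<le> L" and lmin: "0 < lmin" and L: "0 < L"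
    and z: "z \<in> carrier_vec p" and \<beta>: "\<beta>\<^sub>0 \<in> carrier_vec p" and \<gamma>: "\<gamma> \<in> carrier_vec p"
    and \<rho>: "0 < \<rho>" "\<rho>\<^sup>2 \<le> (\<gamma> - \<beta>\<^sub>0) \<bullet> (\<gamma> - \<beta>\<^sub>0)" and qz: "q z \<le> real n * \<rho>\<^sup>2 / (4 * L)"
    and N: "\<delta> * real n \<le> real n - real p + a - 2" "0 < \<delta>" and sb: "0 < s + b" "s + b \<le> C * real n"
  shows "linf_norm (\<gamma> - \<beta>\<^sub>0) / (g_EB X \<gamma> a b (\<beta>\<^sub>0 + z) s + 1) \<le> 4 * L * C * (real p / real n) / (\<delta> * \<rho>)"
proof -
  define d where "d = \<gamma> - \<beta>\<^sub>0"
  define D where "D = sqrt (d \<bullet> d)"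
  define g where "g = g_EB X \<gamma> a b (\<beta>\<^sub>0 + z) s"
  have d: "d \<in> carrier_vec p"
    using \<gamma> \<beta> by (simp add: d_def)
  have n: "0 < real n"
    using p_less_n by simp
  have D2: "D\<^sup>2 = d \<bullet> d"
    by (simp add: D_def scalar_prod_self_ge_0)
  have D: "\<rho> \<le> D"
    unfolding D_def using \<rho> by (intro real_le_rsqrt) (simp add: d_def)
  have D_pos: "0 < D"
    using D \<rho> by simp
  have p_pos: "0 < real p"
  proof (rule ccontr)
    assume "\<not> 0 < real p"
    then have "d \<bullet> d = 0"
      using d by (simp add: scalar_prod_def)
    then show False
      using D2 D_pos by simp
  qed
  have C: "0 < C"
    using sb n by (smt (verit) zero_less_mult_pos2)
  \<comment> \<open>The hypothesis on \<open>q z\<close> is calibrated by q d \<ge> n |d|^2/L: the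
    noise takes at most half of the term q d/2 in \<open>q_diff_bounds\<close>.\<close>
  have "real n * \<rho>\<^sup>2 / (4 * L) \<le> n * (d \<bullet> d) / (4 * L)"
    using \<rho>(2) n L by (intro divide_right_mono mult_left_mono) (auto simp: d_def)
  also have "n * (d \<bullet> d) / (4 * L) \<le> q d / 4"
    using q_bounds(1)[OF ev lmin L d] by (simp add: field_simps)
  finally have "q z \<le> q d / 4"
    using qz by linarith
  then have "q d / 4 \<le> q (z - d)"
    using q_diff_bounds(1)[OF z d] by linarith
  moreover have "n * D\<^sup>2 / (4 * L) \<le> q d / 4"
    using q_bounds(1)[OF ev lmin L d] by (simp add: D2)
  ultimately have T: "n * D\<^sup>2 / (4 * L) \<le> q (z - d)"
    by linarith
  have zd: "\<beta>\<^sub>0 + z - \<gamma> = z - d"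
    using z \<beta> \<gamma> by (intro eq_vecI) (auto simp: d_def)
  have "\<delta> * n / (C * n) * (n * D\<^sup>2 / (4 * L) / real p) \<le> (real n - real p + a - 2) / (s + b) * (q (z - d) / real p)"
  proof (rule mult_mono)
    have Nn: "0 < \<delta> * real n"
      using N(2) n by simp
    show "\<delta> * n / (C * n) \<le> (real n - real p + a - 2) / (s + b)"
      using N(1) Nn sb by (intro frac_le) auto
    show "0 \<le> (real n - real p + a - 2) / (s + b)"
      using N(1) Nn sb by (intro divide_nonneg_pos) auto
    show "n * D\<^sup>2 / (4 * L) / real p \<le> q (z - d) / real p"
      using T by (rule divide_right_mono) simp
  qed (use n L in simp)
  also have "\<dots> \<le> g + 1"
    unfolding g_def g_EB_eq zd by simp
  also have "\<delta> * n / (C * n) * (n * D\<^sup>2 / (4 * L) / real p) = D * (\<delta> * n * D / (4 * L * C * real p))"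
    using n by (simp add: power2_eq_square mult_ac)
  finally have g1: "D * (\<delta> * n * D / (4 * L * C * real p)) \<le> g + 1" .
  have pos: "0 < \<delta> * n * \<rho> / (4 * L * C * real p)"
    using N(2) n \<rho>(1) L C p_pos by simp
  \<comment> \<open>The lower bound for g + 1 is quadratic in D: one factor D absorbs the maximum
    norm of d, the other is bounded below by \<rho>.\<close>
  have "linf_norm d * (\<delta> * n * \<rho> / (4 * L * C * real p)) \<le> D * (\<delta> * n * D / (4 * L * C * real p))"
  proof (intro mult_mono divide_right_mono mult_left_mono)
    show "linf_norm d \<le> D"
      unfolding D_def using linf_norm_sq_le[of d] by (rule real_le_rsqrt)
  qed (use D D_pos N(2) n \<rho>(1) L C p_pos in auto)
  then have "linf_norm d * (\<delta> * n * \<rho> / (4 * L * C * real p)) \<le> g + 1"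
    using g1 by linarith
  then have "linf_norm d \<le> (g + 1) / (\<delta> * n * \<rho> / (4 * L * C * real p))"
    using pos by (simp only: pos_le_divide_eq)
  also have "\<dots> = 4 * L * C * (real p / real n) / (\<delta> * \<rho>) * (g + 1)"
    using n by (simp add: mult_ac)
  finally have "linf_norm d \<le> 4 * L * C * (real p / real n) / (\<delta> * \<rho>) * (g + 1)" .
  moreover have "0 < g + 1"
    using g_EB_nonneg[of \<gamma> a b "\<beta>\<^sub>0 + z" s] by (simp add: g_def)
  ultimately show ?thesis
    unfolding d_def[symmetric] g_def[symmetric] by (simp only: pos_divide_le_eq)
qed

text \<open>Both factors of the estimate stay bounded: the residual sum of squares grows linearly in
  n, and the quadratic form is of order n, as is p.\<close>

lemma g_EB_le:
  assumes ev: "\<And>l. eigenvalue (real n \<cdot>\<^sub>m gram_inv X) l \<Longrightarrow> lmin \<le> l \<and> l \<le> L" and lmin: "0 < lmin" and L: "0 < L"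
    and z: "z \<in> carrier_vec p" and \<beta>: "\<beta>\<^sub>0 \<in> carrier_vec p" and \<gamma>: "\<gamma> \<in> carrier_vec p"
    and D: "(\<gamma> - \<beta>\<^sub>0) \<bullet> (\<gamma> - \<beta>\<^sub>0) \<le> D" and qz: "q z \<le> H * real n"
    and s: "\<kappa> * real n \<le> s" "0 < \<kappa>" and b: "0 \<le> b" and p: "c * real n \<le> real p" "0 < c" and a: "a \<le> A" "0 \<le> A"
  shows "g_EB X \<gamma> a b (\<beta>\<^sub>0 + z) s \<le> (1 + A) * (2 * H + 2 * D / lmin) / (\<kappa> * c)"
proof -
  define d where "d = \<gamma> - \<beta>\<^sub>0"
  have d: "d \<in> carrier_vec p"
    using \<gamma> \<beta> by (simp add: d_def)
  have n: "1 \<le> real n"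
    using p_less_n by simp
  have zd: "\<beta>\<^sub>0 + z - \<gamma> = z - d"
    using z \<beta> \<gamma> by (intro eq_vecI) (auto simp: d_def)
  have D0: "0 \<le> D"
    using D scalar_prod_self_ge_0[of "\<gamma> - \<beta>\<^sub>0"] by linarith
  have "0 \<le> H * real n"
    using qz q_nonneg[OF z] by linarith
  then have H0: "0 \<le> H"
    using n by (simp add: zero_le_mult_iff)
  have "q d \<le> n / lmin * (d \<bullet> d)"
    by (rule q_bounds(2)[OF ev lmin L d])
  also have "\<dots> \<le> n / lmin * D"
    using D lmin by (intro mult_left_mono) (auto simp: d_def)
  finally have "q d \<le> n / lmin * D" .
  then have T: "q (z - d) \<le> n * (2 * H + 2 * D / lmin)"
  proof -
    have "n * (2 * H + 2 * D / lmin) = 2 * (H * real n) + 2 * (n / lmin * D)"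
      by (simp add: algebra_simps)
    then show ?thesis
      using q_diff_bounds(2)[OF z d] qz \<open>q d \<le> n / lmin * D\<close> by linarith
  qed
  define B where "B = 2 * H + 2 * D / lmin"
  have B0: "0 \<le> B"
    using H0 D0 lmin by (simp add: B_def)
  have kn: "0 < \<kappa> * real n" and cn: "0 < c * real n"
    using s(2) p(2) n by auto
  \<comment> \<open>The corrected degrees of freedom may be negative for small n; the product is
    then nonpositive.\<close>
  have "(real n - real p + a - 2) / (s + b) * (q (z - d) / real p) \<le> ((1 + A) * n) / (\<kappa> * n) * (n * B / (c * n))"
  proof (cases "0 \<le> real n - real p + a - 2")
    case True
    have "A * 1 \<le> A * n"
      using n a(2) by (intro mult_left_mono) auto
    then have "real n - real p + a - 2 \<le> (1 + A) * n"
      using a(1) by (simp add: algebra_simps)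
    then show ?thesis
      using True T s b p kn cn B0 a(2) n q_nonneg[of "z - d"] z d
      unfolding B_def[symmetric] by (intro mult_mono frac_le divide_nonneg_nonneg) auto
  next
    case False
    have "(real n - real p + a - 2) / (s + b) * (q (z - d) / real p) \<le> 0"
      using False s(1) b kn q_nonneg[of "z - d"] z d
      by (intro mult_nonpos_nonneg divide_nonpos_nonneg divide_nonneg_nonneg) auto
    also have "0 \<le> ((1 + A) * n) / (\<kappa> * n) * (n * B / (c * n))"
      using a(2) kn cn B0 by (intro mult_nonneg_nonneg divide_nonneg_pos) auto
    finally show ?thesis .
  qed
  also have "\<dots> = (1 + A) * B / (\<kappa> * c)"
    using n by simp
  finally have "(real n - real p + a - 2) / (s + b) * (q (z - d) / real p) \<le> (1 + A) * B / (\<kappa> * c)" .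
  moreover have "0 \<le> (1 + A) * B / (\<kappa> * c)"
    using a(2) B0 s(2) p(2) by simp
  ultimately show ?thesis
    unfolding g_EB_eq zd B_def[symmetric] by simp
qed

end

section \<open>Asymptotics\<close>

text \<open>Half of the exponential rate absorbs the factor n; the other half leaves a geometric
  series.\<close>

lemma summable_power_mult_exp:
  assumes "0 < c"
  shows "summable (\<lambda>n. 2 * real n * exp (- (c * real n)))"
proof (rule summable_comparison_test)
  have "2 * real n * exp (- (c * real n)) \<le> 4 / c * exp (- (c / 2)) ^ n" for n
  proof -
    have "c / 2 * real n \<le> exp (c / 2 * real n)"
      using exp_ge_add_one_self[of "c / 2 * real n"] by linarith
    then have "real n \<le> 2 / c * exp (c / 2 * real n)"
      using assms by (simp add: field_simps)
    then have "2 * real n * exp (- (c * real n)) \<le> 2 * (2 / c * exp (c / 2 * real n)) * exp (- (c * real n))"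
      by (intro mult_right_mono) auto
    also have "\<dots> = 4 / c * (exp (c / 2 * real n) * exp (- (c * real n)))"
      by simp
    also have "exp (c / 2 * real n) * exp (- (c * real n)) = exp (real n * - (c / 2))"
      by (simp add: field_simps flip: exp_add)
    also have "\<dots> = exp (- (c / 2)) ^ n"
      by (rule exp_of_nat_mult)
    finally show ?thesis .
  qed
  then show "\<exists>N. \<forall>n\<ge>N. norm (2 * real n * exp (- (c * real n))) \<le> 4 / c * exp (- (c / 2)) ^ n"
    by simp
  show "summable (\<lambda>n. 4 / c * exp (- (c / 2)) ^ n)"
    using assms by (intro summable_mult summable_geometric) simp
qed

locale linear_model_sequence = prob_space M for M :: "'w measure" +
  fixes p :: "nat \<Rightarrow> nat"
    and X :: "nat \<Rightarrow> real mat"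
    and e :: "nat \<Rightarrow> 'w \<Rightarrow> real Matrix.vec"
    and \<beta>\<^sub>0 \<gamma> :: "nat \<Rightarrow> real Matrix.vec"
    and \<sigma>\<^sub>0 \<alpha> a b lmin L :: real
  assumes p_less: "\<And>n. 1 \<le> n \<Longrightarrow> p n < n"
    and p_lim: "(\<lambda>n. real (p n) / real n) \<longlonglongrightarrow> \<alpha>"
    and alpha: "0 \<le> \<alpha>" "\<alpha> < 1"
    and X_dim: "\<And>n. 1 \<le> n \<Longrightarrow> X n \<in> carrier_mat n (p n)"
    and X_rank: "\<And>n. 1 \<le> n \<Longrightarrow> vec_space.rank n (X n) = p n"
    and lmin: "0 < lmin" and L: "0 < L"
    and eigenvalues: "\<And>n l. 1 \<le> n \<Longrightarrow> eigenvalue (real n \<cdot>\<^sub>m gram_inv (X n)) l \<Longrightarrow> lmin \<le> l \<and> l \<le> L"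
    and gamma_dim: "\<And>n. 1 \<le> n \<Longrightarrow> \<gamma> n \<in> carrier_vec (p n)"
    and beta0_dim: "\<And>n. 1 \<le> n \<Longrightarrow> \<beta>\<^sub>0 n \<in> carrier_vec (p n)"
    and sigma0: "0 < \<sigma>\<^sub>0"
    and prior_params: "- 2 \<le> a" "0 \<le> b"
    and errors: "\<And>n. 1 \<le> n \<Longrightarrow>
          distributed M (vec_lborel n) (e n) (\<lambda>x. ennreal (mvn_density (0\<^sub>v n) (\<sigma>\<^sub>0\<^sup>2 \<cdot>\<^sub>m 1\<^sub>m n) x))"
begin

lemma gaussian_linear_model: "1 \<le> n \<Longrightarrow> gaussian_linear_model (p n) (X n) n"
  by (rule gaussian_linear_model_full_rank[OF X_dim X_rank p_less])

lemma gaussian_errors: "1 \<le> n \<Longrightarrow> gaussian_errors (p n) (X n) n M (e n) \<sigma>\<^sub>0"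
  using gaussian_linear_model errors sigma0 prob_space_axioms
  by (intro gaussian_errors.intro gaussian_errors_axioms.intro)

definition dev :: "nat \<Rightarrow> real Matrix.vec" where "dev n = \<gamma> n - \<beta>\<^sub>0 n"

definition proj_err :: "nat \<Rightarrow> 'w \<Rightarrow> real Matrix.vec" where
  "proj_err n \<omega> = gaussian_linear_model.err_proj (X n) (e n \<omega>)"

definition resid :: "nat \<Rightarrow> 'w \<Rightarrow> real" where
  "resid n \<omega> = gaussian_linear_model.err_rss (X n) (e n \<omega>)"

definition form :: "nat \<Rightarrow> real Matrix.vec \<Rightarrow> real" where
  "form n = pos_def_pair.q (transpose_mat (X n) * X n)"

text \<open>The posterior probability with the data written through the errors: for n \<ge> 1 the
  substituted arguments are \<open>ols\<close> and \<open>rss\<close> of the observation, see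
  \<open>posterior_consistency_iff\<close>.\<close>

definition post :: "real \<Rightarrow> nat \<Rightarrow> 'w \<Rightarrow> ennreal" where
  "post \<epsilon> n \<omega> = EB_posterior_prob (X n) (\<gamma> n) a b (\<beta>\<^sub>0 n + proj_err n \<omega>) (resid n \<omega>)
     {\<beta> \<in> carrier_vec (p n). \<epsilon> < linf_norm (\<beta> - \<beta>\<^sub>0 n)}"

definition gEB :: "nat \<Rightarrow> 'w \<Rightarrow> real" where
  "gEB n \<omega> = g_EB (X n) (\<gamma> n) a b (\<beta>\<^sub>0 n + proj_err n \<omega>) (resid n \<omega>)"

section \<open>Almost sure bounds along the sequence of models\<close>

lemma AE_norm_sq_bounded: "AE \<omega> in M. \<forall>\<^sub>F n in sequentially. e n \<omega> \<bullet> e n \<omega> \<le> 4 * \<sigma>\<^sub>0\<^sup>2 * real n"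
proof -
  have "AE \<omega> in M. \<forall>\<^sub>F n in sequentially. \<not> 4 * \<sigma>\<^sub>0\<^sup>2 * real n \<le> e n \<omega> \<bullet> e n \<omega>"
  proof (rule AE_eventually_of_summable)
    fix n :: nat assume "1 \<le> n"
    then interpret E: gaussian_errors "p n" "X n" n M "e n" \<sigma>\<^sub>0
      by (rule gaussian_errors)
    show "{\<omega> \<in> space M. 4 * \<sigma>\<^sub>0\<^sup>2 * real n \<le> e n \<omega> \<bullet> e n \<omega>} \<in> events"
      by measurable
  next
    show "\<forall>\<^sub>F n in sequentially. prob {\<omega> \<in> space M. 4 * \<sigma>\<^sub>0\<^sup>2 * real n \<le> e n \<omega> \<bullet> e n \<omega>} \<le> exp (- 1 / 2) ^ n"
      using eventually_ge_at_top[of 1]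
    proof eventually_elim
      case (elim n)
      then show ?case
        by (rule gaussian_errors.prob_norm_sq_ge[OF gaussian_errors])
    qed
    show "summable (\<lambda>n. exp (- 1 / 2 :: real) ^ n)"
      by (intro summable_geometric) simp
  qed
  then show ?thesis
    by eventually_elim (auto elim: eventually_mono)
qed

text \<open>Each coordinate has variance at most \<open>\<sigma>\<^sub>0\<^sup>2 * L / n\<close>, so
  its tail is exponentially small in n, and a union over p < n coordinates stays summable.\<close>

lemma AE_linf_proj_err:
  assumes \<eta>: "0 < \<eta>"
  shows "AE \<omega> in M. \<forall>\<^sub>F n in sequentially. linf_norm (proj_err n \<omega>) \<le> \<eta>"
proof -
  define c where "c = \<eta>\<^sup>2 / (2 * \<sigma>\<^sub>0\<^sup>2 * L)"
  have "AE \<omega> in M. \<forall>\<^sub>F n in sequentially. \<not> \<eta> < linf_norm (proj_err n \<omega>)"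
  proof (rule AE_eventually_of_summable)
    fix n :: nat assume n: "1 \<le> n"
    then interpret E: gaussian_errors "p n" "X n" n M "e n" \<sigma>\<^sub>0
      by (rule gaussian_errors)
    have [measurable]: "(\<lambda>\<omega>. proj_err n \<omega>) \<in> measurable M (vec_lborel (p n))"
      unfolding proj_err_def by (rule measurable_compose[OF E.measurable_e E.measurable_err_proj])
    have "{x \<in> carrier_vec (p n). \<eta> < linf_norm (x - 0\<^sub>v (p n))} \<in> sets (vec_lborel (p n))"
      using \<eta> by (intro linf_ball_complement_measurable) auto
    then have "(\<lambda>\<omega>. proj_err n \<omega>) -` {x \<in> carrier_vec (p n). \<eta> < linf_norm (x - 0\<^sub>v (p n))} \<inter> space M \<in> events"
      by measurable
    also have "(\<lambda>\<omega>. proj_err n \<omega>) -` {x \<in> carrier_vec (p n). \<eta> < linf_norm (x - 0\<^sub>v (p n))} \<inter> space M =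
        {\<omega> \<in> space M. \<eta> < linf_norm (proj_err n \<omega>)}"
      using E.err_proj_carrier[OF E.e_carrier] by (auto simp: proj_err_def)
    finally show "{\<omega> \<in> space M. \<eta> < linf_norm (proj_err n \<omega>)} \<in> events" .
  next
    show "\<forall>\<^sub>F n in sequentially. prob {\<omega> \<in> space M. \<eta> < linf_norm (proj_err n \<omega>)} \<le> 2 * real n * exp (- (c * real n))"
      using eventually_ge_at_top[of 1]
    proof eventually_elim
      case (elim n)
      then interpret E: gaussian_errors "p n" "X n" n M "e n" \<sigma>\<^sub>0
        by (rule gaussian_errors)
      have "prob {\<omega> \<in> space M. \<eta> < linf_norm (proj_err n \<omega>)} \<le> 2 * real (p n) * exp (- (\<eta>\<^sup>2 / (2 * \<sigma>\<^sub>0\<^sup>2 * (L / n))))"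
        unfolding proj_err_def using elim L \<eta>
        by (intro E.prob_linf_err_proj_ge E.gram_inv_diag_le[OF eigenvalues]) auto
      also have "\<eta>\<^sup>2 / (2 * \<sigma>\<^sub>0\<^sup>2 * (L / n)) = c * real n"
        by (simp add: c_def)
      also have "2 * real (p n) * exp (- (c * real n)) \<le> 2 * real n * exp (- (c * real n))"
        using p_less[OF elim] by (intro mult_right_mono) auto
      finally show ?case .
    qed
    show "summable (\<lambda>n. 2 * real n * exp (- (c * real n)))"
      using \<eta> sigma0 L by (intro summable_power_mult_exp) (simp add: c_def)
  qed
  then show ?thesis
    by (simp add: not_less)
qed

text \<open>The form is of order p, which is o(n) here: eventually p/n < u, and then exp(p/2 - u n)
  is at most exp(-u n/2).\<close>

lemma AE_form_proj_err:
  assumes \<eta>: "0 < \<eta>" and \<alpha>0: "\<alpha> = 0"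
  shows "AE \<omega> in M. \<forall>\<^sub>F n in sequentially. form n (proj_err n \<omega>) \<le> \<eta> * real n"
proof -
  define u where "u = \<eta> / (4 * \<sigma>\<^sub>0\<^sup>2)"
  have u: "0 < u" "4 * \<sigma>\<^sub>0\<^sup>2 * u = \<eta>"
    using \<eta> sigma0 by (auto simp: u_def)
  have "AE \<omega> in M. \<forall>\<^sub>F n in sequentially. \<not> \<eta> * real n \<le> form n (proj_err n \<omega>)"
  proof (rule AE_eventually_of_summable)
    fix n :: nat assume n: "1 \<le> n"
    then interpret E: gaussian_errors "p n" "X n" n M "e n" \<sigma>\<^sub>0
      by (rule gaussian_errors)
    show "{\<omega> \<in> space M. \<eta> * real n \<le> form n (proj_err n \<omega>)} \<in> events"
      unfolding form_def proj_err_def by measurable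
  next
    have "\<forall>\<^sub>F n in sequentially. real (p n) / real n < u"
      using order_tendstoD(2)[OF p_lim] u(1) \<alpha>0 by simp
    then show "\<forall>\<^sub>F n in sequentially. prob {\<omega> \<in> space M. \<eta> * real n \<le> form n (proj_err n \<omega>)} \<le> exp (- (u / 2)) ^ n"
      using eventually_ge_at_top[of 1]
    proof eventually_elim
      case (elim n)
      then interpret E: gaussian_errors "p n" "X n" n M "e n" \<sigma>\<^sub>0
        by (intro gaussian_errors)
      have eq: "4 * \<sigma>\<^sub>0\<^sup>2 * (u * real n) = \<eta> * real n"
        by (simp flip: u(2))
      have "prob {\<omega> \<in> space M. \<eta> * real n \<le> form n (proj_err n \<omega>)} \<le> exp (real (p n) / 2 - u * real n)"
        unfolding form_def proj_err_def using E.prob_q_err_proj_ge[of "u * real n"] by (simp only: eq)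
      also have "\<dots> \<le> exp (real n * - (u / 2))"
        using elim by (simp add: field_simps)
      also have "\<dots> = exp (- (u / 2)) ^ n"
        by (rule exp_of_nat_mult)
      finally show ?case .
    qed
    show "summable (\<lambda>n. exp (- (u / 2)) ^ n)"
      using u by (intro summable_geometric) simp
  qed
  then show ?thesis
    by eventually_elim (auto elim: eventually_mono)
qed

text \<open>Half of the limit of (n - p)/n; the slack absorbs the correction a - 2 and the
  fluctuation of p/n.\<close>

definition \<delta> :: real where "\<delta> = (1 - \<alpha>) / 2"

lemma \<delta>_pos: "0 < \<delta>"
  using alpha by (simp add: \<delta>_def)

lemma eventually_df: "\<forall>\<^sub>F n in sequentially. \<delta> * real n \<le> real n - real (p n) + a - 2"
proof -
  have "(\<lambda>n. 1 - real (p n) / real n + (a - 2) / real n) \<longlonglongrightarrow> 1 - \<alpha> + 0"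
    by (intro tendsto_add tendsto_diff tendsto_const p_lim lim_const_over_n)
  moreover have "\<delta> < 1 - \<alpha> + 0"
    using alpha by (simp add: \<delta>_def)
  ultimately have "\<forall>\<^sub>F n in sequentially. \<delta> < 1 - real (p n) / real n + (a - 2) / real n"
    by (rule order_tendstoD)
  then show ?thesis
    using eventually_ge_at_top[of 1]
  proof eventually_elim
    case (elim n)
    then have "\<delta> * real n \<le> (1 - real (p n) / real n + (a - 2) / real n) * real n"
      by (intro mult_right_mono) auto
    also have "\<dots> = real n - real (p n) + a - 2"
      using elim by (simp add: field_simps)
    finally show ?case .
  qed
qed

lemma AE_resid_lower: "AE \<omega> in M. \<forall>\<^sub>F n in sequentially. \<sigma>\<^sub>0\<^sup>2 * \<delta> * ln 2 / 4 * real n \<le> resid n \<omega>"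
proof -
  define \<kappa> where "\<kappa> = \<sigma>\<^sub>0\<^sup>2 * \<delta> * ln 2 / 4"
  \<comment> \<open>The lower tail bound at t = 1 contributes at most 2^(-\<delta> n/2) = exp(-4 u
    n), while the level costs only exp(u n).\<close>
  define u where "u = \<delta> * ln 2 / 8"
  have u: "0 < u" "2 * \<sigma>\<^sub>0\<^sup>2 * u = \<kappa>"
    using \<delta>_pos by (auto simp: u_def \<kappa>_def)
  have "(\<lambda>n. 1 - real (p n) / real n) \<longlonglongrightarrow> 1 - \<alpha>"
    by (intro tendsto_diff tendsto_const p_lim)
  moreover have "\<delta> < 1 - \<alpha>"
    using alpha by (simp add: \<delta>_def)
  ultimately have "\<forall>\<^sub>F n in sequentially. \<delta> < 1 - real (p n) / real n"
    by (rule order_tendstoD)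
  then have df: "\<forall>\<^sub>F n in sequentially. \<delta> * real n \<le> real n - real (p n)"
    using eventually_ge_at_top[of 1] by eventually_elim (simp add: field_simps)
  have "AE \<omega> in M. \<forall>\<^sub>F n in sequentially. \<not> resid n \<omega> \<le> \<kappa> * real n"
  proof (rule AE_eventually_of_summable)
    fix n :: nat assume n: "1 \<le> n"
    then interpret E: gaussian_errors "p n" "X n" n M "e n" \<sigma>\<^sub>0
      by (rule gaussian_errors)
    show "{\<omega> \<in> space M. resid n \<omega> \<le> \<kappa> * real n} \<in> events"
      unfolding resid_def by measurable
  next
    show "\<forall>\<^sub>F n in sequentially. prob {\<omega> \<in> space M. resid n \<omega> \<le> \<kappa> * real n} \<le> exp (- u) ^ n"
      using df eventually_ge_at_top[of 1]
    proof eventually_elim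
      case (elim n)
      then interpret E: gaussian_errors "p n" "X n" n M "e n" \<sigma>\<^sub>0
        by (intro gaussian_errors)
      have eq: "2 * \<sigma>\<^sub>0\<^sup>2 * (u * real n) = \<kappa> * real n"
        by (simp flip: u(2))
      have "prob {\<omega> \<in> space M. resid n \<omega> \<le> \<kappa> * real n} \<le> 2 powr (- (real n - real (p n)) / 2) * exp (u * real n)"
        unfolding resid_def using E.prob_err_rss_le[of 1 "u * real n"]
        by (simp only: eq one_add_one mult_1_left zero_less_one simp_thms)
      also have "\<dots> \<le> 2 powr (- (\<delta> * real n) / 2) * exp (u * real n)"
        using elim by (intro mult_right_mono powr_mono) auto
      also have "\<dots> = exp (- (\<delta> * real n) / 2 * ln 2 + u * real n)"
        unfolding exp_add by (simp add: powr_def)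
      also have "\<dots> \<le> exp (real n * - u)"
        using \<delta>_pos by (simp add: u_def)
      also have "\<dots> = exp (- u) ^ n"
        by (rule exp_of_nat_mult)
      finally show ?case .
    qed
    show "summable (\<lambda>n. exp (- u) ^ n)"
      using u by (intro summable_geometric) simp
  qed
  then show ?thesis
    unfolding \<kappa>_def by eventually_elim (auto elim: eventually_mono)
qed

lemma AE_resid_pos: "AE \<omega> in M. \<forall>n\<ge>1. 0 < resid n \<omega>"
  unfolding resid_def
  by (intro AE_all_countable[THEN iffD2] allI AE_impI gaussian_errors.AE_err_rss_pos[OF gaussian_errors])

lemma g_posterior:
  assumes n: "1 \<le> n" and \<omega>: "\<omega> \<in> space M" and s: "0 < resid n \<omega>"
  shows "g_posterior (p n) (X n) n b (resid n \<omega>) (gEB n \<omega>) (\<beta>\<^sub>0 n + proj_err n \<omega>) (\<gamma> n)"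
proof -
  interpret E: gaussian_errors "p n" "X n" n M "e n" \<sigma>\<^sub>0
    by (rule gaussian_errors[OF n])
  show ?thesis
    using s prior_params gamma_dim[OF n] beta0_dim[OF n] E.err_proj_carrier[OF E.e_carrier[OF \<omega>]] E.g_EB_nonneg
    by unfold_locales (auto simp: gEB_def proj_err_def)
qed

text \<open>The posterior mass outside the \<open>\<epsilon>\<close>-ball is of order \<open>p / n\<^sup>2\<close> once the posterior mean is within
  \<open>\<epsilon> / 2\<close> of \<open>\<beta>\<^sub>0\<close>; the hypotheses bound the two parts of the error of the mean.\<close>

lemma consistent_of_separation:
  assumes \<epsilon>: "0 < \<epsilon>" and \<rho>: "0 < \<rho>"
    and sep: "\<forall>\<^sub>F n in sequentially. linf_norm (dev n) \<le> \<epsilon> / 4 \<or> \<rho>\<^sup>2 \<le> dev n \<bullet> dev n"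
    and small: "\<forall>\<^sub>F n in sequentially. 4 * L * (4 * \<sigma>\<^sub>0\<^sup>2 + b) * (real (p n) / real n) / (\<delta> * \<rho>) \<le> \<epsilon> / 4"
    and form: "AE \<omega> in M. \<forall>\<^sub>F n in sequentially. form n (proj_err n \<omega>) \<le> real n * \<rho>\<^sup>2 / (4 * L)"
  shows "AE \<omega> in M. (\<lambda>n. post \<epsilon> n \<omega>) \<longlonglongrightarrow> 0"
proof -
  define C where "C = 4 * \<sigma>\<^sub>0\<^sup>2 + b"
  \<comment> \<open>Collects the constants of the final bound Q/n; the factor 4 comes from (a + n -
    2)(a + n - 4) \<ge> (n/2)^2.\<close>
  define Q where "Q = 1024 * (2 / \<epsilon>) ^ 4 * L\<^sup>2 * (C * (1 + 1 / \<delta>))\<^sup>2 * 4"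
  have C: "0 < C"
    using sigma0 prior_params by (simp add: C_def add_pos_nonneg)
  have ev12: "0 < \<epsilon> / 4"
    using \<epsilon> by simp
  have AE: "AE \<omega> in M. \<omega> \<in> space M"
    by simp
  show ?thesis
    using AE form AE_norm_sq_bounded AE_linf_proj_err[OF ev12] AE_resid_pos
  proof eventually_elim
    case \<omega>: (elim \<omega>)
    have "\<forall>\<^sub>F n in sequentially. post \<epsilon> n \<omega> \<le> ennreal (Q / real n)"
      using \<omega>(2,3,4) sep small eventually_df eventually_ge_at_top[of 12]
    proof eventually_elim
      case (elim n)
      have n: "1 \<le> n" and n12: "12 \<le> real n"
        using elim(7) by auto
      have s: "0 < resid n \<omega>"
        using \<omega>(5) n by blast
      interpret E: gaussian_errors "p n" "X n" n M "e n" \<sigma>\<^sub>0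
        by (rule gaussian_errors[OF n])
      interpret P: g_posterior "p n" "X n" n a b "resid n \<omega>" "gEB n \<omega>" "\<beta>\<^sub>0 n + proj_err n \<omega>" "\<gamma> n"
        by (rule g_posterior[OF n \<omega>(1) s])
      note en = E.e_carrier[OF \<omega>(1)]
      have z: "proj_err n \<omega> \<in> carrier_vec (p n)"
        unfolding proj_err_def by (rule E.err_proj_carrier[OF en])
      have g0: "0 \<le> gEB n \<omega>"
        by (simp add: gEB_def E.g_EB_nonneg)
      have "resid n \<omega> \<le> e n \<omega> \<bullet> e n \<omega>"
        unfolding resid_def E.err_rss_def using E.q_nonneg[OF E.err_proj_carrier[OF en]] by simp
      also have "\<dots> \<le> 4 * \<sigma>\<^sub>0\<^sup>2 * real n"
        by (rule elim(2))
      finally have "resid n \<omega> + b \<le> 4 * \<sigma>\<^sub>0\<^sup>2 * real n + b * real n"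
        using prior_params(2) n mult_left_mono[of 1 "real n" b] by simp
      then have sb: "resid n \<omega> + b \<le> C * real n"
        by (simp add: C_def distrib_right)
      have sb0: "0 < resid n \<omega> + b"
        using s prior_params by simp
      have dn: "0 < \<delta> * real n"
        using \<delta>_pos n by simp
      have N: "0 < real n - real (p n) + a - 2"
        using elim(6) dn by linarith
      have bias: "linf_norm (\<gamma> n - \<beta>\<^sub>0 n) / (gEB n \<omega> + 1) \<le> \<epsilon> / 4"
      \<comment> \<open>A prior centre close in the maximum norm does no harm, as g + 1 \<ge> 1;
        otherwise it is far in the Euclidean norm and \<open>shrinkage_bias_le\<close>
        applies.\<close>
      proof (cases "linf_norm (dev n) \<le> \<epsilon> / 4")
        case True
        have "linf_norm (\<gamma> n - \<beta>\<^sub>0 n) / (gEB n \<omega> + 1) \<le> linf_norm (\<gamma> n - \<beta>\<^sub>0 n) / 1"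
          using g0 linf_norm_nonneg by (intro divide_left_mono) auto
        also have "\<dots> = linf_norm (dev n)"
          by (simp add: dev_def)
        finally show ?thesis
          using True by linarith
      next
        case False
        then have far: "\<rho>\<^sup>2 \<le> (\<gamma> n - \<beta>\<^sub>0 n) \<bullet> (\<gamma> n - \<beta>\<^sub>0 n)"
          using elim(4) by (simp add: dev_def)
        have "linf_norm (\<gamma> n - \<beta>\<^sub>0 n) / (gEB n \<omega> + 1) \<le> 4 * L * C * (real (p n) / real n) / (\<delta> * \<rho>)"
          using E.shrinkage_bias_le[OF eigenvalues[OF n] lmin L z beta0_dim[OF n] gamma_dim[OF n] \<rho> far
              elim(1)[unfolded form_def] elim(6) \<delta>_pos sb0 sb]
          unfolding gEB_def .
        then show ?thesis
          using elim(5) unfolding C_def by linarith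
      qed
      have near: "linf_norm (P.post_mean - \<beta>\<^sub>0 n) \<le> \<epsilon> / 2"
        using P.post_mean_deviation(1)[OF beta0_dim[OF n] z refl] bias elim(3) by linarith
      have "P.post_scale \<le> C * (1 + 1 / \<delta>) * real n"
      proof -
        have "E.q (\<beta>\<^sub>0 n + proj_err n \<omega> - \<gamma> n) / (gEB n \<omega> + 1) \<le>
            real (p n) * (resid n \<omega> + b) / (real n - real (p n) + a - 2)"
          unfolding gEB_def by (rule E.q_div_g_EB_le[OF N sb0]) (use z beta0_dim[OF n] gamma_dim[OF n] in auto)
        also have "\<dots> \<le> real n * (C * real n) / (\<delta> * real n)"
          using p_less[OF n] sb sb0 elim(6) dn by (intro frac_le mult_mono) auto
        also have "\<dots> = C * (1 / \<delta>) * real n"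
          using n by simp
        finally show ?thesis
          unfolding P.post_scale_def using sb by (simp add: algebra_simps)
      qed
      then have scale: "P.post_scale\<^sup>2 \<le> (C * (1 + 1 / \<delta>) * real n)\<^sup>2"
        using P.post_scale_pos by (intro power_mono) auto
      \<comment> \<open>For -2 \<le> a the smaller factor a + n - 4 is at least n/2 from n = 12
        on.\<close>
      have half: "real n / 2 * (real n / 2) \<le> (a + n - 2) * (a + n - 4)"
        using prior_params n12 by (intro mult_mono) auto
      have "post \<epsilon> n \<omega> \<le> ennreal (1024 * (2 / \<epsilon>) ^ 4 * p n * (L / n)\<^sup>2 * (P.post_scale\<^sup>2 / ((a + n - 2) * (a + n - 4))))"
        unfolding post_def EB_posterior_prob_def gEB_def[symmetric]
        by (rule P.posterior_prob_le[OF _ beta0_dim[OF n] \<epsilon> near])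
          (use E.gram_inv_diag_le[OF eigenvalues[OF n]] prior_params n12 L in auto)
      also have "\<dots> \<le> ennreal (1024 * (2 / \<epsilon>) ^ 4 * real n * (L / n)\<^sup>2 * ((C * (1 + 1 / \<delta>) * real n)\<^sup>2 / (real n / 2 * (real n / 2))))"
      proof (intro ennreal_leI mult_mono)
        have "0 < real n / 2 * (real n / 2)"
          using n12 by simp
        then show "P.post_scale\<^sup>2 / ((a + n - 2) * (a + n - 4)) \<le> (C * (1 + 1 / \<delta>) * real n)\<^sup>2 / (real n / 2 * (real n / 2))"
          by (intro frac_le scale half) auto
        have "0 \<le> (a + n - 2) * (a + n - 4)"
          using half \<open>0 < real n / 2 * (real n / 2)\<close> by linarith
        then show "0 \<le> P.post_scale\<^sup>2 / ((a + n - 2) * (a + n - 4))"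
          by simp
      qed (use p_less[OF n] in auto)
      also have "1024 * (2 / \<epsilon>) ^ 4 * real n * (L / n)\<^sup>2 * ((C * (1 + 1 / \<delta>) * real n)\<^sup>2 / (real n / 2 * (real n / 2))) = Q / real n"
        using n12 by (simp add: Q_def power2_eq_square)
      finally show ?case .
    qed
    moreover have "(\<lambda>n. ennreal (Q / real n)) \<longlonglongrightarrow> ennreal 0"
      by (intro tendsto_ennrealI lim_const_over_n)
    ultimately show "(\<lambda>n. post \<epsilon> n \<omega>) \<longlonglongrightarrow> 0"
      by (intro tendsto_sandwich[of "\<lambda>_. 0" "\<lambda>n. post \<epsilon> n \<omega>" sequentially "\<lambda>n. ennreal (Q / real n)" 0]) auto
  qed
qed

text \<open>Separation at \<rho> = \<epsilon>/4 is automatic, since the maximum norm is at most the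
  Euclidean norm. The other two conditions follow from p/n tending to 0.\<close>

lemma consistent_alpha_0:
  assumes \<epsilon>: "0 < \<epsilon>" and \<alpha>0: "\<alpha> = 0"
  shows "AE \<omega> in M. (\<lambda>n. post \<epsilon> n \<omega>) \<longlonglongrightarrow> 0"
proof (rule consistent_of_separation[OF \<epsilon>, of "\<epsilon> / 4"])
  show \<rho>: "0 < \<epsilon> / 4"
    using \<epsilon> by simp
  have "linf_norm (dev n) \<le> \<epsilon> / 4 \<or> (\<epsilon> / 4)\<^sup>2 \<le> dev n \<bullet> dev n" for n
    using linf_norm_sq_le[of "dev n"] power_mono[of "\<epsilon> / 4" "linf_norm (dev n)" 2] \<epsilon> by linarith
  then show "\<forall>\<^sub>F n in sequentially. linf_norm (dev n) \<le> \<epsilon> / 4 \<or> (\<epsilon> / 4)\<^sup>2 \<le> dev n \<bullet> dev n"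
    by simp
  have "(\<lambda>n. 4 * L * (4 * \<sigma>\<^sub>0\<^sup>2 + b) * (real (p n) / real n) / (\<delta> * (\<epsilon> / 4))) \<longlonglongrightarrow>
      4 * L * (4 * \<sigma>\<^sub>0\<^sup>2 + b) * \<alpha> / (\<delta> * (\<epsilon> / 4))"
    using \<delta>_pos \<epsilon> by (intro tendsto_intros p_lim) auto
  then have "\<forall>\<^sub>F n in sequentially. 4 * L * (4 * \<sigma>\<^sub>0\<^sup>2 + b) * (real (p n) / real n) / (\<delta> * (\<epsilon> / 4)) < \<epsilon> / 4"
    by (rule order_tendstoD) (use \<alpha>0 \<epsilon> in simp)
  then show "\<forall>\<^sub>F n in sequentially. 4 * L * (4 * \<sigma>\<^sub>0\<^sup>2 + b) * (real (p n) / real n) / (\<delta> * (\<epsilon> / 4)) \<le> \<epsilon> / 4"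
    by (rule eventually_mono) simp
  have "AE \<omega> in M. \<forall>\<^sub>F n in sequentially. form n (proj_err n \<omega>) \<le> (\<epsilon> / 4)\<^sup>2 / (4 * L) * real n"
    using \<epsilon> L by (intro AE_form_proj_err \<alpha>0) simp
  then show "AE \<omega> in M. \<forall>\<^sub>F n in sequentially. form n (proj_err n \<omega>) \<le> real n * (\<epsilon> / 4)\<^sup>2 / (4 * L)"
    by (simp add: mult.commute)
qed

text \<open>Projecting the error vector does not increase its norm; unlike
  \<open>AE_form_proj_err\<close> this covers every \<alpha>.\<close>

lemma AE_form_proj_err_le: "AE \<omega> in M. \<forall>\<^sub>F n in sequentially. form n (proj_err n \<omega>) \<le> 4 * \<sigma>\<^sub>0\<^sup>2 * real n"
proof -
  have AE: "AE \<omega> in M. \<omega> \<in> space M"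
    by simp
  show ?thesis
    using AE AE_norm_sq_bounded
  proof eventually_elim
    case (elim \<omega>)
    show ?case
      using elim(2) eventually_ge_at_top[of 1]
    proof eventually_elim
      case (elim n)
      interpret E: gaussian_errors "p n" "X n" n M "e n" \<sigma>\<^sub>0
        by (rule gaussian_errors[OF elim(2)])
      show ?case
        using E.q_err_proj_le[OF E.e_carrier[OF \<open>\<omega> \<in> space M\<close>]] elim(1)
        unfolding form_def proj_err_def by linarith
    qed
  qed
qed

lemma consistent_no_subsequence:
  assumes \<epsilon>: "0 < \<epsilon>"
    and no: "\<not> (\<exists>k A. strict_mono k \<and> (\<forall>n. 1 \<le> k n) \<and> 0 < A \<and>
      (\<lambda>n. dev (k n) \<bullet> dev (k n)) \<longlonglongrightarrow> A \<and> \<not> (\<lambda>n. linf_norm (dev (k n))) \<longlonglongrightarrow> 0)"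
  shows "AE \<omega> in M. (\<lambda>n. post \<epsilon> n \<omega>) \<longlonglongrightarrow> 0"
proof -
  define C where "C = 4 * \<sigma>\<^sub>0\<^sup>2 + b"
  have C: "0 < C"
    using sigma0 prior_params by (simp add: C_def add_pos_nonneg)
  \<comment> \<open>The first summand makes the bias at most \<epsilon>/4 using only p/n \<le> 1;
    the second makes the noise bound \<open>4 * \<sigma>\<^sub>0\<^sup>2 * n\<close> at most n
    \<rho>^2/(4 L).\<close>
  define \<rho> where "\<rho> = 4 * L * C / \<delta> / (\<epsilon> / 4) + sqrt (16 * \<sigma>\<^sub>0\<^sup>2 * L)"
  have \<rho>1: "0 < 4 * L * C / \<delta> / (\<epsilon> / 4)"
    using L C \<delta>_pos \<epsilon> by simp
  have s0: "0 \<le> sqrt (16 * \<sigma>\<^sub>0\<^sup>2 * L)"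
    using L by simp
  have \<rho>: "0 < \<rho>"
    unfolding \<rho>_def by (rule add_pos_nonneg[OF \<rho>1 s0])
  show ?thesis
  proof (rule consistent_of_separation[OF \<epsilon> \<rho>])
    show "\<forall>\<^sub>F n in sequentially. linf_norm (dev n) \<le> \<epsilon> / 4 \<or> \<rho>\<^sup>2 \<le> dev n \<bullet> dev n"
    proof (rule ccontr)
      \<comment> \<open>The indices at which separation fails. If there are infinitely many, their
        squared Euclidean norms lie in [0, \<rho>^2], and compactness yields the excluded
        subsequence.\<close>
      define P where "P n \<longleftrightarrow> \<epsilon> / 4 < linf_norm (dev n) \<and> dev n \<bullet> dev n < \<rho>\<^sup>2" for n
      assume "\<not> ?thesis"
      moreover have "\<forall>\<^sub>F n in sequentially. linf_norm (dev n) \<le> \<epsilon> / 4 \<or> \<rho>\<^sup>2 \<le> dev n \<bullet> dev n"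
        if "\<forall>\<^sub>F n in sequentially. \<not> P n"
        using that by (rule eventually_mono) (auto simp: P_def not_less)
      ultimately have "\<exists>\<^sub>F n in sequentially. P n"
        unfolding frequently_def by blast
      then have "\<exists>\<^sub>F n in sequentially. P n \<and> 1 \<le> n"
        by (rule frequently_eventually_frequently[OF _ eventually_ge_at_top])
      then have inf: "infinite {n. P n \<and> 1 \<le> n}"
        unfolding cofinite_eq_sequentially[symmetric] frequently_cofinite .
      define r where "r = enumerate {n. P n \<and> 1 \<le> n}"
      have r: "strict_mono r" "\<And>n. P (r n) \<and> 1 \<le> r n"
        using strict_mono_enumerate[OF inf] enumerate_in_set[OF inf] by (auto simp: r_def)
      have "\<forall>n. dev (r n) \<bullet> dev (r n) \<in> {0..\<rho>\<^sup>2}"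
        using r(2) by (auto simp: P_def scalar_prod_self_ge_0 less_imp_le)
      with compact_imp_seq_compact[OF compact_Icc] obtain A r' where A:
        "A \<in> {0..\<rho>\<^sup>2}" "strict_mono r'" "((\<lambda>n. dev (r n) \<bullet> dev (r n)) \<circ> r') \<longlonglongrightarrow> A"
        by (rule seq_compactE)
      define k where "k = r \<circ> r'"
      have k: "strict_mono k" "\<And>n. 1 \<le> k n" "\<And>n. \<epsilon> / 4 < linf_norm (dev (k n))"
        using strict_mono_o[OF r(1) A(2)] r(2) by (simp_all add: k_def P_def)
      have lim: "(\<lambda>n. dev (k n) \<bullet> dev (k n)) \<longlonglongrightarrow> A"
        using A(3) by (simp add: k_def o_def)
      \<comment> \<open>The maximum norm stays above \<epsilon>/4 along the subsequence, which keeps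
        the limit A away from 0.\<close>
      have "(\<epsilon> / 4)\<^sup>2 \<le> dev (k n) \<bullet> dev (k n)" for n
      proof -
        have "(\<epsilon> / 4)\<^sup>2 \<le> (linf_norm (dev (k n)))\<^sup>2"
          using k(3)[of n] \<epsilon> by (intro power_mono) auto
        then show ?thesis
          using linf_norm_sq_le[of "dev (k n)"] by linarith
      qed
      then have "(\<epsilon> / 4)\<^sup>2 \<le> A"
        using LIMSEQ_le_const[OF lim] by blast
      then have "0 < A"
        using \<epsilon> by (smt (verit) zero_less_power divide_pos_pos)
      moreover have "\<not> (\<lambda>n. linf_norm (dev (k n))) \<longlonglongrightarrow> 0"
      proof
        assume "(\<lambda>n. linf_norm (dev (k n))) \<longlonglongrightarrow> 0"
        then have "\<epsilon> / 4 \<le> 0"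
          using k(3) by (intro LIMSEQ_le_const) (auto intro: less_imp_le)
        then show False
          using \<epsilon> by simp
      qed
      ultimately show False
        using no k(1,2) lim by blast
    qed
    have "4 * L * C * (real (p n) / real n) / (\<delta> * \<rho>) \<le> \<epsilon> / 4" if n: "1 \<le> n" for n
    proof -
      have "4 * L * C * (real (p n) / real n) / (\<delta> * \<rho>) \<le> 4 * L * C * 1 / (\<delta> * \<rho>)"
        using p_less[OF n] L C \<delta>_pos \<rho> n by (intro divide_right_mono mult_left_mono) auto
      also have "\<dots> \<le> \<epsilon> / 4"
      proof -
        have "4 * L * C / \<delta> / (\<epsilon> / 4) \<le> \<rho>"
          using s0 by (simp add: \<rho>_def)
        then have "4 * L * C / \<delta> \<le> \<rho> * (\<epsilon> / 4)"
          using \<epsilon> by (subst (asm) pos_divide_le_eq) auto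
        then have "4 * L * C / \<delta> / \<rho> \<le> \<epsilon> / 4"
          using \<rho> by (subst pos_divide_le_eq) (auto simp: mult.commute)
        then show ?thesis
          by simp
      qed
      finally show ?thesis .
    qed
    then show "\<forall>\<^sub>F n in sequentially. 4 * L * (4 * \<sigma>\<^sub>0\<^sup>2 + b) * (real (p n) / real n) / (\<delta> * \<rho>) \<le> \<epsilon> / 4"
      unfolding C_def[symmetric] by (rule eventually_mono[OF eventually_ge_at_top])
    have "sqrt (16 * \<sigma>\<^sub>0\<^sup>2 * L) \<le> \<rho>"
      using \<rho>1 by (simp add: \<rho>_def)
    then have "16 * \<sigma>\<^sub>0\<^sup>2 * L \<le> \<rho>\<^sup>2"
      by (rule sqrt_le_D)
    then have "4 * \<sigma>\<^sub>0\<^sup>2 \<le> \<rho>\<^sup>2 / (4 * L)"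
      using L by (simp add: field_simps)
    then have le: "4 * \<sigma>\<^sub>0\<^sup>2 * real n \<le> real n * \<rho>\<^sup>2 / (4 * L)" for n
      using mult_right_mono[of "4 * \<sigma>\<^sub>0\<^sup>2" "\<rho>\<^sup>2 / (4 * L)" "real n"] by (simp add: mult.commute)
    show "AE \<omega> in M. \<forall>\<^sub>F n in sequentially. form n (proj_err n \<omega>) \<le> real n * \<rho>\<^sup>2 / (4 * L)"
      using AE_form_proj_err_le
    proof eventually_elim
      case (elim \<omega>)
      then show ?case
        by (rule eventually_mono) (use le order_trans in blast)
    qed
  qed
qed

lemma inconsistent_subsequence:
  assumes \<alpha>0: "\<alpha> \<noteq> 0" and k: "strict_mono k"
    and lim: "(\<lambda>n. dev (k n) \<bullet> dev (k n)) \<longlonglongrightarrow> A" and nlim: "\<not> (\<lambda>n. linf_norm (dev (k n))) \<longlonglongrightarrow> 0"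
  obtains \<epsilon> where "0 < \<epsilon>" "\<not> (AE \<omega> in M. (\<lambda>n. post \<epsilon> n \<omega>) \<longlonglongrightarrow> 0)"
proof -
  define \<kappa> where "\<kappa> = \<sigma>\<^sub>0\<^sup>2 * \<delta> * ln 2 / 4"
  have \<kappa>: "0 < \<kappa>"
    using sigma0 \<delta>_pos by (simp add: \<kappa>_def)
  \<comment> \<open>Eventual upper bound for g + 1 from \<open>g_EB_le\<close> at indices with
    squared deviation below A + 1; \<alpha>/2 is an eventual lower bound for p/n.\<close>
  define Q where "Q = 1 + (1 + \<bar>a\<bar>) * (2 * (4 * \<sigma>\<^sub>0\<^sup>2) + 2 * (\<bar>A\<bar> + 1) / lmin) / (\<kappa> * (\<alpha> / 2))"
  have \<alpha>: "0 < \<alpha>"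
    using \<alpha>0 alpha by simp
  have Q: "1 \<le> Q"
    using lmin \<kappa> \<alpha> by (auto simp: Q_def intro!: divide_nonneg_nonneg mult_nonneg_nonneg add_nonneg_nonneg)
  obtain \<eta> where \<eta>0: "0 < \<eta>" "\<not> (\<forall>\<^sub>F n in sequentially. dist (linf_norm (dev (k n))) 0 < \<eta>)"
    using nlim unfolding tendsto_iff by blast
  have \<eta>: "0 < \<eta>" "\<exists>\<^sub>F n in sequentially. \<eta> \<le> linf_norm (dev (k n))"
    using \<eta>0 unfolding frequently_def by (simp_all add: not_le dist_real_def linf_norm_nonneg)
  have "\<forall>\<^sub>F n in sequentially. dev (k n) \<bullet> dev (k n) < A + 1"
    by (rule order_tendstoD[OF lim]) simp
  then have "\<exists>\<^sub>F n in sequentially. \<eta> \<le> linf_norm (dev (k n)) \<and> dev (k n) \<bullet> dev (k n) < A + 1"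
    by (rule frequently_eventually_frequently[OF \<eta>(2)])
  \<comment> \<open>The subsequence is traded for infinitely many indices of the original
    sequence.\<close>
  then have freq: "\<exists>\<^sub>F n in sequentially. \<eta> \<le> linf_norm (dev n) \<and> dev n \<bullet> dev n < A + 1"
    unfolding frequently_def using eventually_subseq[OF k] by blast
  \<comment> \<open>The bias is at least \<eta>/Q = 4 \<epsilon> infinitely often; an estimation
    error of at most \<epsilon> then leaves the posterior mean farther than \<epsilon> from
    \<open>\<beta>\<^sub>0\<close>.\<close>
  define \<epsilon> where "\<epsilon> = \<eta> / (4 * Q)"
  have \<epsilon>: "0 < \<epsilon>"
    using \<eta>(1) Q by (simp add: \<epsilon>_def)
  have "\<not> (AE \<omega> in M. (\<lambda>n. post \<epsilon> n \<omega>) \<longlonglongrightarrow> 0)"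
  proof
    assume "AE \<omega> in M. (\<lambda>n. post \<epsilon> n \<omega>) \<longlonglongrightarrow> 0"
    moreover have "AE \<omega> in M. \<omega> \<in> space M"
      by simp
    ultimately have "AE \<omega> in M. False"
      using AE_form_proj_err_le AE_linf_proj_err[OF \<epsilon>] AE_resid_pos AE_resid_lower
    proof eventually_elim
      case \<omega>: (elim \<omega>)
      have p_lower: "\<forall>\<^sub>F n in sequentially. \<alpha> / 2 < real (p n) / real n"
        by (rule order_tendstoD[OF p_lim]) (use \<alpha> in simp)
      have "\<forall>\<^sub>F n in sequentially. post \<epsilon> n \<omega> < ennreal (1 / 2)"
        by (rule order_tendstoD[OF \<omega>(1)]) (subst ennreal_less_zero_iff, simp)
      then have "\<forall>\<^sub>F n in sequentially. \<not> (\<eta> \<le> linf_norm (dev n) \<and> dev n \<bullet> dev n < A + 1)"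
        using \<omega>(3,4,6) p_lower eventually_ge_at_top[of 4]
      proof eventually_elim
        case (elim n)
        have n: "1 \<le> n" and n4: "4 \<le> real n"
          using elim(6) by auto
        have s: "0 < resid n \<omega>"
          using \<omega>(5) n by blast
        interpret E: gaussian_errors "p n" "X n" n M "e n" \<sigma>\<^sub>0
          by (rule gaussian_errors[OF n])
        interpret P: g_posterior "p n" "X n" n a b "resid n \<omega>" "gEB n \<omega>" "\<beta>\<^sub>0 n + proj_err n \<omega>" "\<gamma> n"
          by (rule g_posterior[OF n \<omega>(2) s])
        have z: "proj_err n \<omega> \<in> carrier_vec (p n)"
          unfolding proj_err_def by (rule E.err_proj_carrier[OF E.e_carrier[OF \<omega>(2)]])
        have pn: "\<alpha> / 2 * real n \<le> real (p n)"
          using elim(5) n by (simp add: field_simps)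
        show ?case
        proof
          assume dev: "\<eta> \<le> linf_norm (dev n) \<and> dev n \<bullet> dev n < A + 1"
          have "gEB n \<omega> \<le> (1 + \<bar>a\<bar>) * (2 * (4 * \<sigma>\<^sub>0\<^sup>2) + 2 * (\<bar>A\<bar> + 1) / lmin) / (\<kappa> * (\<alpha> / 2))"
            unfolding gEB_def
          proof (rule E.g_EB_le[OF eigenvalues[OF n] lmin L z beta0_dim[OF n] gamma_dim[OF n]])
            show "(\<gamma> n - \<beta>\<^sub>0 n) \<bullet> (\<gamma> n - \<beta>\<^sub>0 n) \<le> \<bar>A\<bar> + 1"
              using dev unfolding dev_def by linarith
            show "E.q (proj_err n \<omega>) \<le> 4 * \<sigma>\<^sub>0\<^sup>2 * real n"
              using elim(2) by (simp only: form_def)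
            show "\<kappa> * real n \<le> resid n \<omega>"
              using elim(4) by (simp only: \<kappa>_def)
          qed (use \<kappa> prior_params pn \<alpha> in auto)
          then have g: "gEB n \<omega> + 1 \<le> Q" "0 < gEB n \<omega> + 1"
            using E.g_EB_nonneg[of "\<gamma> n" a b "\<beta>\<^sub>0 n + proj_err n \<omega>" "resid n \<omega>"] by (auto simp: Q_def gEB_def)
          have "\<eta> / Q \<le> linf_norm (dev n) / (gEB n \<omega> + 1)"
            using dev g \<eta>(1) by (intro frac_le) auto
          moreover have "\<eta> / Q = 4 * \<epsilon>"
            using Q by (simp add: \<epsilon>_def)
          ultimately have "\<epsilon> < linf_norm (P.post_mean - \<beta>\<^sub>0 n)"
            using P.post_mean_deviation(2)[OF beta0_dim[OF n] z refl] elim(3) \<epsilon> unfolding dev_def by linarith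
          then have "ennreal (1 / 2) \<le> post \<epsilon> n \<omega>"
            unfolding post_def EB_posterior_prob_def gEB_def[symmetric]
            using prior_params n4 \<epsilon> by (intro P.posterior_prob_ge_half beta0_dim[OF n]) auto
          then show False
            using elim(1) by (simp add: not_le[symmetric])
        qed
      qed
      then show False
        using freq unfolding frequently_def by blast
    qed
    then show False
      by simp
  qed
  then show thesis
    using that \<epsilon> by blast
qed

text \<open>Index 0 lies outside the model, so the two sequences are compared from n = 1 on, which
  is enough for their limits.\<close>

lemma posterior_consistency_iff:
  assumes Y: "\<And>n \<omega>. 1 \<le> n \<Longrightarrow> Y n \<omega> = X n *\<^sub>v \<beta>\<^sub>0 n + e n \<omega>" and \<omega>: "\<omega> \<in> space M"
  shows "(\<lambda>n. EB_posterior_prob (X n) (\<gamma> n) a b (ols (X n) (Y n \<omega>)) (rss (X n) (Y n \<omega>))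
      {\<beta> \<in> carrier_vec (p n). \<epsilon> < linf_norm (\<beta> - \<beta>\<^sub>0 n)}) \<longlonglongrightarrow> 0 \<longleftrightarrow> (\<lambda>n. post \<epsilon> n \<omega>) \<longlonglongrightarrow> 0"
proof (rule tendsto_cong, rule eventually_mono[OF eventually_ge_at_top[of 1]])
  fix n :: nat assume n: "1 \<le> n"
  interpret E: gaussian_errors "p n" "X n" n M "e n" \<sigma>\<^sub>0
    by (rule gaussian_errors[OF n])
  note model = beta0_dim[OF n] E.e_carrier[OF \<omega>]
  show "EB_posterior_prob (X n) (\<gamma> n) a b (ols (X n) (Y n \<omega>)) (rss (X n) (Y n \<omega>))
      {\<beta> \<in> carrier_vec (p n). \<epsilon> < linf_norm (\<beta> - \<beta>\<^sub>0 n)} = post \<epsilon> n \<omega>"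
    unfolding post_def Y[OF n] E.ols_model[OF model] E.rss_model[OF model] proj_err_def resid_def ..
qed

end

theorem theorem2:
  fixes M :: "'w measure"
    and p :: "nat \<Rightarrow> nat"
    and X :: "nat \<Rightarrow> real mat"
    and e :: "nat \<Rightarrow> 'w \<Rightarrow> real Matrix.vec"
    and Y :: "nat \<Rightarrow> 'w \<Rightarrow> real Matrix.vec"
    and \<beta>\<^sub>0 \<gamma> :: "nat \<Rightarrow> real Matrix.vec"
    and \<sigma>\<^sub>0 \<alpha> a b lmin lmax :: real
  assumes p_mono: "\<And>m n. 1 \<le> m \<Longrightarrow> m \<le> n \<Longrightarrow> p m \<le> p n"
    and p_less: "\<And>n. 1 \<le> n \<Longrightarrow> p n < n"
    and p_lim: "(\<lambda>n. real (p n) / real n) \<longlonglongrightarrow> \<alpha>"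
    and alpha: "0 \<le> \<alpha>" "\<alpha> < 1"
    and X_dim: "\<And>n. 1 \<le> n \<Longrightarrow> X n \<in> carrier_mat n (p n)"
    and X_rank: "\<And>n. 1 \<le> n \<Longrightarrow> vec_space.rank n (X n) = p n"
    and lmin: "0 < lmin"
    and eigenvalues: "\<And>n l. 1 \<le> n \<Longrightarrow> eigenvalue (real n \<cdot>\<^sub>m gram_inv (X n)) l
                        \<Longrightarrow> lmin \<le> l \<and> l \<le> lmax"
    and gamma_dim: "\<And>n. 1 \<le> n \<Longrightarrow> \<gamma> n \<in> carrier_vec (p n)"
    and beta0_dim: "\<And>n. 1 \<le> n \<Longrightarrow> \<beta>\<^sub>0 n \<in> carrier_vec (p n)"
    and sigma0: "0 < \<sigma>\<^sub>0"
    and prior_params: "- 2 \<le> a" "0 \<le> b"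
    and prob: "prob_space M"
    and errors: "\<And>n. 1 \<le> n \<Longrightarrow>
          distributed M (vec_lborel n) (e n)
            (\<lambda>x. ennreal (mvn_density (0\<^sub>v n) (\<sigma>\<^sub>0\<^sup>2 \<cdot>\<^sub>m 1\<^sub>m n) x))"
    and model: "\<And>n \<omega>. 1 \<le> n \<Longrightarrow> Y n \<omega> = X n *\<^sub>v \<beta>\<^sub>0 n + e n \<omega>"
  shows
    "(\<forall>\<epsilon>>0. AE \<omega> in M.
        (\<lambda>n. EB_posterior_prob (X n) (\<gamma> n) a b (ols (X n) (Y n \<omega>)) (rss (X n) (Y n \<omega>))
               {\<beta> \<in> carrier_vec (p n). \<epsilon> < linf_norm (\<beta> - \<beta>\<^sub>0 n)}) \<longlonglongrightarrow> 0)
     \<longleftrightarrow>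
     (\<alpha> = 0 \<or>
      \<not> (\<exists>k A. strict_mono k \<and> (\<forall>n. 1 \<le> k n) \<and> 0 < A
             \<and> (\<lambda>n. (l2_norm (\<gamma> (k n) - \<beta>\<^sub>0 (k n)))\<^sup>2) \<longlonglongrightarrow> A
             \<and> \<not> (\<lambda>n. linf_norm (\<gamma> (k n) - \<beta>\<^sub>0 (k n))) \<longlonglongrightarrow> 0))"
proof -
  interpret prob_space M
    by (rule prob)
  \<comment> \<open>The locale asks for a positive upper bound; when every p n is 0 there are no
    eigenvalues and \<open>lmax\<close> may have any sign, hence the maximum with
    \<open>lmin\<close>.\<close>
  interpret linear_model_sequence M p X e \<beta>\<^sub>0 \<gamma> \<sigma>\<^sub>0 \<alpha> a b lmin "max lmin lmax"
    by unfold_locales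
      (use p_less p_lim alpha X_dim X_rank lmin eigenvalues gamma_dim beta0_dim sigma0 prior_params errors in
        \<open>auto simp: le_max_iff_disj\<close>)
  let ?S = "\<exists>k A. strict_mono k \<and> (\<forall>n. 1 \<le> k n) \<and> 0 < A \<and>
    (\<lambda>n. dev (k n) \<bullet> dev (k n)) \<longlonglongrightarrow> A \<and> \<not> (\<lambda>n. linf_norm (dev (k n))) \<longlonglongrightarrow> 0"
  have AE_iff: "(AE \<omega> in M. (\<lambda>n. EB_posterior_prob (X n) (\<gamma> n) a b (ols (X n) (Y n \<omega>)) (rss (X n) (Y n \<omega>))
      {\<beta> \<in> carrier_vec (p n). \<epsilon> < linf_norm (\<beta> - \<beta>\<^sub>0 n)}) \<longlonglongrightarrow> 0) \<longleftrightarrow>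
    (AE \<omega> in M. (\<lambda>n. post \<epsilon> n \<omega>) \<longlonglongrightarrow> 0)" for \<epsilon>
    by (rule AE_cong) (rule posterior_consistency_iff[OF model])
  have "(\<forall>\<epsilon>>0. AE \<omega> in M. (\<lambda>n. post \<epsilon> n \<omega>) \<longlonglongrightarrow> 0) \<longleftrightarrow> \<alpha> = 0 \<or> \<not> ?S"
  proof
    assume *: "\<forall>\<epsilon>>0. AE \<omega> in M. (\<lambda>n. post \<epsilon> n \<omega>) \<longlonglongrightarrow> 0"
    show "\<alpha> = 0 \<or> \<not> ?S"
    proof (rule ccontr)
      assume "\<not> (\<alpha> = 0 \<or> \<not> ?S)"
      then obtain k A where \<alpha>: "\<alpha> \<noteq> 0" and k: "strict_mono k" "(\<lambda>n. dev (k n) \<bullet> dev (k n)) \<longlonglongrightarrow> A"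
        "\<not> (\<lambda>n. linf_norm (dev (k n))) \<longlonglongrightarrow> 0"
        by blast
      show False
        using inconsistent_subsequence[OF \<alpha> k] * by blast
    qed
  next
    assume "\<alpha> = 0 \<or> \<not> ?S"
    then show "\<forall>\<epsilon>>0. AE \<omega> in M. (\<lambda>n. post \<epsilon> n \<omega>) \<longlonglongrightarrow> 0"
      using consistent_alpha_0 consistent_no_subsequence by blast
  qed
  then show ?thesis
    unfolding AE_iff l2_norm_sq dev_def .
qed

end
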